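(* Let $N\ge2$ and $p\in(1,+\infty)$. There exists a constant $C_{\mathcal{W}}=C_{\mathcal{W}}(p,N)>0$ such that for every bounded Lipschitz domain $\Omega\subset\mathbb{R}^N$, $$\lim_{k\to+\infty}\frac{\lambda_k(p;\Omega)}{k^{p/N}}=\frac{C_{\mathcal{W}}}{|\Omega|^{p/N}},$$ where $\{\lambda_k(p;\Omega)\}$ are the cogenus eigenvalues of the Dirichlet $p$-Laplacian in $\Omega$.
   Context: $|\Omega|$ is Lebesgue measure. Let $\mathcal{S}(\Omega)=\{u\in W_0^{1,p}(\Omega):\int_\Omega|u|^p\,dx=1\}$ (with the topology of $W_0^{1,p}(\Omega)$) and $E(u)=\int_\Omega|\nabla u|^p\,dx$. The cogenus eigenvalues are $$\lambda_k(p;\Omega)=\inf_h\max_{u\in h(\mathbb{S}^{k-1})}E(u),\quad k\in\mathbb{N}=\{1,2,\dots\},$$ the infimum being over all continuous odd maps $h:\mathbb{S}^{k-1}\to\mathcal{S}(\Omega)$, with $\mathbb{S}^{k-1}$ the unit sphere in $\mathbb{R}^k$. *)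

theory Defs
  imports "HOL-Analysis.Analysis"
begin

text \<open>
  Functions on an open set \<open>\<Omega>\<close> are represented by total functions on \<open>real^'n\<close> whose values
  outside \<open>\<Omega>\<close> are irrelevant: all measurability, integrability and almost-everywhere
  conditions refer to \<open>lebesgue_on \<Omega>\<close>.  Elements of Lebesgue and Sobolev spaces are
  representatives, two of them being identified when they agree almost everywhere on \<open>\<Omega>\<close>.
\<close>

section \<open>Lipschitz domains\<close>

definition domain :: "(real^'n) set \<Rightarrow> bool" where
  "domain \<Omega> \<longleftrightarrow> open \<Omega> \<and> connected \<Omega> \<and> \<Omega> \<noteq> {}"

text \<open>
  Near each boundary point there is a unit vector \<open>e\<close> (the last axis of a rotated coordinate
  system) such that \<open>\<Omega>\<close> is the strict epigraph, in direction \<open>e\<close>, of a Lipschitz function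
  \<open>\<gamma>\<close> of the coordinates in the hyperplane orthogonal to \<open>e\<close>.
\<close>

definition lipschitz_boundary :: "(real^'n) set \<Rightarrow> bool" where
  "lipschitz_boundary \<Omega> \<longleftrightarrow>
     (\<forall>x\<in>frontier \<Omega>. \<exists>r>0. \<exists>e \<gamma> L. norm e = 1 \<and> L-lipschitz_on {v. v \<bullet> e = 0} \<gamma> \<and>
        \<Omega> \<inter> ball x r = {y \<in> ball x r. \<gamma> (y - (y \<bullet> e) *\<^sub>R e) < y \<bullet> e})"

definition bounded_lipschitz_domain :: "(real^'n) set \<Rightarrow> bool" where
  "bounded_lipschitz_domain \<Omega> \<longleftrightarrow> bounded \<Omega> \<and> domain \<Omega> \<and> lipschitz_boundary \<Omega>"

section \<open>Test functions and weak gradients\<close>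

primrec Ck :: "nat \<Rightarrow> (real^'n \<Rightarrow> real) \<Rightarrow> bool" where
  "Ck 0 f \<longleftrightarrow> continuous_on UNIV f"
| "Ck (Suc m) f \<longleftrightarrow> (\<forall>x. f differentiable (at x)) \<and>
     (\<forall>v. Ck m (\<lambda>x. frechet_derivative f (at x) v))"

definition test_functions :: "(real^'n) set \<Rightarrow> (real^'n \<Rightarrow> real) set" where
  "test_functions \<Omega> =
     {\<phi>. (\<forall>m. Ck m \<phi>) \<and> compact (closure {x. \<phi> x \<noteq> 0}) \<and> closure {x. \<phi> x \<noteq> 0} \<subseteq> \<Omega>}"

definition partial_deriv :: "'n \<Rightarrow> (real^'n \<Rightarrow> real) \<Rightarrow> real^'n \<Rightarrow> real" where
  "partial_deriv i \<phi> x = frechet_derivative \<phi> (at x) (axis i 1)"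

definition locally_integrable :: "(real^'n) set \<Rightarrow> (real^'n \<Rightarrow> 'b::euclidean_space) \<Rightarrow> bool" where
  "locally_integrable \<Omega> f \<longleftrightarrow> (\<forall>K. compact K \<and> K \<subseteq> \<Omega> \<longrightarrow> integrable (lebesgue_on K) f)"

definition is_weak_gradient ::
    "(real^'n) set \<Rightarrow> (real^'n \<Rightarrow> real) \<Rightarrow> (real^'n \<Rightarrow> real^'n) \<Rightarrow> bool" where
  "is_weak_gradient \<Omega> u G \<longleftrightarrow>
     locally_integrable \<Omega> u \<and> locally_integrable \<Omega> G \<and>
     (\<forall>\<phi>\<in>test_functions \<Omega>. \<forall>i.
        (\<integral>x. u x * partial_deriv i \<phi> x \<partial>lebesgue_on \<Omega>) = - (\<integral>x. G x $ i * \<phi> x \<partial>lebesgue_on \<Omega>))"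

text \<open>Weak gradients on an open set are unique up to null sets, so the choice is immaterial below.\<close>

definition weak_gradient :: "(real^'n) set \<Rightarrow> (real^'n \<Rightarrow> real) \<Rightarrow> real^'n \<Rightarrow> real^'n" where
  "weak_gradient \<Omega> u = (SOME G. is_weak_gradient \<Omega> u G)"

section \<open>Sobolev spaces\<close>

definition Lp_fun :: "real \<Rightarrow> (real^'n) set \<Rightarrow> (real^'n \<Rightarrow> 'b::euclidean_space) set" where
  "Lp_fun p \<Omega> =
     {f \<in> borel_measurable (lebesgue_on \<Omega>). integrable (lebesgue_on \<Omega>) (\<lambda>x. norm (f x) powr p)}"

definition sobolev :: "real \<Rightarrow> (real^'n) set \<Rightarrow> (real^'n \<Rightarrow> real) set" where
  "sobolev p \<Omega> = {u \<in> Lp_fun p \<Omega>. \<exists>G\<in>Lp_fun p \<Omega>. is_weak_gradient \<Omega> u G}"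

definition dirichlet_energy :: "real \<Rightarrow> (real^'n) set \<Rightarrow> (real^'n \<Rightarrow> real) \<Rightarrow> real" where
  "dirichlet_energy p \<Omega> u = (\<integral>x. norm (weak_gradient \<Omega> u x) powr p \<partial>lebesgue_on \<Omega>)"

definition sobolev_norm :: "real \<Rightarrow> (real^'n) set \<Rightarrow> (real^'n \<Rightarrow> real) \<Rightarrow> real" where
  "sobolev_norm p \<Omega> u =
     ((\<integral>x. \<bar>u x\<bar> powr p \<partial>lebesgue_on \<Omega>) + dirichlet_energy p \<Omega> u) powr (1 / p)"

definition sobolev0 :: "real \<Rightarrow> (real^'n) set \<Rightarrow> (real^'n \<Rightarrow> real) set" where
  "sobolev0 p \<Omega> =
     {u \<in> sobolev p \<Omega>. \<forall>\<epsilon>>0. \<exists>\<phi>\<in>test_functions \<Omega>. sobolev_norm p \<Omega> (\<lambda>x. u x - \<phi> x) < \<epsilon>}"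

text \<open>
  The norm topology, as the topology generated by the open balls.  On representatives the norm is
  only a seminorm, so functions that agree almost everywhere are topologically indistinguishable;
  a map of representatives is continuous iff the induced map into the quotient is.
\<close>

definition sobolev0_topology :: "real \<Rightarrow> (real^'n) set \<Rightarrow> (real^'n \<Rightarrow> real) topology" where
  "sobolev0_topology p \<Omega> = topology_generated_by
     {{v \<in> sobolev0 p \<Omega>. sobolev_norm p \<Omega> (\<lambda>x. v x - u x) < r} | u r. u \<in> sobolev0 p \<Omega> \<and> 0 < r}"

definition Lp_sphere :: "real \<Rightarrow> (real^'n) set \<Rightarrow> (real^'n \<Rightarrow> real) set" where
  "Lp_sphere p \<Omega> = {u \<in> sobolev0 p \<Omega>. (\<integral>x. \<bar>u x\<bar> powr p \<partial>lebesgue_on \<Omega>) = 1}"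

section \<open>Cogenus eigenvalues\<close>

text \<open>
  The unit sphere of \<open>k\<close>-dimensional Euclidean space is \<open>nsphere (k - 1)\<close>, for \<open>k \<ge> 1\<close>.
  Oddness is an identity between elements of the Sobolev space, hence almost everywhere.
\<close>

definition odd_maps ::
    "real \<Rightarrow> (real^'n) set \<Rightarrow> nat \<Rightarrow> ((nat \<Rightarrow> real) \<Rightarrow> real^'n \<Rightarrow> real) set" where
  "odd_maps p \<Omega> k =
     {h. continuous_map (nsphere (k - 1)) (subtopology (sobolev0_topology p \<Omega>) (Lp_sphere p \<Omega>)) h \<and>
         (\<forall>\<xi>\<in>topspace (nsphere (k - 1)). AE x in lebesgue_on \<Omega>. h (\<lambda>i. - \<xi> i) x = - h \<xi> x)}"

text \<open>
  The supremum is a maximum, since the sphere is compact and the energy is continuous.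
  Only \<open>k \<ge> 1\<close> is meaningful.
\<close>

definition cogenus_eigenvalue :: "real \<Rightarrow> (real^'n) set \<Rightarrow> nat \<Rightarrow> real" where
  "cogenus_eigenvalue p \<Omega> k =
     (INF h\<in>odd_maps p \<Omega> k. SUP u\<in>h ` topspace (nsphere (k - 1)). dirichlet_energy p \<Omega> u)"

end

theory Submission
  imports Defs "HOL-Homology.Simplices"
begin

text \<open>
  Let \<open>c\<^sub>\<Omega>(\<mu>)\<close> be the largest \<open>k\<close> for which some odd map of the sphere of dimension \<open>k - 1\<close> has
  energy at most \<open>\<mu>\<close>.  Joins of odd maps whose values have disjoint supports show that it is
  superadditive over disjoint open subsets, and it scales under dilations; hence
  \<open>c\<^sub>Q(\<mu>) / \<mu> powr (N / p)\<close> converges for a cube \<open>Q\<close>.  The limit is finite: by the Borsuk--Ulam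
  theorem an odd map of a sphere of large dimension attains a function whose averages over all
  cells of a fine grid vanish, and a Poincare inequality bounds its energy from below.  For a
  general \<open>\<Omega>\<close>, filling \<open>\<Omega>\<close> with cubes gives the lower asymptotic bound, and filling the
  complement of \<open>\<Omega>\<close> in a large cube gives the upper one, because the boundary of \<open>\<Omega>\<close> is a null
  set.  Only Dirichlet problems occur in the argument.
\<close>

section \<open>The Borsuk--Ulam theorem\<close>

text \<open>Joins give inequalities in one direction only. What closes the argument is that a cube
  has an exact limit \<open>L\<close>: a surplus in \<Omega> would force a deficit in the rest of a
  surrounding cube, which the lower bound excludes. The eigenvalues come back by inverting the
  asymptotic count \<open>L * |\<Omega>| * \<mu> powr (N / p)\<close>, so the constant is
  \<open>L powr (- p / N)\<close>, with \<open>L\<close> the limit for the unit cube.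

  Odd maps need not be linear, so a function with vanishing averages cannot be found by counting
  dimensions; this is the role of Borsuk--Ulam, proved here by evaluating a mod 2 cup product on
  explicit chains that fill hemispheres.

  Norms occur only as p-th powers. Two elementary inequalities with a free parameter,
  \<open>norm_add_powr\<close> and \<open>young_split\<close>, do the work of the Minkowski and
  Hoelder inequalities. Odd maps of spheres are handled as homogeneous maps of vector spaces
  (\<open>adm\<close>), for which the join is a plain sum and dimension 0 is allowed.\<close>

definition coface :: "nat \<Rightarrow> (nat \<Rightarrow> 'a) \<Rightarrow> nat \<Rightarrow> 'a" where
  "coface i v = (\<lambda>j. if j < i then v j else v (Suc j))"

text \<open>
  For cochains \<open>s 0, s 1, \<dots>\<close> mod 2 on points, this is the cup product of the coboundaries of
  \<open>s (k - 1), \<dots>, s 0\<close> on the ordered simplex with vertices \<open>v 0, \<dots>, v k\<close>.  It is a cocycle, and it is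
  the coboundary of the cup product of \<open>s (k - 1)\<close> with the product of one degree less.
\<close>

primrec cup_prod :: "(nat \<Rightarrow> 'a \<Rightarrow> int) \<Rightarrow> nat \<Rightarrow> (nat \<Rightarrow> 'a) \<Rightarrow> int" where
  "cup_prod s 0 v = 1"
| "cup_prod s (Suc k) v = (s k (v 0) + s k (v 1)) * cup_prod s k (\<lambda>j. v (Suc j))"

lemma coface_shift: "(\<lambda>j. coface (Suc i) v (Suc j)) = coface i (\<lambda>j. v (Suc j))"
  by (auto simp: coface_def)

lemma coface_zero: "coface 0 v = (\<lambda>j. v (Suc j))"
  by (auto simp: coface_def)

text \<open>Faces 0 and 1 share the factor \<open>?W\<close>, and \<open>s k (v 2)\<close> cancels
  mod 2. All later faces keep the first edge and run through the faces of the tail. What remains is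
  \<open>s k (v 0) + s k (v 1)\<close> times the full face sum of the tail, which is even by
  induction.\<close>

lemma cup_prod_cocycle: "even (\<Sum>i\<le>Suc k. cup_prod s k (coface i v))"
proof (induction k arbitrary: v)
  case 0
  show ?case by simp
next
  case (Suc k)
  let ?v = "\<lambda>j. v (Suc j)"
  let ?W = "cup_prod s k (\<lambda>j. v (Suc (Suc j)))"
  let ?S = "\<Sum>i\<le>k. cup_prod s k (coface (Suc i) ?v)"
  have "even (cup_prod s k (coface 0 ?v) + ?S)"
    using Suc.IH[of ?v] by (simp only: sum.atMost_Suc_shift)
  then have ev: "even (?W + ?S)" by (simp add: coface_zero)
  have 0: "cup_prod s (Suc k) (coface 0 v) = (s k (v 1) + s k (v 2)) * ?W"
    by (simp add: coface_zero numeral_2_eq_2)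
  have 1: "cup_prod s (Suc k) (coface (Suc 0) v) = (s k (v 0) + s k (v 2)) * ?W"
    by (simp add: coface_shift coface_zero) (simp add: coface_def numeral_2_eq_2)
  have 2: "cup_prod s (Suc k) (coface (Suc (Suc i)) v)
        = (s k (v 0) + s k (v 1)) * cup_prod s k (coface (Suc i) ?v)" for i
    by (simp add: coface_shift) (simp add: coface_def)
  have "(\<Sum>i\<le>Suc (Suc k). cup_prod s (Suc k) (coface i v))
     = (s k (v 1) + s k (v 2)) * ?W + (s k (v 0) + s k (v 2)) * ?W + (s k (v 0) + s k (v 1)) * ?S"
    by (simp only: sum.atMost_Suc_shift 0 1 2 sum_distrib_left add.assoc)
  then show ?case using ev by auto
qed

text \<open>Only face 0 starts at \<open>v 1\<close>; all others start at \<open>v 0\<close>. By the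
  cocycle property the products on those others sum, mod 2, to the product on face 0, so the total
  coefficient of the latter is \<open>s k (v 0) + s k (v 1)\<close>.\<close>

lemma cup_prod_coboundary:
  "even ((\<Sum>i\<le>Suc k. s k (coface i v 0) * cup_prod s k (coface i v)) - cup_prod s (Suc k) v)"
proof -
  let ?S = "\<Sum>i\<le>k. cup_prod s k (coface (Suc i) v)"
  have "even (cup_prod s k (coface 0 v) + ?S)"
    using cup_prod_cocycle[of s k v] by (simp only: sum.atMost_Suc_shift)
  moreover have "(\<Sum>i\<le>Suc k. s k (coface i v 0) * cup_prod s k (coface i v))
     = s k (v 1) * cup_prod s k (coface 0 v) + s k (v 0) * ?S"
    by (simp only: sum.atMost_Suc_shift sum_distrib_left) (simp add: coface_def)
  ultimately show ?thesis by (auto simp: coface_zero)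
qed

text \<open>Reflecting both ends of an edge turns \<open>a + b\<close> into
  \<open>2 - (a + b)\<close>, so every factor keeps its parity.\<close>

lemma cup_prod_flip:
  assumes "\<And>i j. j \<le> k \<Longrightarrow> s i (g (v j)) = 1 - s i (v j)"
  shows "even (cup_prod s k (\<lambda>j. g (v j)) - cup_prod s k v)"
  using assms
proof (induction k arbitrary: v)
  case (Suc k)
  have "even (cup_prod s k (\<lambda>j. g (v (Suc j))) - cup_prod s k (\<lambda>j. v (Suc j)))"
    using Suc.prems by (intro Suc.IH) auto
  then show ?case using Suc.prems[of 0 k] Suc.prems[of 1 k] by auto
qed simp

text \<open>An odd product has only odd factors, and the factor stemming from \<open>s i\<close>
  compares \<open>s i\<close> at the two ends of one edge.\<close>

lemma odd_cup_prod_imp: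
  assumes "odd (cup_prod s k v)" "i < k"
  obtains j where "j < k" "odd (s i (v j) + s i (v (Suc j)))"
  using assms
proof (induction k arbitrary: v thesis)
  case (Suc k)
  show ?case
  proof (cases "i = k")
    case True
    with Suc.prems(2) have "odd (s i (v 0) + s i (v (Suc 0)))" by simp
    then show ?thesis by (rule Suc.prems(1)[OF zero_less_Suc])
  next
    case False
    then have "i < k" using Suc.prems(3) by simp
    moreover have "odd (cup_prod s k (\<lambda>j. v (Suc j)))" using Suc.prems(2) by simp
    ultimately obtain j where "j < k" "odd (s i (v (Suc j)) + s i (v (Suc (Suc j))))"
      using Suc.IH[of "\<lambda>j. v (Suc j)"] by metis
    then show ?thesis using Suc.prems(1)[of "Suc j"] by simp
  qed
qed simp

section \<open>Integer cochains evaluated on singular chains\<close>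

definition chain_eval :: "(((nat \<Rightarrow> real) \<Rightarrow> 'a) \<Rightarrow> int) \<Rightarrow> 'a chain \<Rightarrow> int" where
  "chain_eval a c = poly_mapping.lookup (frag_extend (\<lambda>\<sigma>. frag_cmul (a \<sigma>) (frag_of ())) c) ()"

lemma chain_eval_0 [simp]: "chain_eval a 0 = 0"
  by (simp add: chain_eval_def)

lemma chain_eval_of [simp]: "chain_eval a (frag_of \<sigma>) = a \<sigma>"
  by (simp add: chain_eval_def)

lemma chain_eval_add: "chain_eval a (x + y) = chain_eval a x + chain_eval a y"
  by (simp add: chain_eval_def frag_extend_add lookup_add)

lemma chain_eval_diff: "chain_eval a (x - y) = chain_eval a x - chain_eval a y"
  by (simp add: chain_eval_def frag_extend_diff lookup_minus)

lemma chain_eval_cmul: "chain_eval a (frag_cmul k x) = k * chain_eval a x"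
  by (simp add: chain_eval_def frag_extend_cmul)

lemma chain_eval_sum: "chain_eval a (\<Sum>i\<in>I. f i) = (\<Sum>i\<in>I. chain_eval a (f i))"
  by (induction I rule: infinite_finite_induct) (auto simp: chain_eval_add)

lemma chain_eval_chain_map: "chain_eval a (chain_map p g c) = chain_eval (\<lambda>\<sigma>. a (simplex_map p g \<sigma>)) c"
proof -
  have "Poly_Mapping.keys c \<subseteq> UNIV" by simp
  then show ?thesis
    by (induction c rule: frag_induction) (auto simp: chain_map_diff chain_eval_diff)
qed

lemma chain_eval_add_fun: "chain_eval (\<lambda>\<sigma>. a \<sigma> + b \<sigma>) c = chain_eval a c + chain_eval b c"
proof -
  have "Poly_Mapping.keys c \<subseteq> UNIV" by simp
  then show ?thesis
    by (induction c rule: frag_induction) (auto simp: chain_eval_diff)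
qed

text \<open>The congruence is asked only for simplices in \<open>X\<close>, because the signs used
  later flip under the antipode only at points of the sphere.\<close>

lemma chain_eval_parity:
  assumes "singular_chain p X c" "\<And>\<sigma>. singular_simplex p X \<sigma> \<Longrightarrow> even (a \<sigma> - b \<sigma>)"
  shows "even (chain_eval a c - chain_eval b c)"
  using assms(1) unfolding singular_chain_def
proof (induction c rule: frag_induction)
  case (one x)
  then show ?case using assms(2) by simp
next
  case (diff x y)
  then show ?case unfolding chain_eval_diff by presburger
qed simp

lemma odd_chain_eval_imp_key:
  assumes "odd (chain_eval a c)"
  obtains \<sigma> where "\<sigma> \<in> Poly_Mapping.keys c" "odd (a \<sigma>)"
proof -
  have "chain_eval a c = (\<Sum>\<sigma>\<in>Poly_Mapping.keys c. poly_mapping.lookup c \<sigma> * a \<sigma>)"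
    by (simp add: chain_eval_def frag_extend_def lookup_sum)
  then have "\<exists>\<sigma>\<in>Poly_Mapping.keys c. odd (a \<sigma>)"
    using assms by (metis (no_types, lifting) dvd_mult dvd_sum)
  then show ?thesis using that by blast
qed

abbreviation unit_vec :: "nat \<Rightarrow> nat \<Rightarrow> real" where
  "unit_vec i \<equiv> (\<lambda>j. if j = i then 1 else 0)"

lemma simplical_face_unit_vec:
  "simplical_face k (unit_vec j) = unit_vec (if j < k then j else Suc j)"
  unfolding simplical_face_def by (rule ext) auto

lemma singular_face_unit_vec:
  assumes "j \<le> p"
  shows "singular_face (Suc p) k \<sigma> (unit_vec j) = coface k (\<lambda>j. \<sigma> (unit_vec j)) j"
  using assms by (simp add: singular_face_def simplical_face_unit_vec coface_def)

lemma cup_prod_cong: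
  assumes "\<And>j. j \<le> k \<Longrightarrow> v j = w j"
  shows "cup_prod s k v = cup_prod s k w"
  using assms
proof (induction k arbitrary: v w)
  case (Suc k)
  have "cup_prod s k (\<lambda>j. v (Suc j)) = cup_prod s k (\<lambda>j. w (Suc j))"
    using Suc.prems by (intro Suc.IH) auto
  then show ?case using Suc.prems by auto
qed simp

text \<open>
  The boundary of the \<open>k\<close>-th hemisphere is the sum of the two hemispheres below it, and for an odd
  sign \<open>s\<close> the cochain \<open>s k \<union> cup_prod s k\<close> and its reflection add up to \<open>cup_prod s k\<close>; so the
  value of \<open>cup_prod s k\<close> on the \<open>k\<close>-th hemisphere does not depend on \<open>k\<close> mod 2.
\<close>

lemma odd_hemisphere_eval:
  fixes s :: "nat \<Rightarrow> 'a \<Rightarrow> int"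
  assumes chain: "\<And>k. k \<le> n \<Longrightarrow> singular_chain k X (c k)"
    and bd: "\<And>k. k < n \<Longrightarrow> \<exists>\<epsilon>. odd \<epsilon> \<and>
        chain_boundary (Suc k) (c (Suc k)) = c k + frag_cmul \<epsilon> (chain_map k \<tau> (c k))"
    and flip: "\<And>i x. x \<in> topspace X \<Longrightarrow> s i (\<tau> x) = 1 - s i x"
    and base: "odd (chain_eval (\<lambda>_. 1) (c 0))"
    and "k \<le> n"
  shows "odd (chain_eval (\<lambda>\<sigma>. cup_prod s k (\<lambda>j. \<sigma> (unit_vec j))) (c k))"
  using \<open>k \<le> n\<close>
proof (induction k)
  case 0
  then show ?case using base by simp
next
  case (Suc k)
  define A where "A = (\<lambda>\<sigma> :: (nat \<Rightarrow> real) \<Rightarrow> 'a. s k (\<sigma> (unit_vec 0)) * cup_prod s k (\<lambda>j. \<sigma> (unit_vec j)))"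
  define W where "W = (\<lambda>k (\<sigma> :: (nat \<Rightarrow> real) \<Rightarrow> 'a). cup_prod s k (\<lambda>j. \<sigma> (unit_vec j)))"
  have vert: "\<sigma> (unit_vec j) \<in> topspace X" if "singular_simplex k X \<sigma>" "j \<le> k" for \<sigma> j
    using that by (auto simp: singular_simplex_def continuous_map_def Pi_iff)
  obtain \<epsilon> where \<epsilon>: "odd \<epsilon>"
    "chain_boundary (Suc k) (c (Suc k)) = c k + frag_cmul \<epsilon> (chain_map k \<tau> (c k))"
    using bd[of k] Suc.prems by auto
  have A: "even (chain_eval A (chain_boundary (Suc k) c') - chain_eval (W (Suc k)) c')"
    if "singular_chain (Suc k) X c'" for c'
    using that unfolding singular_chain_def
  proof (induction c' rule: frag_induction)
    case (one \<sigma>)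
    let ?v = "\<lambda>j. \<sigma> (unit_vec j)"
    have eq: "A (singular_face (Suc k) i \<sigma>) = s k (coface i ?v 0) * cup_prod s k (coface i ?v)" for i
      unfolding A_def by (simp add: singular_face_unit_vec cong: cup_prod_cong)
    \<comment> \<open>The boundary signs differ from 1 by even numbers, so mod 2 the alternating sum
      may be replaced by the plain sum that \<open>cup_prod_coboundary\<close> controls.\<close>
    have "even (\<Sum>i\<le>Suc k. ((- 1) ^ i - 1) * (s k (coface i ?v 0) * cup_prod s k (coface i ?v)))"
      by (intro dvd_sum) auto
    moreover have "chain_eval A (chain_boundary (Suc k) (frag_of \<sigma>))
      = (\<Sum>i\<le>Suc k. (- 1) ^ i * (s k (coface i ?v 0) * cup_prod s k (coface i ?v)))"
      by (simp add: chain_boundary_of chain_eval_sum chain_eval_cmul chain_eval_add eq)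
    moreover note cup_prod_coboundary[of s k ?v]
    ultimately show ?case
      by (simp add: W_def sum_subtractf left_diff_distrib del: cup_prod.simps sum.atMost_Suc)
  next
    case (diff a b)
    then show ?case unfolding chain_boundary_diff chain_eval_diff by presburger
  qed simp
  have B: "even ((A \<sigma> + A (simplex_map k \<tau> \<sigma>)) - W k \<sigma>)" if \<sigma>: "singular_simplex k X \<sigma>" for \<sigma>
  proof -
    have m: "simplex_map k \<tau> \<sigma> (unit_vec j) = \<tau> (\<sigma> (unit_vec j))" if "j \<le> k" for j
      using that by (simp add: simplex_map_def)
    have "even (cup_prod s k (\<lambda>j. \<tau> (\<sigma> (unit_vec j))) - W k \<sigma>)"
      unfolding W_def by (rule cup_prod_flip) (use flip vert[OF \<sigma>] in auto)
    moreover have "cup_prod s k (\<lambda>j. simplex_map k \<tau> \<sigma> (unit_vec j))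
        = cup_prod s k (\<lambda>j. \<tau> (\<sigma> (unit_vec j)))"
      by (rule cup_prod_cong) (simp add: m)
    ultimately show ?thesis
      using flip[OF vert[OF \<sigma>, of 0], of k] unfolding A_def W_def by (auto simp: m)
  qed
  have "chain_eval A (chain_boundary (Suc k) (c (Suc k)))
      = chain_eval A (c k) + \<epsilon> * chain_eval (\<lambda>\<sigma>. A (simplex_map k \<tau> \<sigma>)) (c k)"
    by (simp add: \<epsilon> chain_eval_add chain_eval_cmul chain_eval_chain_map)
  moreover have "even (chain_eval (\<lambda>\<sigma>. A \<sigma> + A (simplex_map k \<tau> \<sigma>)) (c k) - chain_eval (W k) (c k))"
    using chain Suc.prems B by (intro chain_eval_parity[where p=k and X=X]) auto
  moreover have "odd (chain_eval (W k) (c k))"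
    using Suc unfolding W_def by simp
  moreover have "even (chain_eval A (chain_boundary (Suc k) (c (Suc k))) - chain_eval (W (Suc k)) (c (Suc k)))"
    using A chain Suc.prems by blast
  moreover have "odd y" if "x = a + \<epsilon> * b" "even (a + b - w)" "odd w" "even (x - y)" for x y a b w
    using that \<epsilon>(1) by auto
  ultimately have "odd (chain_eval (W (Suc k)) (c (Suc k)))"
    unfolding chain_eval_add_fun by blast
  then show ?case by (simp add: W_def)
qed

section \<open>The cross polytope and the chains that fill its hemispheres\<close>

definition antipode :: "(nat \<Rightarrow> real) \<Rightarrow> nat \<Rightarrow> real" where
  "antipode x = (\<lambda>i. - x i)"

text \<open>The unit sphere of the l1 norm stands in for the round sphere: an affine cone from a new
  coordinate vertex over a simplex of this set stays in it, so hemispheres can be built from affine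
  simplices.\<close>

definition cross_polytope :: "nat \<Rightarrow> (nat \<Rightarrow> real) set" where
  "cross_polytope n = {x. (\<forall>i>n. x i = 0) \<and> (\<Sum>i\<le>n. \<bar>x i\<bar>) = 1}"

text \<open>The sign \<open>(-1) ^ Suc k\<close> is the one that makes the base of the cone a cycle:
  the lower hemisphere and its antipodal copy close up to a sphere.\<close>

primrec hemisphere :: "nat \<Rightarrow> (nat \<Rightarrow> real) chain" where
  "hemisphere 0 = frag_of (oriented_simplex 0 (\<lambda>_. unit_vec 0))"
| "hemisphere (Suc k) = simplicial_cone k (unit_vec (Suc k))
     (hemisphere k + frag_cmul ((-1) ^ Suc k) (chain_map k antipode (hemisphere k)))"

lemma antipode_antipode [simp]: "antipode \<circ> antipode = id"
  by (auto simp: antipode_def fun_eq_iff)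

lemma antipode_cross_polytope: "x \<in> cross_polytope n \<Longrightarrow> antipode x \<in> cross_polytope n"
  by (simp add: antipode_def cross_polytope_def)

lemma cross_polytope_mono: "m \<le> n \<Longrightarrow> cross_polytope m \<subseteq> cross_polytope n"
proof
  fix x assume "m \<le> n" "x \<in> cross_polytope m"
  moreover have "(\<Sum>i\<le>m. \<bar>x i\<bar>) = (\<Sum>i\<le>n. \<bar>x i\<bar>)"
    using calculation by (intro sum.mono_neutral_left) (auto simp: cross_polytope_def)
  ultimately show "x \<in> cross_polytope n" by (auto simp: cross_polytope_def)
qed

lemma simplicial_chain_add:
  "simplicial_chain p S a \<Longrightarrow> simplicial_chain p S b \<Longrightarrow> simplicial_chain p S (a + b)"
  unfolding simplicial_chain_def using keys_add [of a b] by blast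

lemma simplicial_chain_antipode:
  assumes "simplicial_chain p (cross_polytope n) c"
  shows "simplicial_chain p (cross_polytope n) (chain_map p antipode c)"
  using assms unfolding simplicial_chain_def
proof (induction c rule: frag_induction)
  case (one f)
  then obtain l where l: "f = oriented_simplex p l" and im: "f ` standard_simplex p \<subseteq> cross_polytope n"
    by (auto simp: simplicial_simplex)
  have eq: "simplex_map p antipode f = oriented_simplex p (\<lambda>j i. - l j i)"
    by (auto simp: l simplex_map_def oriented_simplex_def antipode_def sum_negf restrict_def fun_eq_iff)
  have "simplex_map p antipode f ` standard_simplex p \<subseteq> cross_polytope n"
    using im antipode_cross_polytope by (auto simp: simplex_map_def)
  then have "simplicial_simplex p (cross_polytope n) (simplex_map p antipode f)"
    by (auto simp: simplicial_simplex eq)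
  then show ?case by simp
next
  case (diff a b)
  then show ?case
    using keys_diff[of "chain_map p antipode a" "chain_map p antipode b"] by (auto simp: chain_map_diff)
qed simp

text \<open>Coordinate \<open>Suc k\<close> of \<open>x\<close> is zero, so the two parts do not
  interfere and contribute \<open>1 - u\<close> and \<open>u\<close> to the l1 norm.\<close>

lemma cone_cross_polytope:
  assumes "0 \<le> u" "u \<le> 1" "x \<in> cross_polytope k"
  shows "(\<lambda>i. (1 - u) * unit_vec (Suc k) i + u * x i) \<in> cross_polytope (Suc k)"
proof -
  have "(\<Sum>i\<le>k. \<bar>(1 - u) * unit_vec (Suc k) i + u * x i\<bar>) = (\<Sum>i\<le>k. u * \<bar>x i\<bar>)"
    using assms by (intro sum.cong) (auto simp: abs_mult)
  also have "\<dots> = u"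
    using assms by (simp flip: sum_distrib_left add: cross_polytope_def)
  finally show ?thesis
    using assms by (simp add: cross_polytope_def)
qed

lemma simplicial_chain_hemisphere: "simplicial_chain k (cross_polytope k) (hemisphere k)"
proof (induction k)
  case 0
  have "oriented_simplex 0 (\<lambda>_. unit_vec 0) ` standard_simplex 0 \<subseteq> cross_polytope 0"
    by (auto simp: oriented_simplex_def standard_simplex_0 cross_polytope_def)
  then show ?case by (auto simp: simplicial_simplex)
next
  case (Suc k)
  then have "simplicial_chain k (cross_polytope k)
      (hemisphere k + frag_cmul ((-1) ^ Suc k) (chain_map k antipode (hemisphere k)))"
    by (intro simplicial_chain_add simplicial_chain_cmul simplicial_chain_antipode)
  then show ?case unfolding hemisphere.simps
    by (rule simplicial_chain_simplicial_cone) (rule cone_cross_polytope)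
qed

lemma singular_chain_hemisphere:
  assumes "k \<le> n"
  shows "singular_chain k (subtopology (powertop_real UNIV) (cross_polytope n)) (hemisphere k)"
proof -
  have "singular_chain k (subtopology (powertop_real UNIV) (cross_polytope k)) (hemisphere k)"
    using simplicial_chain_hemisphere by (rule simplicial_imp_singular_chain)
  then show ?thesis using cross_polytope_mono[OF assms] by (rule singular_chain_mono)
qed

lemma chain_map_antipode_antipode:
  assumes "singular_chain p X c"
  shows "chain_map p antipode (chain_map p antipode c) = c"
  using chain_map_ident[OF assms] chain_map_compose[of p antipode antipode]
  by (metis antipode_antipode comp_apply)

text \<open>The boundary of a cone is its base minus the cone over the boundary of the base, and the
  base is a cycle: consecutive signs are opposite and the antipode is an involution, so all terms
  cancel. In degree 0 the cycle condition is that the coefficients sum to zero.\<close>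

lemma chain_boundary_hemisphere:
  "chain_boundary (Suc k) (hemisphere (Suc k))
     = hemisphere k + frag_cmul ((-1) ^ Suc k) (chain_map k antipode (hemisphere k))"
proof (induction k)
  case 0
  have "chain_map 0 antipode (hemisphere 0) = frag_of (simplex_map 0 antipode (oriented_simplex 0 (\<lambda>_. unit_vec 0)))"
    by simp
  moreover have "simplicial_chain 0 (cross_polytope 0) (hemisphere 0 + frag_cmul (- 1) (chain_map 0 antipode (hemisphere 0)))"
    by (intro simplicial_chain_add simplicial_chain_cmul simplicial_chain_antipode simplicial_chain_hemisphere)
  ultimately show ?case
    by (simp add: chain_boundary_simplicial_cone frag_extend_diff del: chain_map_of)
next
  case (Suc k)
  let ?c = "hemisphere (Suc k)" and ?\<epsilon> = "(- 1 :: int) ^ Suc (Suc k)"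
  have s: "simplicial_chain (Suc k) (cross_polytope (Suc k)) (?c + frag_cmul ?\<epsilon> (chain_map (Suc k) antipode ?c))"
    by (intro simplicial_chain_add simplicial_chain_cmul simplicial_chain_antipode simplicial_chain_hemisphere)
  have sing: "singular_chain (Suc k) (subtopology (powertop_real UNIV) (cross_polytope (Suc k))) ?c"
    and sing': "singular_chain k (subtopology (powertop_real UNIV) (cross_polytope (Suc k))) (hemisphere k)"
    by (auto intro!: singular_chain_hemisphere simp del: hemisphere.simps)
  have cancel: "frag_cmul (- a) x + frag_cmul a x = 0" for a and x :: "(nat \<Rightarrow> real) chain"
    by (simp flip: frag_cmul_distrib)
  have "chain_boundary (Suc k) (?c + frag_cmul ?\<epsilon> (chain_map (Suc k) antipode ?c)) = 0"
    using Suc.IH chain_boundary_chain_map[OF sing, of antipode]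
    by (simp add: chain_boundary_add chain_boundary_cmul chain_boundary_diff chain_map_add chain_map_diff
        chain_map_antipode_antipode[OF sing'] frag_cmul_distrib2 frag_cmul_diff_distrib
        chain_map_minus chain_boundary_minus cancel del: hemisphere.simps)
  then show ?case
    by (simp only: hemisphere.simps(2)[of "Suc k"] chain_boundary_simplicial_cone[OF s])
       (simp add: simplicial_cone_def del: hemisphere.simps)
qed

section \<open>Iterated subdivision and signs of odd functions\<close>

lemma iterated_subdivision_props:
  fixes c :: "(nat \<Rightarrow> real) chain"
  assumes "singular_chain p X c"
  shows "singular_chain p X ((singular_subdivision p ^^ m) c)"
    and "chain_boundary p ((singular_subdivision p ^^ m) c)
       = (singular_subdivision (p - Suc 0) ^^ m) (chain_boundary p c)"
    and "(singular_subdivision p ^^ m) (chain_map p g c) = chain_map p g ((singular_subdivision p ^^ m) c)"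
proof (induction m)
  case 0
  { case 1 then show ?case using assms by simp next
    case 2 then show ?case by simp next
    case 3 then show ?case by simp }
next
  case (Suc m)
  { case 1 then show ?case using Suc by (simp add: singular_chain_singular_subdivision) next
    case 2 then show ?case using Suc by (simp add: chain_boundary_singular_subdivision) next
    case 3 then show ?case using Suc by (simp add: naturality_singular_subdivision) }
qed

lemma iterated_subdivision_zero:
  assumes "singular_chain 0 X c"
  shows "(singular_subdivision 0 ^^ m) c = c"
  using assms by (induction m) (auto simp: singular_subdivision_zero)

lemma iterated_subdivision_add:
  "(singular_subdivision p ^^ m) (a + b) = (singular_subdivision p ^^ m) a + (singular_subdivision p ^^ m) b"
  by (induction m) (auto simp: singular_subdivision_add)

lemma iterated_subdivision_cmul:
  "(singular_subdivision p ^^ m) (frag_cmul k a) = frag_cmul k ((singular_subdivision p ^^ m) a)"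
  by (induction m) (auto simp: singular_subdivision_def frag_extend_cmul)

text \<open>Ties \<open>f i x = 0\<close> are broken by the sign of the first nonzero coordinate of \<open>x\<close>, so that the sign
  is odd everywhere on the cross polytope.\<close>

definition odd_sign :: "((nat \<Rightarrow> real) \<Rightarrow> real) \<Rightarrow> (nat \<Rightarrow> real) \<Rightarrow> int" where
  "odd_sign f x = (if 0 < f x \<or> f x = 0 \<and> 0 < x (LEAST j. x j \<noteq> 0) then 1 else 0)"

lemma odd_sign_antipode:
  assumes "x \<in> cross_polytope n" "f (antipode x) = - f x"
  shows "odd_sign f (antipode x) = 1 - odd_sign f x"
proof -
  have "\<exists>j. x j \<noteq> 0"
  proof (rule ccontr)
    assume "\<not> ?thesis"
    then show False using assms(1) by (simp add: cross_polytope_def)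
  qed
  then have "x (LEAST j. x j \<noteq> 0) \<noteq> 0" by (rule LeastI_ex)
  then show ?thesis using assms(2) by (auto simp: odd_sign_def antipode_def)
qed

lemma Borsuk_Ulam_cross_polytope:
  assumes cont: "\<And>i. i < n \<Longrightarrow> continuous_on (cross_polytope n) (f i)"
    and odd: "\<And>i x. i < n \<Longrightarrow> x \<in> cross_polytope n \<Longrightarrow> f i (antipode x) = - f i x"
  shows "\<exists>x\<in>cross_polytope n. \<forall>i<n. f i x = (0::real)"
proof (rule ccontr)
  assume contra: "\<not> ?thesis"
  let ?X = "subtopology (powertop_real UNIV) (cross_polytope n)"
  \<comment> \<open>Without a common zero, the sets on which some \<open>f i\<close> has a strict
    sign form an open cover; the hemisphere is subdivided until each simplex lies in one of
    them.\<close>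
  define C where "C = (\<Union>i\<in>{..<n}. {{x\<in>cross_polytope n. f i x > 0}, {x\<in>cross_polytope n. f i x < 0}})"
  have X: "?X = top_of_set (cross_polytope n)" by (simp add: euclidean_product_topology)
  have tX: "topspace ?X = cross_polytope n" by simp
  have "openin ?X U" if U: "U \<in> C" for U
  proof -
    obtain i where i: "i < n" "U = {x\<in>cross_polytope n. f i x > 0} \<or> U = {x\<in>cross_polytope n. f i x < 0}"
      using U unfolding C_def by blast
    have c: "continuous_map ?X euclidean (f i)" using cont[OF i(1)] unfolding X by simp
    have "openin ?X {x \<in> topspace ?X. f i x \<in> {0<..}}" "openin ?X {x \<in> topspace ?X. f i x \<in> {..<0}}"
      using c by (intro openin_continuous_map_preimage[OF c]; simp)+
    then show ?thesis using i(2) by (auto simp: tX)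
  qed
  moreover have "topspace ?X \<subseteq> \<Union>C"
  proof
    fix x assume "x \<in> topspace ?X"
    then have x: "x \<in> cross_polytope n" by simp
    with contra obtain i where "i < n" "f i x \<noteq> 0" by auto
    then have "f i x > 0 \<or> f i x < 0" by linarith
    with x \<open>i < n\<close> show "x \<in> \<Union>C" unfolding C_def by blast
  qed
  ultimately obtain m where m: "\<And>g. g \<in> Poly_Mapping.keys ((singular_subdivision n ^^ m) (hemisphere n))
       \<Longrightarrow> \<exists>V\<in>C. g \<in> standard_simplex n \<rightarrow> V"
    using sufficient_iterated_singular_subdivision_exists[OF _ _ singular_chain_hemisphere[OF order_refl]]
    by (metis order_refl)
  define c where "c k = (singular_subdivision k ^^ m) (hemisphere k)" for k
  \<comment> \<open>For \<open>i \<ge> n\<close> the sign attached to the zero function serves as a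
    default. It is still odd, since the flip condition of \<open>odd_hemisphere_eval\<close> is
    stated for every \<open>i\<close>.\<close>
  define s where "s i x = (if i < n then odd_sign (f i) x else odd_sign (\<lambda>_. 0) x)" for i x
  have "odd (chain_eval (\<lambda>\<sigma>. cup_prod s n (\<lambda>j. \<sigma> (unit_vec j))) (c n))"
  proof (rule odd_hemisphere_eval[where n=n and X="?X" and \<tau>=antipode])
    show "singular_chain k ?X (c k)" if "k \<le> n" for k
      unfolding c_def by (rule iterated_subdivision_props(1)) (use that singular_chain_hemisphere in auto)
    show "\<exists>\<epsilon>. odd \<epsilon> \<and> chain_boundary (Suc k) (c (Suc k)) = c k + frag_cmul \<epsilon> (chain_map k antipode (c k))"
      if "k < n" for k
    proof (intro exI conjI)
      show "odd ((- 1 :: int) ^ Suc k)" by simp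
      have 1: "singular_chain (Suc k) ?X (hemisphere (Suc k))" "singular_chain k ?X (hemisphere k)"
        using that singular_chain_hemisphere[of "Suc k" n] singular_chain_hemisphere[of k n] by auto
      show "chain_boundary (Suc k) (c (Suc k)) = c k + frag_cmul ((- 1) ^ Suc k) (chain_map k antipode (c k))"
        unfolding c_def iterated_subdivision_props(2)[OF 1(1)] chain_boundary_hemisphere
        by (simp only: diff_Suc_1 One_nat_def[symmetric] iterated_subdivision_add iterated_subdivision_cmul
            iterated_subdivision_props(3)[OF 1(2)])
    qed
    show "s i (antipode x) = 1 - s i x" if "x \<in> topspace ?X" for i x
      using that odd odd_sign_antipode[of x n] unfolding s_def by auto
    have "singular_chain 0 ?X (hemisphere 0)" by (rule singular_chain_hemisphere) simp
    then show "odd (chain_eval (\<lambda>_. 1) (c 0))" unfolding c_def by (simp add: iterated_subdivision_zero)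
  qed simp
  then obtain \<sigma> where \<sigma>: "\<sigma> \<in> Poly_Mapping.keys (c n)" "odd (cup_prod s n (\<lambda>j. \<sigma> (unit_vec j)))"
    by (rule odd_chain_eval_imp_key)
  then obtain V where V: "V \<in> C" "\<sigma> \<in> standard_simplex n \<rightarrow> V"
    using m unfolding c_def by blast
  then obtain i where i: "i < n" "V = {x\<in>cross_polytope n. f i x > 0} \<or> V = {x\<in>cross_polytope n. f i x < 0}"
    unfolding C_def by auto
  \<comment> \<open>An odd cup product yields an edge along which the sign of \<open>f i\<close>
    changes, while the whole simplex lies where \<open>f i\<close> keeps one strict sign.\<close>
  obtain j where j: "j < n" "odd (s i (\<sigma> (unit_vec j)) + s i (\<sigma> (unit_vec (Suc j))))"
    using odd_cup_prod_imp[OF \<sigma>(2) i(1)] by blast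
  have "\<sigma> (unit_vec j) \<in> V" "\<sigma> (unit_vec (Suc j)) \<in> V"
    using V(2) j(1) by (auto simp: Pi_iff)
  then show False using i j(2) by (auto simp: s_def odd_sign_def split: if_splits)
qed

text \<open>Radial projection of the l1 sphere to the round sphere is continuous and odd, so it
  carries a zero found on the cross polytope to the sphere.\<close>

theorem Borsuk_Ulam:
  assumes cont: "\<And>i. i < n \<Longrightarrow> continuous_on (topspace (nsphere n)) (f i)"
    and odd: "\<And>i x. i < n \<Longrightarrow> x \<in> topspace (nsphere n) \<Longrightarrow> f i (\<lambda>j. - x j) = - f i x"
  shows "\<exists>x\<in>topspace (nsphere n). \<forall>i<n. f i x = (0::real)"
proof -
  let ?r = "\<lambda>x. sqrt (\<Sum>i\<le>n. (x i)\<^sup>2)"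
  define g where "g x = (\<lambda>j. x j / ?r x)" for x :: "nat \<Rightarrow> real"
  have r: "?r x > 0" if "x \<in> cross_polytope n" for x
  proof -
    have "\<exists>i\<le>n. x i \<noteq> 0"
    proof (rule ccontr)
      assume "\<not> ?thesis"
      then show False using that by (simp add: cross_polytope_def)
    qed
    then show ?thesis by (auto intro!: sum_pos2)
  qed
  have g: "g x \<in> topspace (nsphere n)" if "x \<in> cross_polytope n" for x
  proof -
    have "(\<Sum>i\<le>n. (x i)\<^sup>2) > 0" using r[OF that] by simp
    then show ?thesis using that
      by (auto simp: nsphere g_def cross_polytope_def power_divide sum_nonneg simp flip: sum_divide_distrib)
  qed
  have cg: "continuous_on (cross_polytope n) g"
  proof (intro continuous_on_coordinatewise_then_product)
    have c: "continuous_on (cross_polytope n) (\<lambda>x. x i :: real)" for i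
      by (rule continuous_on_subset[OF continuous_on_product_coordinates]) simp
    show "continuous_on (cross_polytope n) (\<lambda>x. g x i)" for i
      unfolding g_def by (intro continuous_intros c) (use r in fastforce)
  qed
  have "\<exists>x\<in>cross_polytope n. \<forall>i<n. (f i \<circ> g) x = 0"
  proof (rule Borsuk_Ulam_cross_polytope)
    show "continuous_on (cross_polytope n) (f i \<circ> g)" if "i < n" for i
      using cont[OF that] cg g by (intro continuous_on_compose) (auto intro: continuous_on_subset)
    show "(f i \<circ> g) (antipode x) = - (f i \<circ> g) x" if "i < n" "x \<in> cross_polytope n" for i x
      using odd[OF that(1) g[OF that(2)]] by (simp add: g_def antipode_def)
  qed
  then show ?thesis using g by auto
qed

section \<open>Smooth functions and test functions\<close>

lemma Ck_SucI:
  assumes "\<And>x. (f has_derivative f' x) (at x)" "\<And>v. Ck m (\<lambda>x. f' x v)"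
  shows "Ck (Suc m) f"
proof -
  have "frechet_derivative f (at x) = f' x" for x
    using frechet_derivative_at[OF assms(1)] by simp
  then show ?thesis using assms by (auto simp: differentiable_def)
qed

lemma Ck_SucD:
  assumes "Ck (Suc m) f"
  shows "(f has_derivative frechet_derivative f (at x)) (at x)"
    and "Ck m (\<lambda>x. frechet_derivative f (at x) v)"
  using assms by (auto simp: frechet_derivative_works)

lemma Ck_0I: "Ck (Suc m) f \<Longrightarrow> Ck 0 f"
  by (auto intro!: continuous_at_imp_continuous_on differentiable_imp_continuous_within)

text \<open>\<open>Ck (Suc m)\<close> speaks of derivatives only, whereas the product rule leaves
  one factor undifferentiated; for that factor the lower order is needed.\<close>

lemma Ck_decr: "Ck (Suc m) f \<Longrightarrow> Ck m f"
proof (induction m arbitrary: f)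
  case 0 then show ?case by (rule Ck_0I)
next
  case (Suc m)
  show ?case
  proof (rule Ck_SucI)
    show "(f has_derivative frechet_derivative f (at x)) (at x)" for x
      using Suc.prems by (rule Ck_SucD)
    show "Ck m (\<lambda>x. frechet_derivative f (at x) v)" for v
      using Suc.prems by (intro Suc.IH Ck_SucD)
  qed
qed

lemma Ck_imp_continuous: "Ck m f \<Longrightarrow> continuous_on UNIV f"
  by (cases m) (auto dest: Ck_0I simp del: Ck.simps(2))

lemma Ck_const: "Ck m (\<lambda>x. c)"
proof (induction m arbitrary: c)
  case (Suc m)
  show ?case by (rule Ck_SucI[where f'="\<lambda>_ _. 0"]) (use Suc in auto)
qed simp

lemma Ck_add: "Ck m f \<Longrightarrow> Ck m g \<Longrightarrow> Ck m (\<lambda>x. f x + g x)"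
proof (induction m arbitrary: f g)
  case 0 then show ?case by (auto intro: continuous_intros)
next
  case (Suc m)
  show ?case
    by (rule Ck_SucI[OF has_derivative_add[OF Ck_SucD(1) Ck_SucD(1)]])
       (use Suc Ck_SucD(2) in blast)+
qed

lemma Ck_mult: "Ck m f \<Longrightarrow> Ck m g \<Longrightarrow> Ck m (\<lambda>x. f x * g x)"
proof (induction m arbitrary: f g)
  case 0 then show ?case by (auto intro: continuous_intros)
next
  case (Suc m)
  show ?case
  proof (rule Ck_SucI[OF has_derivative_mult[OF Ck_SucD(1) Ck_SucD(1)]])
    fix v
    have "Ck m f" "Ck m g" "Ck m (\<lambda>x. frechet_derivative f (at x) v)" "Ck m (\<lambda>x. frechet_derivative g (at x) v)"
      using Suc.prems by (auto intro: Ck_decr Ck_SucD simp del: Ck.simps)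
    then show "Ck m (\<lambda>x. f x * frechet_derivative g (at x) v + frechet_derivative f (at x) v * g x)"
      by (intro Ck_add Suc.IH)
  qed (use Suc.prems in auto)
qed

lemma Ck_cmult: "Ck m f \<Longrightarrow> Ck m (\<lambda>x. c * f x)"
  by (rule Ck_mult[OF Ck_const])

lemma Ck_prod: "finite I \<Longrightarrow> (\<And>i. i \<in> I \<Longrightarrow> Ck m (f i)) \<Longrightarrow> Ck m (\<lambda>x. \<Prod>i\<in>I. f i x)"
  by (induction I rule: finite_induct) (auto intro: Ck_const Ck_mult)

lemma Ck_affine: "Ck m f \<Longrightarrow> Ck m (\<lambda>x. f (a + s *\<^sub>R x))"
proof (induction m arbitrary: f)
  case 0 then show ?case
    by (auto intro!: continuous_intros continuous_on_compose2[where f="\<lambda>x. a + s *\<^sub>R x" and g=f])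
next
  case (Suc m)
  have "((\<lambda>x. f (a + s *\<^sub>R x)) has_derivative (\<lambda>v. frechet_derivative f (at (a + s *\<^sub>R x)) (s *\<^sub>R v))) (at x)" for x
  proof -
    have "((\<lambda>x. a + s *\<^sub>R x) has_derivative (\<lambda>v. s *\<^sub>R v)) (at x)"
      by (auto intro!: derivative_eq_intros)
    from has_derivative_compose[OF this Ck_SucD(1)[OF Suc.prems]] show ?thesis .
  qed
  moreover have "Ck m (\<lambda>x. frechet_derivative f (at (a + s *\<^sub>R x)) (s *\<^sub>R v))" for v
    using Suc.IH[OF Ck_SucD(2)[OF Suc.prems]] .
  ultimately show ?case by (rule Ck_SucI)
qed

section \<open>Smooth cut-off functions for boxes\<close>

definition bump :: "real poly \<Rightarrow> real \<Rightarrow> real" where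
  "bump q t = (if 0 < t then poly q (1 / t) * exp (- (1 / t)) else 0)"

lemma poly_div_exp_tendsto_0: "((\<lambda>x. poly q x / exp x) \<longlongrightarrow> (0::real)) at_top"
proof -
  have "((\<lambda>x. \<Sum>i\<le>Polynomial.degree q. Polynomial.coeff q i * (x ^ i / exp x)) \<longlongrightarrow> (\<Sum>i\<le>Polynomial.degree q. Polynomial.coeff q i * 0)) at_top"
    by (intro tendsto_intros tendsto_power_div_exp_0)
  then show ?thesis by (simp add: poly_altdef sum_divide_distrib)
qed

lemma bump_tendsto_0: "(bump q \<longlongrightarrow> 0) (at 0)"
proof -
  have "((\<lambda>x. poly q (inverse x) / exp (inverse x)) \<longlongrightarrow> 0) (at_right 0)"
    using filterlim_compose[OF poly_div_exp_tendsto_0 filterlim_inverse_at_top_right] .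
  then have "(bump q \<longlongrightarrow> 0) (at_right 0)"
    by (rule Lim_transform_eventually)
       (auto simp: bump_def eventually_at_filter exp_minus field_simps)
  moreover have "(bump q \<longlongrightarrow> 0) (at_left 0)"
    by (rule Lim_transform_eventually[OF tendsto_const])
       (auto simp: bump_def eventually_at_filter)
  ultimately show ?thesis by (simp add: filterlim_split_at)
qed

text \<open>The family is closed under differentiation: with \<open>x = 1 / t\<close>, the
  derivative of \<open>q x * exp (- x)\<close> has the polynomial
  \<open>x\<^sup>2 * (q - q')\<close>. Smoothness of all its members then follows from one
  induction.\<close>

lemma bump_deriv:
  "(bump q has_real_derivative bump ([:0, 0, 1:] * (q - pderiv q)) t) (at t)"
proof -
  consider "t > 0" | "t < 0" | "t = 0" by linarith
  then show ?thesis
  proof cases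
    case 1
    have "((\<lambda>t. poly q (1 / t) * exp (- (1 / t))) has_real_derivative bump ([:0, 0, 1:] * (q - pderiv q)) t) (at t)"
      using 1 by (auto intro!: derivative_eq_intros simp: bump_def field_simps power2_eq_square)
    then show ?thesis
      by (rule has_field_derivative_transform_within_open[where S="{0<..}"]) (use 1 in \<open>auto simp: bump_def\<close>)
  next
    case 2
    have "((\<lambda>t. 0) has_real_derivative 0) (at t)" by simp
    then have "(bump q has_real_derivative 0) (at t)"
      by (rule has_field_derivative_transform_within_open[where S="{..<0}"]) (use 2 in \<open>auto simp: bump_def\<close>)
    then show ?thesis using 2 by (simp add: bump_def)
  next
    case 3
    \<comment> \<open>At 0 the difference quotient of \<open>bump q\<close> is the bump of the
      polynomial \<open>x * q\<close>, which tends to 0.\<close>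
    have "((\<lambda>h. (bump q (0 + h) - bump q 0) / h) \<longlongrightarrow> 0) (at 0)"
      by (rule Lim_transform_eventually[OF bump_tendsto_0[of "[:0, 1:] * q"]])
         (auto simp: bump_def eventually_at_filter)
    then show ?thesis using 3 by (simp add: DERIV_def bump_def)
  qed
qed

lemma Ck_bump_coord: "Ck m (\<lambda>x :: real^'n. bump q (c + d * x $ i))"
proof (induction m arbitrary: q)
  case 0
  have "continuous_on UNIV (bump q)"
    using bump_deriv by (auto intro!: DERIV_isCont continuous_at_imp_continuous_on)
  then show ?case
    by (auto intro!: continuous_intros continuous_on_compose2[where g="bump q" and f="\<lambda>x::real^'n. c + d * x $ i"])
next
  case (Suc m)
  let ?r = "[:0, 0, 1:] * (q - pderiv q)"
  have "((\<lambda>x :: real^'n. bump q (c + d * x $ i)) has_derivative (\<lambda>v. (d * v $ i) * bump ?r (c + d * x $ i))) (at x)" for x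
  proof -
    have "((\<lambda>x :: real^'n. c + d * x $ i) has_derivative (\<lambda>v. d * v $ i)) (at x)"
      by (auto intro!: derivative_eq_intros bounded_linear.has_derivative[OF bounded_linear_vec_nth])
    from has_derivative_compose[OF this bump_deriv[THEN has_field_derivative_imp_has_derivative]]
    show ?thesis by (simp add: mult_ac)
  qed
  then show ?case by (rule Ck_SucI) (intro Ck_cmult Suc.IH)
qed

text \<open>The factor \<open>Suc j\<close> steepens the one-dimensional bumps:
  \<open>exp (- 1 / (j * t))\<close> tends to 1 for each \<open>t > 0\<close>, so these test
  functions converge to the indicator of the open box.\<close>

definition box_bump :: "real^'n \<Rightarrow> real^'n \<Rightarrow> nat \<Rightarrow> real^'n \<Rightarrow> real" where
  "box_bump a b j x = (\<Prod>i\<in>UNIV. bump 1 (real (Suc j) * (x $ i - a $ i)) * bump 1 (real (Suc j) * (b $ i - x $ i)))"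

lemma bump_1: "bump 1 t \<ge> 0" "bump 1 t \<le> 1" "bump 1 t > 0 \<longleftrightarrow> t > 0" "bump 1 t = 0 \<longleftrightarrow> t \<le> 0"
  by (auto simp: bump_def)

lemma box_bump_nonzero_iff: "box_bump a b j x \<noteq> 0 \<longleftrightarrow> x \<in> box a b"
  by (auto simp: box_bump_def bump_1 mem_box_cart zero_less_mult_iff mult_le_0_iff not_le) 

lemma box_bump_bounds: "0 \<le> box_bump a b j x" "box_bump a b j x \<le> 1"
  by (auto simp: box_bump_def bump_1 intro!: prod_nonneg prod_le_1 mult_nonneg_nonneg mult_le_one)

lemma box_bump_limit: "(\<lambda>j. box_bump a b j x) \<longlonglongrightarrow> indicator (box a b) x"
proof (cases "x \<in> box a b")
  case True
  have *: "(\<lambda>j. bump 1 (real (Suc j) * t)) \<longlonglongrightarrow> 1" if "t > 0" for t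
  proof -
    have "(\<lambda>j. exp (- (1 / t) * (1 / real (Suc j)))) \<longlonglongrightarrow> exp (- (1 / t) * 0)"
      by (intro tendsto_intros LIMSEQ_Suc[OF lim_1_over_n])
    then show ?thesis using that by (simp add: bump_def mult.commute)
  qed
  have "(\<lambda>j. box_bump a b j x) \<longlonglongrightarrow> (\<Prod>i\<in>(UNIV::'a set). 1 * 1)"
    unfolding box_bump_def by (intro tendsto_intros *) (use True in \<open>auto simp: mem_box_cart\<close>)
  then show ?thesis using True by simp
next
  case False
  then have "box_bump a b j x = 0" for j using box_bump_nonzero_iff by blast
  then show ?thesis using False by simp
qed

section \<open>Supports and closure properties of test functions\<close>

lemma test_functionsI:
  assumes "\<And>m. Ck m \<phi>" "compact K" "K \<subseteq> \<Omega>" "\<And>x. \<phi> x \<noteq> 0 \<Longrightarrow> x \<in> K"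
  shows "\<phi> \<in> test_functions \<Omega>"
proof -
  have "closure {x. \<phi> x \<noteq> 0} \<subseteq> K"
    using assms(2,4) by (intro closure_minimal) (auto simp: compact_imp_closed)
  moreover have "compact (closure {x. \<phi> x \<noteq> 0})"
    unfolding compact_closure using assms(2,4) compact_imp_bounded by (auto intro: bounded_subset)
  ultimately show ?thesis
    unfolding test_functions_def using assms(1,3) by blast
qed

lemma test_functionsE:
  assumes "\<phi> \<in> test_functions \<Omega>"
  obtains K where "compact K" "K \<subseteq> \<Omega>" "\<And>x. x \<notin> K \<Longrightarrow> \<phi> x = 0"
    "\<And>x v. x \<notin> K \<Longrightarrow> frechet_derivative \<phi> (at x) v = 0"
proof -
  let ?K = "closure {x. \<phi> x \<noteq> 0}"
  have z: "\<phi> x = 0" if "x \<notin> ?K" for x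
    using that closure_subset[of "{x. \<phi> x \<noteq> 0}"] by auto
  have d: "frechet_derivative \<phi> (at x) v = 0" if "x \<notin> ?K" for x v
  proof -
    have "((\<lambda>_. 0) has_derivative (\<lambda>_. 0)) (at x)" by simp
    then have "(\<phi> has_derivative (\<lambda>_. 0)) (at x)"
    proof (rule has_derivative_transform_within_open)
      show "open (- ?K)" by (rule open_Compl[OF closed_closure])
      show "x \<in> - ?K" using that by simp
      show "0 = \<phi> y" if "y \<in> - ?K" for y using z[of y] that by simp
    qed
    from frechet_derivative_at[OF this] have "frechet_derivative \<phi> (at x) = (\<lambda>_. 0)" by (rule sym)
    then show ?thesis by simp
  qed
  have "compact ?K" "?K \<subseteq> \<Omega>" using assms unfolding test_functions_def by blast+
  from that[OF this z d] show ?thesis .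
qed

lemma test_functions_Ck: "\<phi> \<in> test_functions \<Omega> \<Longrightarrow> Ck m \<phi>"
  by (simp add: test_functions_def)

lemma test_functions_mono: "\<Omega> \<subseteq> \<Omega>' \<Longrightarrow> \<phi> \<in> test_functions \<Omega> \<Longrightarrow> \<phi> \<in> test_functions \<Omega>'"
  by (auto simp: test_functions_def)

lemma test_functions_support:
  assumes "\<phi> \<in> test_functions \<Omega>"
  obtains K where "compact K" "K \<subseteq> \<Omega>" "\<And>x. x \<notin> K \<Longrightarrow> \<phi> x = 0"
  by (rule test_functionsE[OF assms]) (rule that)

lemma test_functions_zero: "\<phi> \<in> test_functions \<Omega> \<Longrightarrow> x \<notin> \<Omega> \<Longrightarrow> \<phi> x = 0"
  by (erule test_functions_support) auto

lemma test_functions_has_derivative: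
  "\<phi> \<in> test_functions \<Omega> \<Longrightarrow> (\<phi> has_derivative frechet_derivative \<phi> (at x)) (at x)"
  using Ck_SucD(1)[OF test_functions_Ck] .

lemma test_functions_add:
  assumes "\<phi> \<in> test_functions \<Omega>" "\<psi> \<in> test_functions \<Omega>"
  shows "(\<lambda>x. \<phi> x + \<psi> x) \<in> test_functions \<Omega>"
proof -
  obtain K where K: "compact K" "K \<subseteq> \<Omega>" "\<And>x. x \<notin> K \<Longrightarrow> \<phi> x = 0"
    by (rule test_functions_support[OF assms(1)]) (rule that)
  obtain L where L: "compact L" "L \<subseteq> \<Omega>" "\<And>x. x \<notin> L \<Longrightarrow> \<psi> x = 0"
    by (rule test_functions_support[OF assms(2)]) (rule that)
  show ?thesis
  proof (rule test_functionsI[where K="K \<union> L"])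
    show "x \<in> K \<union> L" if "\<phi> x + \<psi> x \<noteq> 0" for x
      using that K(3)[of x] L(3)[of x] by (cases "x \<in> K"; cases "x \<in> L") simp_all
  qed (use K L assms in \<open>auto intro: Ck_add test_functions_Ck\<close>)
qed

lemma test_functions_mult:
  assumes "\<phi> \<in> test_functions \<Omega>" "\<And>m. Ck m \<psi>"
  shows "(\<lambda>x. \<psi> x * \<phi> x) \<in> test_functions \<Omega>"
proof -
  obtain K where K: "compact K" "K \<subseteq> \<Omega>" "\<And>x. x \<notin> K \<Longrightarrow> \<phi> x = 0"
    by (rule test_functions_support[OF assms(1)]) (rule that)
  show ?thesis
  proof (rule test_functionsI[OF _ K(1,2)])
    show "x \<in> K" if "\<psi> x * \<phi> x \<noteq> 0" for x using that K(3)[of x] by auto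
    show "Ck m (\<lambda>x. \<psi> x * \<phi> x)" for m by (intro Ck_mult assms test_functions_Ck[OF assms(1)])
  qed
qed

lemma test_functions_cmult: "\<phi> \<in> test_functions \<Omega> \<Longrightarrow> (\<lambda>x. c * \<phi> x) \<in> test_functions \<Omega>"
  by (rule test_functions_mult[OF _ Ck_const])

lemma test_functions_partial_deriv:
  assumes "\<phi> \<in> test_functions \<Omega>"
  shows "partial_deriv i \<phi> \<in> test_functions \<Omega>"
proof -
  obtain K where K: "compact K" "K \<subseteq> \<Omega>" "\<And>x v. x \<notin> K \<Longrightarrow> frechet_derivative \<phi> (at x) v = 0"
    by (rule test_functionsE[OF assms]) (rule that)
  show ?thesis
  proof (rule test_functionsI[OF _ K(1,2)])
    show "x \<in> K" if "partial_deriv i \<phi> x \<noteq> 0" for x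
      using that K(3)[of x] unfolding partial_deriv_def by auto
    show "Ck m (partial_deriv i \<phi>)" for m
      unfolding partial_deriv_def[abs_def] by (rule Ck_SucD(2)[OF test_functions_Ck[OF assms]])
  qed
qed

lemma test_functions_affine:
  assumes "\<phi> \<in> test_functions \<Omega>" "s \<noteq> 0"
  shows "(\<lambda>x. \<phi> (a + s *\<^sub>R x)) \<in> test_functions ((\<lambda>x. a + s *\<^sub>R x) -` \<Omega>)"
proof -
  obtain K where K: "compact K" "K \<subseteq> \<Omega>" "\<And>x. x \<notin> K \<Longrightarrow> \<phi> x = 0"
    by (rule test_functions_support[OF assms(1)]) (rule that)
  let ?g = "\<lambda>y. (1 / s) *\<^sub>R (y - a)"
  have eq: "?g ` K = (\<lambda>x. a + s *\<^sub>R x) -` K"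
    using assms(2) by (auto simp: image_iff intro!: bexI[where x="a + s *\<^sub>R _"])
  have "compact (?g ` K)" by (intro compact_continuous_image continuous_intros K)
  then have c: "compact ((\<lambda>x. a + s *\<^sub>R x) -` K)" unfolding eq .
  show ?thesis
  proof (rule test_functionsI[OF _ c])
    show "Ck m (\<lambda>x. \<phi> (a + s *\<^sub>R x))" for m by (intro Ck_affine test_functions_Ck[OF assms(1)])
    show "x \<in> (\<lambda>x. a + s *\<^sub>R x) -` K" if "\<phi> (a + s *\<^sub>R x) \<noteq> 0" for x
      using that K(3)[of "a + s *\<^sub>R x"] by auto
  qed (use K(2) in auto)
qed

lemma box_bump_test:
  assumes "cbox a b \<subseteq> \<Omega>"
  shows "box_bump a b j \<in> test_functions \<Omega>"
proof (rule test_functionsI[OF _ compact_cbox assms])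
  show "Ck m (box_bump a b j)" for m
  proof -
    have "Ck m (\<lambda>x. \<Prod>i\<in>UNIV. bump 1 (- real (Suc j) * a $ i + real (Suc j) * x $ i) *
         bump 1 (real (Suc j) * b $ i + (- real (Suc j)) * x $ i))"
      by (intro Ck_prod Ck_mult Ck_bump_coord) simp
    moreover have "(\<lambda>x. \<Prod>i\<in>UNIV. bump 1 (- real (Suc j) * a $ i + real (Suc j) * x $ i) *
         bump 1 (real (Suc j) * b $ i + (- real (Suc j)) * x $ i)) = box_bump a b j"
      unfolding box_bump_def by (simp add: fun_eq_iff algebra_simps)
    ultimately show ?thesis by simp
  qed
  show "x \<in> cbox a b" if "box_bump a b j x \<noteq> 0" for x
    using that unfolding box_bump_nonzero_iff by (rule subsetD[OF box_subset_cbox])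
qed

section \<open>Classical gradients of test functions\<close>

definition grad :: "(real^'n \<Rightarrow> real) \<Rightarrow> real^'n \<Rightarrow> real^'n" where
  "grad \<phi> x = (\<chi> i. partial_deriv i \<phi> x)"

lemma grad_nth: "grad \<phi> x $ i = partial_deriv i \<phi> x"
  by (simp add: grad_def)

lemma frechet_derivative_eq_grad:
  assumes "\<phi> \<in> test_functions \<Omega>"
  shows "frechet_derivative \<phi> (at x) v = grad \<phi> x \<bullet> v"
proof -
  have lin: "linear (frechet_derivative \<phi> (at x))"
    using test_functions_has_derivative[OF assms] has_derivative_linear by blast
  have "v = (\<Sum>i\<in>UNIV. v $ i *\<^sub>R axis i 1)"
    by (simp add: basis_expansion flip: scalar_mult_eq_scaleR)
  then have "frechet_derivative \<phi> (at x) v = frechet_derivative \<phi> (at x) (\<Sum>i\<in>UNIV. v $ i *\<^sub>R axis i 1)"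
    by simp
  also have "\<dots> = (\<Sum>i\<in>UNIV. v $ i * partial_deriv i \<phi> x)"
    by (simp add: linear_sum[OF lin] linear_scale[OF lin] partial_deriv_def)
  finally have "frechet_derivative \<phi> (at x) v = (\<Sum>i\<in>UNIV. v $ i * partial_deriv i \<phi> x)" .
  then show ?thesis by (simp add: grad_def inner_vec_def mult.commute)
qed

lemma test_functions_continuous: "\<phi> \<in> test_functions \<Omega> \<Longrightarrow> continuous_on S \<phi>"
  using Ck_imp_continuous[OF test_functions_Ck] continuous_on_subset by blast

lemma continuous_grad: "\<phi> \<in> test_functions \<Omega> \<Longrightarrow> continuous_on S (grad \<phi>)"
  unfolding grad_def
  by (intro continuous_on_vec_lambda test_functions_continuous[OF test_functions_partial_deriv])

lemma grad_zero_outside: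
  assumes "\<phi> \<in> test_functions \<Omega>" "x \<notin> \<Omega>"
  shows "grad \<phi> x = 0"
  using test_functions_zero[OF test_functions_partial_deriv[OF assms(1)] assms(2)]
  by (simp add: grad_def vec_eq_iff)

lemma grad_add:
  assumes "\<phi> \<in> test_functions \<Omega>" "\<psi> \<in> test_functions \<Omega>'"
  shows "grad (\<lambda>x. \<phi> x + \<psi> x) x = grad \<phi> x + grad \<psi> x"
  using frechet_derivative_at[OF has_derivative_add[OF assms[THEN test_functions_has_derivative]], symmetric]
  by (simp add: grad_def partial_deriv_def vec_eq_iff)

lemma grad_cmult:
  assumes "\<phi> \<in> test_functions \<Omega>"
  shows "grad (\<lambda>x. c * \<phi> x) x = c *\<^sub>R grad \<phi> x"
  using frechet_derivative_at[OF has_derivative_mult_right[OF test_functions_has_derivative[OF assms], where x=c], symmetric]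
  by (simp add: grad_def partial_deriv_def vec_eq_iff)

lemma grad_affine:
  assumes "\<phi> \<in> test_functions \<Omega>"
  shows "grad (\<lambda>x. \<phi> (a + s *\<^sub>R x)) x = s *\<^sub>R grad \<phi> (a + s *\<^sub>R x)"
proof -
  have "((\<lambda>x. a + s *\<^sub>R x) has_derivative (\<lambda>v. s *\<^sub>R v)) (at x)"
    by (auto intro!: derivative_eq_intros)
  from has_derivative_compose[OF this test_functions_has_derivative[OF assms]]
  have "frechet_derivative (\<lambda>x. \<phi> (a + s *\<^sub>R x)) (at x) = (\<lambda>v. frechet_derivative \<phi> (at (a + s *\<^sub>R x)) (s *\<^sub>R v))"
    by (rule frechet_derivative_at[symmetric])
  then have "partial_deriv i (\<lambda>x. \<phi> (a + s *\<^sub>R x)) x = s * grad \<phi> (a + s *\<^sub>R x) $ i" for i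
    unfolding partial_deriv_def by (simp only: frechet_derivative_eq_grad[OF assms] inner_scaleR_right inner_axis) simp
  then show ?thesis unfolding vec_eq_iff by (simp only: grad_nth vector_scaleR_component) simp
qed

section \<open>Weak gradients\<close>

lemma continuous_compact_support_integrable:
  fixes f :: "'a::euclidean_space \<Rightarrow> 'b::euclidean_space"
  assumes "continuous_on UNIV f" "compact K" "\<And>x. x \<notin> K \<Longrightarrow> f x = 0"
  shows "f \<in> borel_measurable borel" "integrable lborel f" "integrable lebesgue f"
proof -
  show m: "f \<in> borel_measurable borel" by (rule borel_measurable_continuous_onI[OF assms(1)])
  have "(\<lambda>x. indicator K x *\<^sub>R f x) = f" using assms(3) by (auto simp: indicator_def fun_eq_iff)
  then show "integrable lborel f"
    using borel_integrable_compact[OF assms(2) continuous_on_subset[OF assms(1) subset_UNIV]] by simp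
  then show "integrable lebesgue f" using m by (simp add: integrable_completion)
qed

lemma test_functions_integrable:
  assumes "\<phi> \<in> test_functions \<Omega>"
  shows "\<phi> \<in> borel_measurable borel" "integrable lborel \<phi>" "integrable lebesgue \<phi>"
proof -
  obtain K where K: "compact K" "K \<subseteq> \<Omega>" "\<And>x. x \<notin> K \<Longrightarrow> \<phi> x = 0"
    by (rule test_functions_support[OF assms]) (rule that)
  show "\<phi> \<in> borel_measurable borel" "integrable lborel \<phi>" "integrable lebesgue \<phi>"
    by (rule continuous_compact_support_integrable[OF test_functions_continuous[OF assms] K(1,3)], assumption)+
qed

lemma lborel_integral_translation:
  fixes f :: "'a::euclidean_space \<Rightarrow> 'b::{banach, second_countable_topology}"
  assumes "f \<in> borel_measurable borel"
  shows "(\<integral>x. f (h + x) \<partial>lborel) = (\<integral>x. f x \<partial>lborel)"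
    and "integrable lborel (\<lambda>x. f (h + x)) \<longleftrightarrow> integrable lborel f"
proof -
  show "(\<integral>x. f (h + x) \<partial>lborel) = (\<integral>x. f x \<partial>lborel)"
    by (subst (2) lborel_distr_plus[of h, symmetric]) (simp add: integral_distr assms)
  show "integrable lborel (\<lambda>x. f (h + x)) \<longleftrightarrow> integrable lborel f"
    by (subst (2) lborel_distr_plus[of h, symmetric]) (simp add: integrable_distr_eq assms)
qed

lemma test_functions_bounded:
  assumes "\<phi> \<in> test_functions \<Omega>"
  obtains B where "0 \<le> B" "\<And>x. \<bar>\<phi> x\<bar> \<le> B"
proof -
  obtain K where K: "compact K" "K \<subseteq> \<Omega>" "\<And>x. x \<notin> K \<Longrightarrow> \<phi> x = 0"
    by (rule test_functions_support[OF assms]) (rule that)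
  have "bounded (\<phi> ` K)"
    by (intro compact_imp_bounded compact_continuous_image test_functions_continuous[OF assms] K)
  then obtain B where B: "\<And>x. x \<in> K \<Longrightarrow> \<bar>\<phi> x\<bar> \<le> B" by (auto simp: bounded_iff)
  have "\<bar>\<phi> x\<bar> \<le> max B 0" for x using B[of x] K(3)[of x] by (cases "x \<in> K") auto
  then show ?thesis using that[of "max B 0"] by simp
qed

lemma grad_bounded:
  fixes \<phi> :: "real^'n \<Rightarrow> real"
  assumes "\<phi> \<in> test_functions \<Omega>"
  obtains B where "0 \<le> B" "\<And>x. norm (grad \<phi> x) \<le> B"
proof -
  have "\<exists>B. 0 \<le> B \<and> (\<forall>x. \<bar>partial_deriv i \<phi> x\<bar> \<le> B)" for i
    using test_functions_bounded[OF test_functions_partial_deriv[OF assms, of i]] by metis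
  then obtain B where B: "\<And>i. 0 \<le> B i" "\<And>i x. \<bar>partial_deriv i \<phi> x\<bar> \<le> B i" by metis
  have "norm (grad \<phi> x) \<le> sum B UNIV" for x
  proof -
    have "norm (grad \<phi> x) \<le> (\<Sum>i\<in>UNIV. \<bar>grad \<phi> x $ i\<bar>)" by (rule norm_le_l1_cart)
    also have "\<dots> \<le> sum B UNIV" by (intro sum_mono) (simp add: grad_nth B)
    finally show ?thesis .
  qed
  then show ?thesis using that[of "sum B UNIV"] B(1) by (simp add: sum_nonneg)
qed

lemma test_functions_Lipschitz:
  assumes "\<phi> \<in> test_functions \<Omega>" "\<And>x. norm (grad \<phi> x) \<le> B"
  shows "\<bar>\<phi> y - \<phi> x\<bar> \<le> B * norm (y - x)"
proof -
  have "norm (\<phi> y - \<phi> x) \<le> B * norm (y - x)"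
  proof (rule differentiable_bound[OF convex_UNIV])
    show "(\<phi> has_derivative frechet_derivative \<phi> (at z)) (at z within UNIV)" for z
      using test_functions_has_derivative[OF assms(1)] by simp
    show "onorm (frechet_derivative \<phi> (at z)) \<le> B" for z
    proof (rule onorm_le)
      fix v
      have "norm (frechet_derivative \<phi> (at z) v) \<le> norm (grad \<phi> z) * norm v"
        unfolding frechet_derivative_eq_grad[OF assms(1)] real_norm_def by (rule Cauchy_Schwarz_ineq2)
      also have "\<dots> \<le> B * norm v" by (intro mult_right_mono assms) simp
      finally show "norm (frechet_derivative \<phi> (at z) v) \<le> B * norm v" .
    qed
  qed auto
  then show ?thesis by simp
qed

text \<open>The integrals of the difference quotients vanish by translation invariance.\<close>

lemma integral_partial_deriv_zero:
  fixes \<phi> :: "real^'n \<Rightarrow> real"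
  assumes \<phi>: "\<phi> \<in> test_functions \<Omega>"
  shows "(\<integral>x. partial_deriv i \<phi> x \<partial>lborel) = 0"
proof -
  let ?e = "axis i 1 :: real^'n"
  define s where "s n x = (\<phi> ((1 / real (Suc n)) *\<^sub>R ?e + x) - \<phi> x) * real (Suc n)" for n x
  obtain B where B: "0 \<le> B" "\<And>x. norm (grad \<phi> x) \<le> B" by (rule grad_bounded[OF \<phi>]) (rule that)
  obtain K where K: "compact K" "K \<subseteq> \<Omega>" "\<And>x. x \<notin> K \<Longrightarrow> \<phi> x = 0"
    by (rule test_functions_support[OF \<phi>]) (rule that)
  obtain R where R: "\<And>x. x \<in> K \<Longrightarrow> norm x \<le> R"
    using compact_imp_bounded[OF K(1)] by (auto simp: bounded_iff)
  note [measurable] = test_functions_integrable(1)[OF \<phi>] test_functions_integrable(1)[OF test_functions_partial_deriv[OF \<phi>]]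
  have ne: "norm ?e = 1" by (simp add: norm_axis_1)
  have lim: "(\<lambda>n. s n x) \<longlonglongrightarrow> partial_deriv i \<phi> x" for x
  proof -
    have "((\<lambda>t. \<phi> (x + t *\<^sub>R ?e)) has_derivative (\<lambda>t. frechet_derivative \<phi> (at x) (t *\<^sub>R ?e))) (at 0)"
    proof -
      have "((\<lambda>t. x + t *\<^sub>R ?e) has_derivative (\<lambda>t. t *\<^sub>R ?e)) (at 0)"
        by (auto intro!: derivative_eq_intros)
      from has_derivative_compose[OF this] test_functions_has_derivative[OF \<phi>, of x] show ?thesis by simp
    qed
    then have "((\<lambda>t. \<phi> (x + t *\<^sub>R ?e)) has_real_derivative partial_deriv i \<phi> x) (at 0)"
      by (simp add: has_field_derivative_def partial_deriv_def frechet_derivative_eq_grad[OF \<phi>] mult_commute_abs)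
    then have "((\<lambda>t. (\<phi> (x + t *\<^sub>R ?e) - \<phi> x) / t) \<longlongrightarrow> partial_deriv i \<phi> x) (at 0)"
      by (simp add: DERIV_def)
    moreover have "filterlim (\<lambda>n. 1 / real (Suc n)) (at 0) sequentially"
      unfolding filterlim_at using LIMSEQ_Suc[OF lim_1_over_n] by (auto simp: o_def)
    ultimately have "(\<lambda>n. (\<phi> (x + (1 / real (Suc n)) *\<^sub>R ?e) - \<phi> x) / (1 / real (Suc n))) \<longlonglongrightarrow> partial_deriv i \<phi> x"
      by (rule filterlim_compose)
    then show ?thesis by (simp add: s_def add.commute)
  qed
  have "(\<lambda>n. \<integral>x. s n x \<partial>lborel) \<longlonglongrightarrow> (\<integral>x. partial_deriv i \<phi> x \<partial>lborel)"
  proof (rule integral_dominated_convergence)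
    \<comment> \<open>The quotients are bounded by the Lipschitz constant \<open>B\<close> and
      vanish outside a ball whose radius leaves room for shifts of length at most 1.\<close>
    show "integrable lborel (\<lambda>x. B * indicator (cball 0 (R + 1)) x :: real)"
      by (intro integrable_mult_right integrable_real_indicator) (use emeasure_bounded_finite[OF bounded_cball, of 0 "R + 1"] in auto)
    show "AE x in lborel. norm (s n x) \<le> B * indicator (cball 0 (R + 1)) x" for n
    proof (rule AE_I2)
      fix x
      let ?h = "(1 / real (Suc n)) *\<^sub>R ?e"
      have h: "norm ?h = 1 / real (Suc n)" using ne by simp
      have "\<bar>\<phi> (?h + x) - \<phi> x\<bar> \<le> B * norm ((?h + x) - x)"
        by (rule test_functions_Lipschitz[OF \<phi> B(2)])
      then have "\<bar>\<phi> (?h + x) - \<phi> x\<bar> * real (Suc n) \<le> (B * norm ?h) * real (Suc n)"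
        by (intro mult_right_mono) simp_all
      also have "\<dots> = B" unfolding h by simp
      finally have b: "norm (s n x) \<le> B" unfolding s_def by (simp add: abs_mult)
      show "norm (s n x) \<le> B * indicator (cball 0 (R + 1)) x"
      proof (cases "norm x \<le> R + 1")
        case True then show ?thesis using b by simp
      next
        case False
        have "norm x \<le> norm (?h + x) + norm ?h" using norm_triangle_ineq4[of "?h + x" ?h] by simp
        moreover have "norm ?h \<le> 1" using h by simp
        ultimately have "\<not> norm (?h + x) \<le> R" "\<not> norm x \<le> R" using False by linarith+
        then have "\<phi> (?h + x) = 0" "\<phi> x = 0" using R K(3) by blast+
        then show ?thesis using B by (simp add: s_def)
      qed
    qed
  qed (use lim in \<open>auto simp: s_def[abs_def]\<close>)
  moreover have "(\<integral>x. s n x \<partial>lborel) = 0" for n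
    using lborel_integral_translation[OF test_functions_integrable(1)[OF \<phi>]] test_functions_integrable(2)[OF \<phi>]
    by (simp add: s_def)
  ultimately show ?thesis by (simp add: LIMSEQ_const_iff)
qed

text \<open>The partial derivative of the product integrates to zero, and the product rule splits
  it. All integrals run over the whole space, so the two functions may belong to different open
  sets.\<close>

lemma integration_by_parts:
  fixes \<phi> \<psi> :: "real^'n \<Rightarrow> real"
  assumes \<phi>: "\<phi> \<in> test_functions \<Omega>" and \<psi>: "\<psi> \<in> test_functions \<Omega>'"
  shows "(\<integral>x. \<phi> x * partial_deriv i \<psi> x \<partial>lebesgue) = - (\<integral>x. partial_deriv i \<phi> x * \<psi> x \<partial>lebesgue)"
proof -
  let ?f = "\<lambda>x. \<phi> x * partial_deriv i \<psi> x" and ?g = "\<lambda>x. partial_deriv i \<phi> x * \<psi> x"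
  have f: "?f \<in> test_functions \<Omega>'"
    by (rule test_functions_mult[OF test_functions_partial_deriv[OF \<psi>] test_functions_Ck[OF \<phi>]])
  have g: "?g \<in> test_functions \<Omega>'"
    by (rule test_functions_mult[OF \<psi> test_functions_Ck[OF test_functions_partial_deriv[OF \<phi>]]])
  have "partial_deriv i (\<lambda>x. \<phi> x * \<psi> x) x = ?f x + ?g x" for x
    using frechet_derivative_at[OF has_derivative_mult[OF test_functions_has_derivative[OF \<phi>] test_functions_has_derivative[OF \<psi>]], symmetric]
    by (simp add: partial_deriv_def)
  then have "(\<integral>x. ?f x + ?g x \<partial>lborel) = 0"
    using integral_partial_deriv_zero[OF test_functions_mult[OF \<psi> test_functions_Ck[OF \<phi>]], of i] by simp
  then have "(\<integral>x. ?f x \<partial>lborel) = - (\<integral>x. ?g x \<partial>lborel)"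
    using test_functions_integrable(2)[OF f] test_functions_integrable(2)[OF g] by simp
  then show ?thesis
    using test_functions_integrable(1)[OF f] test_functions_integrable(1)[OF g] by (simp add: integral_completion)
qed

text \<open>Boxes generate the Borel sets and are stable under intersection; the sets over which the
  integral vanishes form a Dynkin system, where \<open>tot\<close> takes care of
  complements.\<close>

lemma AE_zero_if_box_integrals_zero:
  fixes f :: "'a::euclidean_space \<Rightarrow> real"
  assumes f: "integrable lborel f" and box: "\<And>a b. (\<integral>x. indicator (box a b) x * f x \<partial>lborel) = 0"
    and tot: "(\<integral>x. f x \<partial>lborel) = 0"
  shows "AE x in lborel. f x = 0"
proof (rule density_unique_real[OF f])
  show "integrable lborel (\<lambda>_. 0::real)" by simp
  have st: "Int_stable (range (\<lambda>(a, b). box a b :: 'a set))"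
    by (auto simp: Int_stable_def box_Int_box)
  have subset_Pow_UNIV: "range (\<lambda>(a, b). box a b :: 'a set) \<subseteq> Pow UNIV" by simp
  have int: "integrable lborel (\<lambda>x. indicator A x * f x)" if "A \<in> sets borel" for A
    using integrable_mult_indicator[OF _ f, of A] that by simp
  fix A :: "'a set" assume "A \<in> sets lborel"
  then have "A \<in> sigma_sets UNIV (range (\<lambda>(a, b). box a b :: 'a set))"
    by (simp add: borel_eq_box)
  then have "(\<integral>x. indicator A x * f x \<partial>lborel) = 0"
  proof (induction rule: sigma_sets_induct_disjoint[OF st subset_Pow_UNIV, consumes 1, case_names basic empty compl union])
    case (compl A)
    then have A: "A \<in> sets borel" by (simp add: borel_eq_box)
    have "(\<integral>x. indicator (UNIV - A) x * f x \<partial>lborel) = (\<integral>x. f x - indicator A x * f x \<partial>lborel)"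
      by (intro Bochner_Integration.integral_cong) (auto simp: indicator_def)
    then show ?case using compl int[OF A] f tot by simp
  next
    case (union A)
    then have A: "A i \<in> sets borel" for i by (auto simp: borel_eq_box)
    have "(LINT x:(\<Union>i. A i)|lborel. f x) = suminf (\<lambda>i. LINT x:A i|lborel. f x)"
    proof (rule lebesgue_integral_countable_add)
      show "set_integrable lborel (\<Union>i. A i) f"
        using int[of "\<Union>i. A i"] A by (simp add: set_integrable_def sets.countable_UN)
    qed (use A union in \<open>auto simp: disjoint_family_on_def\<close>)
    then show ?case using union by (simp add: set_lebesgue_integral_def)
  qed (use box in auto)
  then show "(LINT x:A|lborel. f x) = (LINT x:A|lborel. 0)" by (simp add: set_lebesgue_integral_def)
qed

text \<open>The bumps of a box converge to its indicator, so box integrals vanish by dominated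
  convergence. On each box this gives the claim by \<open>AE_zero_if_box_integrals_zero\<close>, and
  countably many closed boxes exhaust \<Omega>.\<close>

lemma AE_zero_if_test_integrals_zero:
  fixes g :: "real^'n \<Rightarrow> real"
  assumes \<Omega>: "open \<Omega>"
    and loc: "\<And>a b. cbox a b \<subseteq> \<Omega> \<Longrightarrow> integrable lebesgue (\<lambda>x. indicator (cbox a b) x * g x)"
    and zero: "\<And>\<phi>. \<phi> \<in> test_functions \<Omega> \<Longrightarrow> (\<integral>x. g x * \<phi> x \<partial>lebesgue) = 0"
  shows "AE x in lebesgue. x \<in> \<Omega> \<longrightarrow> g x = 0"
proof -
  have box: "(\<integral>x. indicator (box a b) x * g x \<partial>lebesgue) = 0" if ab: "cbox a b \<subseteq> \<Omega>" for a b
  proof -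
    let ?h = "\<lambda>x. indicator (cbox a b) x * g x"
    have hm: "?h \<in> borel_measurable lebesgue" using loc[OF ab] by simp
    have bm: "box_bump a b j \<in> borel_measurable lebesgue" for j
      using test_functions_integrable(3)[OF box_bump_test[OF ab]] by simp
    have eq: "g x * box_bump a b j x = ?h x * box_bump a b j x" for x j
      using box_bump_nonzero_iff[of a b j x] box_subset_cbox[of a b] by (auto simp: indicator_def)
    have eq2: "indicator (box a b) x * g x = ?h x * indicator (box a b) x" for x
      using box_subset_cbox[of a b] by (auto simp: indicator_def)
    have "(\<lambda>j. \<integral>x. ?h x * box_bump a b j x \<partial>lebesgue) \<longlonglongrightarrow> (\<integral>x. ?h x * indicator (box a b) x \<partial>lebesgue)"
    proof (rule integral_dominated_convergence[where w="\<lambda>x. norm (?h x)"])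
      show "AE x in lebesgue. (\<lambda>j. ?h x * box_bump a b j x) \<longlonglongrightarrow> ?h x * indicator (box a b) x"
        by (intro AE_I2 tendsto_intros box_bump_limit)
      show "AE x in lebesgue. norm (?h x * box_bump a b j x) \<le> norm (?h x)" for j
        using box_bump_bounds[of a b j] by (intro AE_I2) (auto simp: abs_mult intro!: mult_left_le)
      show "integrable lebesgue (\<lambda>x. norm (?h x))" using loc[OF ab] by simp
      show "(\<lambda>x. ?h x * indicator (box a b) x) \<in> borel_measurable lebesgue"
        by (intro borel_measurable_times hm borel_measurable_indicator) simp
      show "(\<lambda>x. ?h x * box_bump a b j x) \<in> borel_measurable lebesgue" for j
        by (intro borel_measurable_times hm bm)
    qed
    moreover have "(\<integral>x. ?h x * box_bump a b j x \<partial>lebesgue) = 0" for j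
      using zero[OF box_bump_test[OF ab]] unfolding eq .
    ultimately have "(\<integral>x. ?h x * indicator (box a b) x \<partial>lebesgue) = 0"
      by (simp add: LIMSEQ_const_iff)
    then show ?thesis unfolding eq2 .
  qed
  have AE: "AE x in lebesgue. x \<in> box a b \<longrightarrow> g x = 0" if ab: "cbox a b \<subseteq> \<Omega>" for a b
  proof -
    let ?h = "\<lambda>x. indicator (box a b) x * g x"
    have "?h = (\<lambda>x. indicator (box a b) x * (indicator (cbox a b) x * g x))"
      using box_subset_cbox[of a b] by (auto simp: indicator_def fun_eq_iff)
    then have h: "integrable lebesgue ?h"
      using integrable_mult_indicator[OF _ loc[OF ab], of "box a b"] by simp
    \<comment> \<open>The lemma on boxes lives on \<open>lborel\<close>, while \<open>g\<close> is
      only Lebesgue measurable; hence the passage to a Borel version.\<close>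
    then obtain f where f: "f \<in> borel_measurable lborel" "AE x in lborel. ?h x = f x"
      using completion_ex_borel_measurable_real[of ?h lborel] by (auto simp: integrable_iff_bounded)
    have fm[measurable]: "f \<in> borel_measurable borel" using f by simp
    have ae: "AE x in lebesgue. ?h x = f x" using f(2) by (rule AE_completion)
    have hm: "?h \<in> borel_measurable lebesgue" using h by simp
    have fi: "integrable lborel f"
      using integrable_cong_AE_imp[OF h measurable_completion[OF f(1)] ae] fm
      by (simp add: integrable_completion)
    have int: "(\<integral>x. indicator A x * f x \<partial>lborel) = (\<integral>x. indicator A x * ?h x \<partial>lebesgue)" if "A \<in> sets borel" for A
    proof -
      have "(\<integral>x. indicator A x * f x \<partial>lborel) = (\<integral>x. indicator A x * f x \<partial>lebesgue)"
        using that fm by (intro integral_completion[symmetric]) simp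
      also have "\<dots> = (\<integral>x. indicator A x * ?h x \<partial>lebesgue)"
      proof (rule integral_cong_AE)
        show "(\<lambda>x. indicator A x * f x) \<in> borel_measurable lebesgue"
          using that fm by (intro measurable_completion) simp
        show "(\<lambda>x. indicator A x * ?h x) \<in> borel_measurable lebesgue"
          by (rule borel_measurable_times[OF borel_measurable_indicator hm]) (use that in simp)
        show "AE x in lebesgue. indicator A x * f x = indicator A x * ?h x" using ae by eventually_elim simp
      qed
      finally show ?thesis .
    qed
    have sets_borel_box: "box c d \<in> sets borel" for c d :: "real^'n" by simp
    have "AE x in lborel. f x = 0"
    proof (rule AE_zero_if_box_integrals_zero[OF fi])
      fix c d
      obtain u v where uv: "box c d \<inter> box a b = box u v" using box_Int_box by blast
      show "(\<integral>x. indicator (box c d) x * f x \<partial>lborel) = 0"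
      proof (cases "box u v = {}")
        case True
        then have "(\<lambda>x. indicator (box c d) x * ?h x) = (\<lambda>_. 0)"
          using uv by (auto simp: indicator_def fun_eq_iff)
        then show ?thesis by (simp only: int[OF sets_borel_box]) simp
      next
        case False
        then have "cbox u v \<subseteq> cbox a b" using uv closure_mono[of "box u v" "box a b"]
          by (metis Int_lower2 closure_box box_eq_empty(1) inf.absorb_iff2 inf_bot_right)
        then have "(\<integral>x. indicator (box u v) x * g x \<partial>lebesgue) = 0" using box ab by blast
        moreover have "(\<lambda>x. indicator (box c d) x * ?h x) = (\<lambda>x. indicator (box u v) x * g x)"
          unfolding uv[symmetric] by (auto simp: indicator_def fun_eq_iff)
        ultimately show ?thesis by (simp only: int[OF sets_borel_box])
      qed
    next
      have "(\<integral>x. f x \<partial>lborel) = (\<integral>x. indicator UNIV x * ?h x \<partial>lebesgue)" using int[of UNIV] by simp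
      then show "(\<integral>x. f x \<partial>lborel) = 0" using box[OF ab] by simp
    qed
    then have "AE x in lebesgue. f x = 0" by (rule AE_completion)
    with ae show ?thesis by eventually_elim (auto simp: indicator_def)
  qed
  obtain D where D: "countable D" "D \<subseteq> Pow \<Omega>" "\<And>X. X \<in> D \<Longrightarrow> \<exists>a b. X = cbox a b" "\<Union>D = \<Omega>"
    using open_countable_Union_open_cbox[OF \<Omega>] by metis
  have "AE x in lebesgue. \<forall>X\<in>D. x \<in> X \<longrightarrow> g x = 0"
  proof (subst AE_ball_countable[OF D(1)], rule ballI)
    fix X assume X: "X \<in> D"
    then obtain a b where ab: "X = cbox a b" "cbox a b \<subseteq> \<Omega>" using D by blast
    have "negligible (cbox a b - box a b)" using negligible_frontier_interval by blast
    then have "AE x in lebesgue. x \<notin> cbox a b - box a b"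
      by (intro AE_not_in) (simp add: negligible_iff_null_sets)
    with AE[OF ab(2)] show "AE x in lebesgue. x \<in> X \<longrightarrow> g x = 0"
      by eventually_elim (use ab in auto)
  qed
  then show ?thesis by eventually_elim (use D(4) in auto)
qed

section \<open>Functions with integrable powers\<close>

lemma one_le_powr_nonpos:
  fixes t q :: real
  assumes "0 < t" "t < 1" "q \<le> 0"
  shows "1 \<le> t powr q"
proof -
  have "1 powr q \<le> t powr q" by (rule powr_mono2') (use assms in auto)
  then show ?thesis by simp
qed

text \<open>Convexity of the power at the points \<open>norm a / (1 - t)\<close> and
  \<open>norm b / t\<close>. For small \<open>t\<close> the factor of \<open>norm a powr p\<close>
  is close to 1, so this is a triangle inequality for p-th powers that takes no roots.\<close>

lemma norm_add_powr:
  fixes a b :: "'a::real_normed_vector"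
  assumes p: "1 < p" and t: "0 < t" "t < 1"
  shows "norm (a + b) powr p \<le> (1 - t) powr (1 - p) * norm a powr p + t powr (1 - p) * norm b powr p"
proof -
  consider "a = 0" | "b = 0" | "a \<noteq> 0" "b \<noteq> 0" by blast
  then show ?thesis
  proof cases
    case 1
    have "1 * norm b powr p \<le> t powr (1 - p) * norm b powr p"
      by (intro mult_right_mono one_le_powr_nonpos) (use p t in auto)
    then show ?thesis using 1 by simp
  next
    case 2
    have "1 * norm a powr p \<le> (1 - t) powr (1 - p) * norm a powr p"
      by (intro mult_right_mono one_le_powr_nonpos) (use p t in auto)
    then show ?thesis using 2 by simp
  next
    case 3
    let ?x = "norm a / (1 - t)" and ?y = "norm b / t"
    have pos: "?x > 0" "?y > 0" using 3 t by auto
    have "norm (a + b) powr p \<le> (norm a + norm b) powr p"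
      by (rule powr_mono2) (use p norm_triangle_ineq in auto)
    also have "norm a + norm b = (1 - t) * ?x + t * ?y" using t by simp
    also have "\<dots> powr p \<le> (1 - t) * ?x powr p + t * ?y powr p"
      using convex_onD[OF powr_convex[of p], of t ?x ?y] p t pos by simp
    also have "(1 - t) * ?x powr p = (1 - t) powr (1 - p) * norm a powr p"
      using t by (simp add: powr_divide powr_diff)
    also have "t * ?y powr p = t powr (1 - p) * norm b powr p"
      using t by (simp add: powr_divide powr_diff)
    finally show ?thesis .
  qed
qed

lemma norm_add_powr2:
  fixes a b :: "'a::real_normed_vector"
  assumes p: "0 < p"
  shows "norm (a + b) powr p \<le> 2 powr p * (norm a powr p + norm b powr p)"
proof -
  let ?m = "max (norm a) (norm b)"
  have "norm (a + b) \<le> 2 * ?m" using norm_triangle_ineq[of a b] by linarith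
  then have "norm (a + b) powr p \<le> (2 * ?m) powr p" by (intro powr_mono2) (use p in auto)
  also have "\<dots> = 2 powr p * ?m powr p" by (simp add: powr_mult)
  also have "?m powr p \<le> norm a powr p + norm b powr p" by (auto simp: max_def)
  finally show ?thesis by simp
qed

text \<open>For \<open>t > d\<close> the factor \<open>(t / d) powr (p - 1)\<close> is at least 1.
  Integrated over a set of finite measure, this bounds first powers by p-th powers, with a free
  parameter instead of the Hoelder constant.\<close>

lemma young_split:
  fixes t :: real
  assumes p: "1 < p" and d: "0 < d" and t: "0 \<le> t"
  shows "t \<le> d + d powr (1 - p) * t powr p"
proof (cases "t \<le> d")
  case True then show ?thesis using d by (simp add: add_increasing2)
next
  case False
  then have "t = t powr (1 - p) * t powr p" using d by (simp flip: powr_add)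
  also have "\<dots> \<le> d powr (1 - p) * t powr p"
    by (intro mult_right_mono powr_mono2') (use False d p in auto)
  finally show ?thesis using d by simp
qed

definition Lp :: "real \<Rightarrow> (real^'n \<Rightarrow> 'b::euclidean_space) \<Rightarrow> bool" where
  "Lp p f \<longleftrightarrow> f \<in> borel_measurable lebesgue \<and> integrable lebesgue (\<lambda>x. norm (f x) powr p)"

definition pint :: "real \<Rightarrow> (real^'n \<Rightarrow> 'b::euclidean_space) \<Rightarrow> real" where
  "pint p f = (\<integral>x. norm (f x) powr p \<partial>lebesgue)"

lemma pint_nonneg: "0 \<le> pint p f"
  by (simp add: pint_def)

lemma LpD: "Lp p f \<Longrightarrow> f \<in> borel_measurable lebesgue"
  "Lp p f \<Longrightarrow> integrable lebesgue (\<lambda>x. norm (f x) powr p)"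
  by (auto simp: Lp_def)

lemma Lp_add:
  assumes p: "0 < p" and f: "Lp p f" and g: "Lp p g"
  shows "Lp p (\<lambda>x. f x + g x)" "pint p (\<lambda>x. f x + g x) \<le> 2 powr p * (pint p f + pint p g)"
proof -
  note [measurable] = LpD(1)[OF f] LpD(1)[OF g]
  have m: "(\<lambda>x. f x + g x) \<in> borel_measurable lebesgue" by measurable
  have dom: "integrable lebesgue (\<lambda>x. 2 powr p * (norm (f x) powr p + norm (g x) powr p))"
    by (intro integrable_mult_right Bochner_Integration.integrable_add LpD f g)
  have i: "integrable lebesgue (\<lambda>x. norm (f x + g x) powr p)"
    by (rule Bochner_Integration.integrable_bound[OF dom])
       (use norm_add_powr2[OF p] in \<open>auto intro!: AE_I2\<close>)
  show "Lp p (\<lambda>x. f x + g x)" using m i by (simp add: Lp_def)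
  have "pint p (\<lambda>x. f x + g x) \<le> (\<integral>x. 2 powr p * (norm (f x) powr p + norm (g x) powr p) \<partial>lebesgue)"
    unfolding pint_def by (intro integral_mono i dom norm_add_powr2[OF p])
  then show "pint p (\<lambda>x. f x + g x) \<le> 2 powr p * (pint p f + pint p g)"
    using LpD(2)[OF f] LpD(2)[OF g] by (simp add: pint_def)
qed

lemma pint_add_sharp:
  assumes p: "1 < p" and f: "Lp p f" and g: "Lp p g" and t: "0 < t" "t < 1"
  shows "pint p (\<lambda>x. f x + g x) \<le> (1 - t) powr (1 - p) * pint p f + t powr (1 - p) * pint p g"
proof -
  have p0: "0 < p" using p by simp
  have "pint p (\<lambda>x. f x + g x)
     \<le> (\<integral>x. (1 - t) powr (1 - p) * norm (f x) powr p + t powr (1 - p) * norm (g x) powr p \<partial>lebesgue)"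
    unfolding pint_def
    by (intro integral_mono norm_add_powr[OF p t] Bochner_Integration.integrable_add integrable_mult_right
        LpD(2) f g Lp_add(1)[OF p0])
  then show ?thesis using LpD(2)[OF f] LpD(2)[OF g] by (simp add: pint_def)
qed

lemma Lp_scale:
  assumes "Lp p f"
  shows "Lp p (\<lambda>x. c *\<^sub>R f x)" "pint p (\<lambda>x. c *\<^sub>R f x) = \<bar>c\<bar> powr p * pint p f"
proof -
  note [measurable] = LpD(1)[OF assms]
  have "(\<lambda>x. c *\<^sub>R f x) \<in> borel_measurable lebesgue" by measurable
  then show "Lp p (\<lambda>x. c *\<^sub>R f x)" "pint p (\<lambda>x. c *\<^sub>R f x) = \<bar>c\<bar> powr p * pint p f"
    using LpD(2)[OF assms] by (auto simp: Lp_def pint_def powr_mult)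
qed

lemma Lp_diff:
  assumes p: "0 < p" and f: "Lp p f" and g: "Lp p g"
  shows "Lp p (\<lambda>x. f x - g x)" "pint p (\<lambda>x. f x - g x) \<le> 2 powr p * (pint p f + pint p g)"
  using Lp_add[OF p f Lp_scale(1)[OF g, of "-1"]] Lp_scale(2)[OF g, of "-1"] by simp_all

lemma pint_minus: "pint p (\<lambda>x. f x - g x) = pint p (\<lambda>x. g x - f x)"
  by (simp add: pint_def norm_minus_commute)

lemma pint_cong_AE:
  assumes "Lp p f" "Lp p g" "AE x in lebesgue. f x = g x"
  shows "pint p f = pint p g"
  unfolding pint_def
proof (rule integral_cong_AE)
  show "AE x in lebesgue. norm (f x) powr p = norm (g x) powr p"
    using assms(3) by eventually_elim simp
qed (use LpD(2)[OF assms(1)] LpD(2)[OF assms(2)] in auto)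

lemma Lp_continuous_compact:
  fixes f :: "real^'n \<Rightarrow> 'b::euclidean_space"
  assumes p: "0 < p" and f: "continuous_on UNIV f" "compact K" "\<And>x. x \<notin> K \<Longrightarrow> f x = 0"
  shows "Lp p f"
proof -
  have "continuous_on UNIV (\<lambda>x. norm (f x) powr p)"
    by (intro continuous_on_powr' continuous_intros f) (use p in auto)
  then have "integrable lebesgue (\<lambda>x. norm (f x) powr p)"
    by (rule continuous_compact_support_integrable(3)[OF _ f(2)]) (use f(3) p in auto)
  then show ?thesis
    using continuous_compact_support_integrable(1)[OF f]
    by (auto simp: Lp_def intro: measurable_completion)
qed

lemma Lp_test:
  assumes p: "0 < p" and \<phi>: "\<phi> \<in> test_functions \<Omega>"
  shows "Lp p \<phi>" "Lp p (grad \<phi>)"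
proof -
  obtain K where K: "compact K" "K \<subseteq> \<Omega>" "\<And>x. x \<notin> K \<Longrightarrow> \<phi> x = 0"
     "\<And>x v. x \<notin> K \<Longrightarrow> frechet_derivative \<phi> (at x) v = 0"
    by (rule test_functionsE[OF \<phi>]) (rule that)
  show "Lp p \<phi>" by (rule Lp_continuous_compact[OF p test_functions_continuous[OF \<phi>] K(1,3)])
  have "grad \<phi> x = 0" if "x \<notin> K" for x
    using K(4)[OF that] by (simp add: vec_eq_iff grad_nth partial_deriv_def)
  then show "Lp p (grad \<phi>)" by (rule Lp_continuous_compact[OF p continuous_grad[OF \<phi>] K(1)])
qed

text \<open>The sharp sum inequality is applied in both directions. The error carries the factor
  \<open>t powr (1 - p)\<close>, which may be large but is fixed once \<open>t\<close> is chosen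
  with \<open>(1 - t) powr (1 - p)\<close> close enough to 1.\<close>

lemma pint_tendsto:
  assumes p: "1 < p" and f: "\<And>w. w \<in> S \<Longrightarrow> Lp p (f w)" and g: "Lp p g"
    and F: "eventually (\<lambda>w. w \<in> S) F"
    and lim: "((\<lambda>w. pint p (\<lambda>x. f w x - g x)) \<longlongrightarrow> 0) F"
  shows "((\<lambda>w. pint p (f w)) \<longlongrightarrow> pint p g) F"
proof (cases "F = bot")
  case False
  have p0: "0 < p" using p by simp
  have upper: "pint p (f w) \<le> (1 - t) powr (1 - p) * pint p g + t powr (1 - p) * pint p (\<lambda>x. f w x - g x)"
    if "w \<in> S" "0 < t" "t < 1" for w t
    using pint_add_sharp[OF p g Lp_diff(1)[OF p0 f[OF that(1)] g] that(2,3)] by simp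
  have lower: "pint p g \<le> (1 - t) powr (1 - p) * pint p (f w) + t powr (1 - p) * pint p (\<lambda>x. f w x - g x)"
    if "w \<in> S" "0 < t" "t < 1" for w t
    using pint_add_sharp[OF p f[OF that(1)] Lp_diff(1)[OF p0 g f[OF that(1)]] that(2,3)]
      pint_minus[of p g "f w"] by simp
  have tlim: "((\<lambda>t. (1 - t) powr (1 - p) * c) \<longlongrightarrow> c) (at_right 0)" for c :: real
  proof -
    have "((\<lambda>t. (1 - t) powr (1 - p) * c) \<longlongrightarrow> (1 - 0) powr (1 - p) * c) (at_right 0)"
      by (intro tendsto_intros) auto
    then show ?thesis by simp
  qed
  have small: "eventually (\<lambda>t. 0 < t \<and> t < 1) (at_right (0::real))"
    unfolding eventually_at_right_field by (intro exI[of _ 1]) auto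
  show ?thesis
  proof (rule order_tendstoI)
    fix a assume a: "pint p g < a"
    have "eventually (\<lambda>t. (1 - t) powr (1 - p) * pint p g < a) (at_right 0)"
      using order_tendstoD(2)[OF tlim a] .
    then obtain t where t: "0 < t" "t < 1" "(1 - t) powr (1 - p) * pint p g < a"
      using eventually_happens[OF eventually_conj[OF small]] by auto
    have "((\<lambda>w. (1 - t) powr (1 - p) * pint p g + t powr (1 - p) * pint p (\<lambda>x. f w x - g x))
        \<longlongrightarrow> (1 - t) powr (1 - p) * pint p g + t powr (1 - p) * 0) F"
      by (intro tendsto_intros lim)
    from order_tendstoD(2)[OF this, of a] t(3)
    have "eventually (\<lambda>w. (1 - t) powr (1 - p) * pint p g + t powr (1 - p) * pint p (\<lambda>x. f w x - g x) < a) F"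
      by simp
    then show "eventually (\<lambda>w. pint p (f w) < a) F"
      using F by eventually_elim (use upper t in fastforce)
  next
    fix a assume a: "a < pint p g"
    have "eventually (\<lambda>t. (1 - t) powr (1 - p) * a < pint p g) (at_right 0)"
      using order_tendstoD(2)[OF tlim a] .
    then obtain t where t: "0 < t" "t < 1" "(1 - t) powr (1 - p) * a < pint p g"
      using eventually_happens[OF eventually_conj[OF small]] by auto
    have "((\<lambda>w. (1 - t) powr (1 - p) * a + t powr (1 - p) * pint p (\<lambda>x. f w x - g x))
        \<longlongrightarrow> (1 - t) powr (1 - p) * a + t powr (1 - p) * 0) F"
      by (intro tendsto_intros lim)
    from order_tendstoD(2)[OF this, of "pint p g"] t(3)
    have "eventually (\<lambda>w. (1 - t) powr (1 - p) * a + t powr (1 - p) * pint p (\<lambda>x. f w x - g x) < pint p g) F"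
      by simp
    then show "eventually (\<lambda>w. a < pint p (f w)) F"
      using F
    proof eventually_elim
      case (elim w)
      then have "(1 - t) powr (1 - p) * a < (1 - t) powr (1 - p) * pint p (f w)"
        using lower[of w t] t by linarith
      then show ?case using t by simp
    qed
  qed
qed simp

section \<open>The closure of the test functions\<close>

text \<open>
  Functions are paired with their gradients and extended by zero to the whole space, so that no
  weak gradient has to be chosen and enlarging \<open>\<Omega>\<close> is an inclusion.
\<close>

definition W0 :: "real \<Rightarrow> (real^'n) set \<Rightarrow> ((real^'n \<Rightarrow> real) \<times> (real^'n \<Rightarrow> real^'n)) set" where
  "W0 p \<Omega> = {(u, G). Lp p u \<and> Lp p G \<and> (\<forall>x. x \<notin> \<Omega> \<longrightarrow> u x = 0 \<and> G x = 0) \<and>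
     (\<forall>\<epsilon>>0. \<exists>\<phi>\<in>test_functions \<Omega>. pint p (\<lambda>x. u x - \<phi> x) + pint p (\<lambda>x. G x - grad \<phi> x) < \<epsilon>)}"

lemma W0D:
  assumes "(u, G) \<in> W0 p \<Omega>"
  shows "Lp p u" "Lp p G" "x \<notin> \<Omega> \<Longrightarrow> u x = 0" "x \<notin> \<Omega> \<Longrightarrow> G x = 0"
  using assms by (auto simp: W0_def)

lemma W0_approx:
  assumes "(u, G) \<in> W0 p \<Omega>" "0 < \<epsilon>"
  obtains \<phi> where "\<phi> \<in> test_functions \<Omega>" "pint p (\<lambda>x. u x - \<phi> x) + pint p (\<lambda>x. G x - grad \<phi> x) < \<epsilon>"
  using assms by (auto simp: W0_def)

lemma W0I:
  assumes "Lp p u" "Lp p G" "\<And>x. x \<notin> \<Omega> \<Longrightarrow> u x = 0" "\<And>x. x \<notin> \<Omega> \<Longrightarrow> G x = 0"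
    and "\<And>\<epsilon>. 0 < \<epsilon> \<Longrightarrow>
      \<exists>\<phi>\<in>test_functions \<Omega>. pint p (\<lambda>x. u x - \<phi> x) + pint p (\<lambda>x. G x - grad \<phi> x) < \<epsilon>"
  shows "(u, G) \<in> W0 p \<Omega>"
  unfolding W0_def using assms by simp

lemma W0_mono:
  assumes "\<Omega> \<subseteq> \<Omega>'" "(u, G) \<in> W0 p \<Omega>"
  shows "(u, G) \<in> W0 p \<Omega>'"
proof (rule W0I)
  show "\<exists>\<phi>\<in>test_functions \<Omega>'. pint p (\<lambda>x. u x - \<phi> x) + pint p (\<lambda>x. G x - grad \<phi> x) < \<epsilon>" if "0 < \<epsilon>" for \<epsilon>
    using W0_approx[OF assms(2) that] test_functions_mono[OF assms(1)] by metis
qed (use assms(1) W0D[OF assms(2)] in auto)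

lemma W0_test:
  assumes "0 < p" "\<phi> \<in> test_functions \<Omega>"
  shows "(\<phi>, grad \<phi>) \<in> W0 p \<Omega>"
  by (rule W0I)
     (use assms Lp_test[OF assms] test_functions_zero[OF assms(2)] grad_zero_outside[OF assms(2)]
      in \<open>auto simp: pint_def intro!: bexI[of _ \<phi>]\<close>)

lemma W0_add:
  assumes p: "0 < p" and u: "(u, G) \<in> W0 p \<Omega>" and v: "(v, H) \<in> W0 p \<Omega>"
  shows "(\<lambda>x. u x + v x, \<lambda>x. G x + H x) \<in> W0 p \<Omega>"
proof -
  have "\<exists>\<phi>\<in>test_functions \<Omega>. pint p (\<lambda>x. u x + v x - \<phi> x) + pint p (\<lambda>x. G x + H x - grad \<phi> x) < \<epsilon>"
    if \<epsilon>: "0 < \<epsilon>" for \<epsilon>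
  proof -
    \<comment> \<open>Splitting the sums costs a factor \<open>2 powr p\<close>, and each of the two
      approximations contributes one \<delta>.\<close>
    define \<delta> where "\<delta> = \<epsilon> / (2 * 2 powr p)"
    have \<delta>: "0 < \<delta>" using \<epsilon> by (simp add: \<delta>_def)
    obtain \<phi> where \<phi>: "\<phi> \<in> test_functions \<Omega>" "pint p (\<lambda>x. u x - \<phi> x) + pint p (\<lambda>x. G x - grad \<phi> x) < \<delta>"
      by (rule W0_approx[OF u \<delta>])
    obtain \<psi> where \<psi>: "\<psi> \<in> test_functions \<Omega>" "pint p (\<lambda>x. v x - \<psi> x) + pint p (\<lambda>x. H x - grad \<psi> x) < \<delta>"
      by (rule W0_approx[OF v \<delta>])
    have 1: "pint p (\<lambda>x. (u x - \<phi> x) + (v x - \<psi> x)) \<le> 2 powr p * (pint p (\<lambda>x. u x - \<phi> x) + pint p (\<lambda>x. v x - \<psi> x))"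
      by (intro Lp_add(2) p Lp_diff(1) W0D[OF u] W0D[OF v] Lp_test[OF p \<phi>(1)] Lp_test[OF p \<psi>(1)])
    have 2: "pint p (\<lambda>x. (G x - grad \<phi> x) + (H x - grad \<psi> x))
         \<le> 2 powr p * (pint p (\<lambda>x. G x - grad \<phi> x) + pint p (\<lambda>x. H x - grad \<psi> x))"
      by (intro Lp_add(2) p Lp_diff(1) W0D[OF u] W0D[OF v] Lp_test[OF p \<phi>(1)] Lp_test[OF p \<psi>(1)])
    have "pint p (\<lambda>x. (u x - \<phi> x) + (v x - \<psi> x)) + pint p (\<lambda>x. (G x - grad \<phi> x) + (H x - grad \<psi> x))
        \<le> 2 powr p * ((pint p (\<lambda>x. u x - \<phi> x) + pint p (\<lambda>x. G x - grad \<phi> x))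
            + (pint p (\<lambda>x. v x - \<psi> x) + pint p (\<lambda>x. H x - grad \<psi> x)))"
      using 1 2 by (simp add: algebra_simps)
    also have "\<dots> < 2 powr p * (\<delta> + \<delta>)"
      by (intro mult_strict_left_mono add_strict_mono \<phi> \<psi>) simp
    also have "\<dots> = \<epsilon>" by (simp add: \<delta>_def)
    finally have "pint p (\<lambda>x. u x + v x - (\<phi> x + \<psi> x)) + pint p (\<lambda>x. G x + H x - grad (\<lambda>x. \<phi> x + \<psi> x) x) < \<epsilon>"
      by (simp add: grad_add[OF \<phi>(1) \<psi>(1)] algebra_simps)
    then show ?thesis by (rule bexI[of _ "\<lambda>x. \<phi> x + \<psi> x"]) (rule test_functions_add[OF \<phi>(1) \<psi>(1)])
  qed
  then show ?thesis
    by (intro W0I Lp_add(1) p W0D[OF u] W0D[OF v]) (auto simp: W0D(3,4)[OF u] W0D(3,4)[OF v])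
qed

lemma W0_scale:
  assumes p: "0 < p" and u: "(u, G) \<in> W0 p \<Omega>"
  shows "(\<lambda>x. c * u x, \<lambda>x. c *\<^sub>R G x) \<in> W0 p \<Omega>"
proof -
  have "\<exists>\<phi>\<in>test_functions \<Omega>. pint p (\<lambda>x. c * u x - \<phi> x) + pint p (\<lambda>x. c *\<^sub>R G x - grad \<phi> x) < \<epsilon>"
    if \<epsilon>: "0 < \<epsilon>" for \<epsilon>
  proof -
    \<comment> \<open>The summand 1 keeps the quotient meaningful for \<open>c = 0\<close>.\<close>
    define \<delta> where "\<delta> = \<epsilon> / (\<bar>c\<bar> powr p + 1)"
    have pos: "\<bar>c\<bar> powr p + 1 > 0" by (simp add: add_nonneg_pos)
    then have \<delta>: "0 < \<delta>" using \<epsilon> by (simp add: \<delta>_def)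
    obtain \<phi> where \<phi>: "\<phi> \<in> test_functions \<Omega>" "pint p (\<lambda>x. u x - \<phi> x) + pint p (\<lambda>x. G x - grad \<phi> x) < \<delta>"
      by (rule W0_approx[OF u \<delta>])
    have "pint p (\<lambda>x. c *\<^sub>R (u x - \<phi> x)) + pint p (\<lambda>x. c *\<^sub>R (G x - grad \<phi> x))
      = \<bar>c\<bar> powr p * (pint p (\<lambda>x. u x - \<phi> x) + pint p (\<lambda>x. G x - grad \<phi> x))"
      by (simp only: Lp_scale(2)[OF Lp_diff(1)[OF p W0D(1)[OF u] Lp_test(1)[OF p \<phi>(1)]]]
          Lp_scale(2)[OF Lp_diff(1)[OF p W0D(2)[OF u] Lp_test(2)[OF p \<phi>(1)]]] distrib_left)
    also have "\<dots> \<le> \<bar>c\<bar> powr p * \<delta>" using \<phi>(2) by (intro mult_left_mono) auto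
    also have "\<dots> < (\<bar>c\<bar> powr p + 1) * \<delta>" using \<delta> by (intro mult_strict_right_mono) auto
    also have "\<dots> = \<epsilon>" using pos by (simp add: \<delta>_def)
    finally have "pint p (\<lambda>x. c * u x - c * \<phi> x) + pint p (\<lambda>x. c *\<^sub>R G x - grad (\<lambda>x. c * \<phi> x) x) < \<epsilon>"
      by (simp add: grad_cmult[OF \<phi>(1)] algebra_simps)
    then show ?thesis by (rule bexI[of _ "\<lambda>x. c * \<phi> x"]) (rule test_functions_cmult[OF \<phi>(1)])
  qed
  then show ?thesis
    using Lp_scale(1)[OF W0D(1)[OF u], of c] Lp_scale(1)[OF W0D(2)[OF u], of c]
    by (intro W0I) (auto simp: W0D(3,4)[OF u])
qed

text \<open>This is \<open>young_split\<close> integrated over \<open>K\<close>. The parameter stays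
  free in the estimate, so that an error in p-th powers can tend to 0 before \<open>d\<close>
  does.\<close>

lemma Lp_integrable_compact:
  fixes u :: "real^'n \<Rightarrow> 'b::euclidean_space"
  assumes p: "1 < p" and u: "Lp p u" and K: "compact K" and d: "0 < d"
  shows "integrable lebesgue (\<lambda>x. indicator K x *\<^sub>R u x)"
    and "(\<integral>x. indicator K x * norm (u x) \<partial>lebesgue) \<le> d * measure lebesgue K + d powr (1 - p) * pint p u"
proof -
  note [measurable] = LpD(1)[OF u]
  have Km: "K \<in> sets lebesgue" using K by (simp add: borel_compact)
  have Kf: "emeasure lebesgue K < \<infinity>"
    using emeasure_bounded_finite[OF compact_imp_bounded[OF K]] K by (simp add: borel_compact)
  have m: "(\<lambda>x. indicator K x *\<^sub>R u x) \<in> borel_measurable lebesgue"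
    using Km by (intro borel_measurable_scaleR borel_measurable_indicator) auto
  have dom: "integrable lebesgue (\<lambda>x. d * indicator K x + d powr (1 - p) * norm (u x) powr p)"
    using Km Kf LpD(2)[OF u]
    by (intro Bochner_Integration.integrable_add integrable_mult_right integrable_real_indicator) auto
  have le: "indicator K x * norm (u x) \<le> d * indicator K x + d powr (1 - p) * norm (u x) powr p" for x
    using young_split[OF p d, of "norm (u x)"] by (auto simp: indicator_def)
  show i: "integrable lebesgue (\<lambda>x. indicator K x *\<^sub>R u x)"
  proof (rule Bochner_Integration.integrable_bound[OF dom m], rule AE_I2)
    show "norm (indicator K x *\<^sub>R u x) \<le> norm (d * indicator K x + d powr (1 - p) * norm (u x) powr p)" for x
      using le[of x] by simp
  qed
  have "(\<integral>x. indicator K x * norm (u x) \<partial>lebesgue)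
      \<le> (\<integral>x. d * indicator K x + d powr (1 - p) * norm (u x) powr p \<partial>lebesgue)"
    using integrable_norm[OF i] by (intro integral_mono dom le) simp
  also have "\<dots> = d * measure lebesgue K + d powr (1 - p) * pint p u"
    using Km Kf LpD(2)[OF u] by (simp add: pint_def integrable_real_indicator)
  finally show "(\<integral>x. indicator K x * norm (u x) \<partial>lebesgue) \<le> d * measure lebesgue K + d powr (1 - p) * pint p u" .
qed

section \<open>Sobolev functions and their extension by zero\<close>

definition zext :: "(real^'n) set \<Rightarrow> (real^'n \<Rightarrow> 'b::real_vector) \<Rightarrow> real^'n \<Rightarrow> 'b" where
  "zext \<Omega> f = (\<lambda>x. if x \<in> \<Omega> then f x else 0)"

lemma zext_indicator: "zext \<Omega> f x = indicator \<Omega> x *\<^sub>R f x"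
  by (simp add: zext_def indicator_def)

lemma integral_lebesgue_on_open:
  fixes f :: "real^'n \<Rightarrow> 'b::euclidean_space"
  assumes "open \<Omega>"
  shows "(\<integral>x. f x \<partial>lebesgue_on \<Omega>) = (\<integral>x. zext \<Omega> f x \<partial>lebesgue)"
  using assms by (simp add: integral_restrict_space zext_indicator)

lemma pint_zext:
  assumes "open \<Omega>" "p \<noteq> 0"
  shows "(\<integral>x. norm (f x) powr p \<partial>lebesgue_on \<Omega>) = pint p (zext \<Omega> f)"
  unfolding integral_lebesgue_on_open[OF assms(1)] pint_def
  by (rule Bochner_Integration.integral_cong) (use assms(2) in \<open>auto simp: zext_def\<close>)

lemma Lp_fun_iff_zext:
  assumes "open \<Omega>" "p \<noteq> 0"
  shows "f \<in> Lp_fun p \<Omega> \<longleftrightarrow> Lp p (zext \<Omega> f)"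
proof -
  have "(\<lambda>x. indicator \<Omega> x *\<^sub>R norm (f x) powr p) = (\<lambda>x. norm (zext \<Omega> f x) powr p)"
    using assms(2) by (auto simp: zext_def indicator_def fun_eq_iff)
  then show ?thesis
    using assms(1) by (simp add: Lp_fun_def Lp_def zext_def borel_measurable_if[symmetric] integrable_restrict_space)
qed

lemma locally_integrable_mult_test:
  assumes \<phi>: "\<phi> \<in> test_functions \<Omega>" and g: "\<And>K. compact K \<Longrightarrow> K \<subseteq> \<Omega> \<Longrightarrow> integrable lebesgue (\<lambda>x. indicator K x * g x)"
  shows "integrable lebesgue (\<lambda>x. g x * \<phi> x)"
proof -
  obtain K where K: "compact K" "K \<subseteq> \<Omega>" "\<And>x. x \<notin> K \<Longrightarrow> \<phi> x = 0"
    by (rule test_functions_support[OF \<phi>]) (rule that)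
  obtain B where B: "0 \<le> B" "\<And>x. \<bar>\<phi> x\<bar> \<le> B" by (rule test_functions_bounded[OF \<phi>]) (rule that)
  have \<phi>m: "\<phi> \<in> borel_measurable lebesgue" using test_functions_integrable(3)[OF \<phi>] by simp
  have eq: "(\<lambda>x. g x * \<phi> x) = (\<lambda>x. (indicator K x * g x) * \<phi> x)"
    using K(3) by (auto simp: indicator_def fun_eq_iff)
  show ?thesis unfolding eq
  proof (rule Bochner_Integration.integrable_bound[OF integrable_mult_right[OF g[OF K(1,2)], of B]])
    show "AE x in lebesgue. norm (indicator K x * g x * \<phi> x) \<le> norm (B * (indicator K x * g x))"
    proof (rule AE_I2)
      fix x
      have "\<bar>indicator K x * g x\<bar> * \<bar>\<phi> x\<bar> \<le> \<bar>indicator K x * g x\<bar> * B" by (intro mult_left_mono B) simp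
      then show "norm (indicator K x * g x * \<phi> x) \<le> norm (B * (indicator K x * g x))"
        using B(1) by (simp add: abs_mult mult_ac)
    qed
  qed (intro borel_measurable_times \<phi>m borel_measurable_integrable g K)
qed

lemma locally_integrableD:
  fixes f :: "real^'n \<Rightarrow> 'b::euclidean_space"
  assumes "locally_integrable \<Omega> f" "compact K" "K \<subseteq> \<Omega>"
  shows "integrable lebesgue (\<lambda>x. indicator K x *\<^sub>R f x)"
  using assms by (simp add: locally_integrable_def integrable_restrict_space borel_compact)

lemma locally_integrableI:
  fixes f :: "real^'n \<Rightarrow> 'b::euclidean_space"
  assumes "\<And>K. compact K \<Longrightarrow> K \<subseteq> \<Omega> \<Longrightarrow> integrable lebesgue (\<lambda>x. indicator K x *\<^sub>R f x)"
  shows "locally_integrable \<Omega> f"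
  using assms by (simp add: locally_integrable_def integrable_restrict_space borel_compact)

lemma locally_integrable_nth:
  fixes G :: "real^'n \<Rightarrow> real^'n"
  assumes "locally_integrable \<Omega> G" "compact K" "K \<subseteq> \<Omega>"
  shows "integrable lebesgue (\<lambda>x. indicator K x * G x $ i)"
  using integrable_bounded_linear[OF bounded_linear_vec_nth[of i] locally_integrableD[OF assms]] by simp

lemma locally_integrable_mult_test_nth:
  fixes G :: "real^'n \<Rightarrow> real^'n"
  assumes "\<phi> \<in> test_functions \<Omega>" "locally_integrable \<Omega> G"
  shows "integrable lebesgue (\<lambda>x. G x $ i * \<phi> x)"
  by (rule locally_integrable_mult_test[OF assms(1)]) (rule locally_integrable_nth[OF assms(2)])

lemma locally_integrable_mult_test_real:
  fixes u :: "real^'n \<Rightarrow> real"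
  assumes "\<phi> \<in> test_functions \<Omega>" "locally_integrable \<Omega> u"
  shows "integrable lebesgue (\<lambda>x. u x * \<phi> x)"
  using locally_integrableD[OF assms(2)] by (intro locally_integrable_mult_test[OF assms(1)]) simp

lemma is_weak_gradient_iff:
  fixes u :: "real^'n \<Rightarrow> real"
  assumes "open \<Omega>"
  shows "is_weak_gradient \<Omega> u G \<longleftrightarrow> locally_integrable \<Omega> u \<and> locally_integrable \<Omega> G \<and>
     (\<forall>\<phi>\<in>test_functions \<Omega>. \<forall>i. (\<integral>x. u x * partial_deriv i \<phi> x \<partial>lebesgue) = - (\<integral>x. G x $ i * \<phi> x \<partial>lebesgue))"
proof -
  have 1: "(\<integral>x. u x * partial_deriv i \<phi> x \<partial>lebesgue_on \<Omega>) = (\<integral>x. u x * partial_deriv i \<phi> x \<partial>lebesgue)"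
    if "\<phi> \<in> test_functions \<Omega>" for \<phi> i
    unfolding integral_lebesgue_on_open[OF assms]
    by (rule Bochner_Integration.integral_cong)
       (auto simp: zext_def test_functions_zero[OF test_functions_partial_deriv[OF that]])
  have 2: "(\<integral>x. G x $ i * \<phi> x \<partial>lebesgue_on \<Omega>) = (\<integral>x. G x $ i * \<phi> x \<partial>lebesgue)"
    if "\<phi> \<in> test_functions \<Omega>" for \<phi> i
    unfolding integral_lebesgue_on_open[OF assms]
    by (rule Bochner_Integration.integral_cong) (auto simp: zext_def test_functions_zero[OF that])
  show ?thesis unfolding is_weak_gradient_def by (simp add: 1 2)
qed

text \<open>Both candidates have the same integrals against every test function, so
  \<open>AE_zero_if_test_integrals_zero\<close> applies to each component of the difference.\<close>

lemma is_weak_gradient_unique: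
  assumes \<Omega>: "open \<Omega>" and G: "is_weak_gradient \<Omega> u G" and H: "is_weak_gradient \<Omega> u H"
  shows "AE x in lebesgue. x \<in> \<Omega> \<longrightarrow> G x = H x"
proof -
  note G' = G[unfolded is_weak_gradient_iff[OF \<Omega>]] and H' = H[unfolded is_weak_gradient_iff[OF \<Omega>]]
  have "AE x in lebesgue. x \<in> \<Omega> \<longrightarrow> G x $ i - H x $ i = 0" for i
  proof (rule AE_zero_if_test_integrals_zero[OF \<Omega>])
    show "integrable lebesgue (\<lambda>x. indicator (cbox a b) x * (G x $ i - H x $ i))" if "cbox a b \<subseteq> \<Omega>" for a b
      using locally_integrable_nth[of \<Omega> G "cbox a b" i] locally_integrable_nth[of \<Omega> H "cbox a b" i] G' H' that
      by (simp add: right_diff_distrib)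
    show "(\<integral>x. (G x $ i - H x $ i) * \<phi> x \<partial>lebesgue) = 0" if \<phi>: "\<phi> \<in> test_functions \<Omega>" for \<phi>
    proof -
      have "integrable lebesgue (\<lambda>x. G x $ i * \<phi> x)" "integrable lebesgue (\<lambda>x. H x $ i * \<phi> x)"
        by (rule locally_integrable_mult_test_nth[OF \<phi> conjunct1[OF conjunct2[OF G']]]
            locally_integrable_mult_test_nth[OF \<phi> conjunct1[OF conjunct2[OF H']]])+
      moreover have "(\<integral>x. u x * partial_deriv i \<phi> x \<partial>lebesgue) = - (\<integral>x. G x $ i * \<phi> x \<partial>lebesgue)"
        "(\<integral>x. u x * partial_deriv i \<phi> x \<partial>lebesgue) = - (\<integral>x. H x $ i * \<phi> x \<partial>lebesgue)"
        using bspec[OF conjunct2[OF conjunct2[OF G']] \<phi>] bspec[OF conjunct2[OF conjunct2[OF H']] \<phi>] by blast+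
      ultimately show ?thesis by (simp add: left_diff_distrib)
    qed
  qed
  then have "AE x in lebesgue. \<forall>i. x \<in> \<Omega> \<longrightarrow> G x $ i - H x $ i = 0" by (intro AE_all_countable[THEN iffD2]) simp
  then show ?thesis by eventually_elim (simp add: vec_eq_iff)
qed

lemma is_weak_gradient_diff:
  assumes \<Omega>: "open \<Omega>" and u: "is_weak_gradient \<Omega> u G" and v: "is_weak_gradient \<Omega> v H"
  shows "is_weak_gradient \<Omega> (\<lambda>x. u x - v x) (\<lambda>x. G x - H x)"
proof -
  note u' = u[unfolded is_weak_gradient_iff[OF \<Omega>]] and v' = v[unfolded is_weak_gradient_iff[OF \<Omega>]]
  have "locally_integrable \<Omega> (\<lambda>x. u x - v x)" "locally_integrable \<Omega> (\<lambda>x. G x - H x)"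
    using u' v' by (auto simp: locally_integrable_def)
  moreover have "(\<integral>x. (u x - v x) * partial_deriv i \<phi> x \<partial>lebesgue) = - (\<integral>x. (G x - H x) $ i * \<phi> x \<partial>lebesgue)"
    if \<phi>: "\<phi> \<in> test_functions \<Omega>" for \<phi> i
  proof -
    have "integrable lebesgue (\<lambda>x. G x $ i * \<phi> x)" "integrable lebesgue (\<lambda>x. H x $ i * \<phi> x)"
      by (rule locally_integrable_mult_test_nth[OF \<phi> conjunct1[OF conjunct2[OF u']]]
          locally_integrable_mult_test_nth[OF \<phi> conjunct1[OF conjunct2[OF v']]])+
    moreover have "integrable lebesgue (\<lambda>x. u x * partial_deriv i \<phi> x)" "integrable lebesgue (\<lambda>x. v x * partial_deriv i \<phi> x)"
      by (rule locally_integrable_mult_test_real[OF test_functions_partial_deriv[OF \<phi>] conjunct1[OF u']]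
          locally_integrable_mult_test_real[OF test_functions_partial_deriv[OF \<phi>] conjunct1[OF v']])+
    moreover have "(\<integral>x. u x * partial_deriv i \<phi> x \<partial>lebesgue) = - (\<integral>x. G x $ i * \<phi> x \<partial>lebesgue)"
      "(\<integral>x. v x * partial_deriv i \<phi> x \<partial>lebesgue) = - (\<integral>x. H x $ i * \<phi> x \<partial>lebesgue)"
      using bspec[OF conjunct2[OF conjunct2[OF u']] \<phi>] bspec[OF conjunct2[OF conjunct2[OF v']] \<phi>] by blast+
    ultimately show ?thesis by (simp add: left_diff_distrib)
  qed
  ultimately show ?thesis unfolding is_weak_gradient_iff[OF \<Omega>] by blast
qed

text \<open>The gradient picked by \<open>weak_gradient\<close> differs from \<open>G\<close> on
  \<Omega> by a null set only, and completeness of Lebesgue measure passes measurability on. So the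
  energy may be computed from any explicit gradient.\<close>

lemma dirichlet_energy_eq:
  assumes \<Omega>: "open \<Omega>" and p: "p \<noteq> 0" and G: "is_weak_gradient \<Omega> u G" and m: "zext \<Omega> G \<in> borel_measurable lebesgue"
  shows "dirichlet_energy p \<Omega> u = pint p (zext \<Omega> G)"
proof -
  have "is_weak_gradient \<Omega> u (weak_gradient \<Omega> u)"
    unfolding weak_gradient_def by (rule someI[of "is_weak_gradient \<Omega> u", OF G])
  then have "AE x in lebesgue. x \<in> \<Omega> \<longrightarrow> G x = weak_gradient \<Omega> u x"
    by (rule is_weak_gradient_unique[OF \<Omega> G])
  then have ae: "AE x in lebesgue. zext \<Omega> G x = zext \<Omega> (weak_gradient \<Omega> u) x"
    by eventually_elim (simp add: zext_def)
  have m': "zext \<Omega> (weak_gradient \<Omega> u) \<in> borel_measurable lebesgue"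
    by (rule borel_measurable_AE[OF m ae])
  have "pint p (zext \<Omega> (weak_gradient \<Omega> u)) = pint p (zext \<Omega> G)"
    unfolding pint_def
  proof (rule integral_cong_AE)
    show "AE x in lebesgue. norm (zext \<Omega> (weak_gradient \<Omega> u) x) powr p = norm (zext \<Omega> G x) powr p"
      using ae by eventually_elim simp
  qed (use m m' in measurable)
  then show ?thesis unfolding dirichlet_energy_def pint_zext[OF \<Omega> p] .
qed

lemma sobolev_norm_eq:
  assumes "open \<Omega>" "p \<noteq> 0" "is_weak_gradient \<Omega> u G" "zext \<Omega> G \<in> borel_measurable lebesgue"
  shows "sobolev_norm p \<Omega> u = (pint p (zext \<Omega> u) + pint p (zext \<Omega> G)) powr (1 / p)"
  using pint_zext[OF assms(1,2), of u] dirichlet_energy_eq[OF assms] by (simp add: sobolev_norm_def)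

text \<open>Removes p-th roots: membership in a Sobolev ball of radius \<open>r\<close> becomes the
  bound \<open>r powr p\<close> on a sum of two values of \<open>pint\<close>.\<close>

lemma powr_inverse_less_iff:
  fixes a r p :: real
  assumes "0 < p" "0 \<le> a" "0 < r"
  shows "a powr (1 / p) < r \<longleftrightarrow> a < r powr p"
proof
  assume "a powr (1 / p) < r"
  then have "(a powr (1 / p)) powr p < r powr p" using assms by (intro powr_less_mono2) auto
  then show "a < r powr p" using assms by (simp add: powr_powr)
next
  assume "a < r powr p"
  then have "a powr (1 / p) < (r powr p) powr (1 / p)" using assms by (intro powr_less_mono2) auto
  then show "a powr (1 / p) < r" using assms by (simp add: powr_powr)
qed

lemma Lp_locally_integrable: "1 < p \<Longrightarrow> Lp p u \<Longrightarrow> locally_integrable \<Omega> u"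
  by (intro locally_integrableI Lp_integrable_compact(1)[where d=1 and p=p]) auto

lemma Lp_nth:
  fixes G :: "real^'n \<Rightarrow> real^'m"
  assumes "0 < p" "Lp p G"
  shows "Lp p (\<lambda>x. G x $ i)" "pint p (\<lambda>x. G x $ i) \<le> pint p G"
proof -
  have m: "(\<lambda>x. G x $ i) \<in> borel_measurable lebesgue"
    by (rule measurable_compose[OF LpD(1)[OF assms(2)]])
       (intro borel_measurable_continuous_onI continuous_intros)
  have le: "norm (G x $ i) powr p \<le> norm (G x) powr p" for x
    using component_le_norm_cart[of "G x" i] assms(1) by (intro powr_mono2) auto
  have int: "integrable lebesgue (\<lambda>x. norm (G x $ i) powr p)"
    by (rule Bochner_Integration.integrable_bound[OF LpD(2)[OF assms(2)]]) (use m le in \<open>auto intro!: AE_I2\<close>)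
  show "Lp p (\<lambda>x. G x $ i)" using m int by (simp add: Lp_def)
  show "pint p (\<lambda>x. G x $ i) \<le> pint p G" unfolding pint_def by (intro integral_mono int LpD assms le)
qed

lemma Lp_integral_mult_test:
  assumes p: "1 < p" and u: "Lp p u" and \<psi>: "\<psi> \<in> test_functions \<Omega>" and K: "compact K" "\<And>x. x \<notin> K \<Longrightarrow> \<psi> x = 0"
    and B: "0 \<le> B" "\<And>x. \<bar>\<psi> x\<bar> \<le> B" and d: "0 < d"
  shows "\<bar>\<integral>x. u x * \<psi> x \<partial>lebesgue\<bar> \<le> B * (d * measure lebesgue K + d powr (1 - p) * pint p u)"
proof -
  have "\<bar>\<integral>x. u x * \<psi> x \<partial>lebesgue\<bar> \<le> (\<integral>x. B * (indicator K x * norm (u x)) \<partial>lebesgue)"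
  proof (rule order_trans[OF integral_abs_bound[unfolded real_norm_def]], rule integral_mono)
    have "integrable lebesgue (\<lambda>x. u x * \<psi> x)"
      using Lp_integrable_compact(1)[OF p u _ d] by (intro locally_integrable_mult_test[OF \<psi>]) auto
    then show "integrable lebesgue (\<lambda>x. \<bar>u x * \<psi> x\<bar>)" by simp
    show "integrable lebesgue (\<lambda>x. B * (indicator K x * norm (u x)))"
      using integrable_norm[OF Lp_integrable_compact(1)[OF p u K(1) d]] by (intro integrable_mult_right) (simp add: abs_mult)
    show "\<bar>u x * \<psi> x\<bar> \<le> B * (indicator K x * norm (u x))" for x
      using mult_right_mono[OF B(2)[of x], of "\<bar>u x\<bar>"] K(2)[of x] by (auto simp: indicator_def abs_mult mult.commute)
  qed
  also have "\<dots> = B * (\<integral>x. indicator K x * norm (u x) \<partial>lebesgue)" by simp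
  also have "\<dots> \<le> B * (d * measure lebesgue K + d powr (1 - p) * pint p u)"
    by (intro mult_left_mono Lp_integrable_compact(2)[OF p u K(1) d] B)
  finally show ?thesis .
qed

text \<open>Test functions satisfy the defining identity by integration by parts. Against a fixed
  test function both integrals are controlled by \<open>pint\<close> through
  \<open>Lp_integral_mult_test\<close>, so the identity passes to the closure.\<close>

lemma W0_is_weak_gradient:
  fixes u :: "real^'n \<Rightarrow> real"
  assumes p: "1 < p" and \<Omega>: "open \<Omega>" and u: "(u, G) \<in> W0 p \<Omega>"
  shows "is_weak_gradient \<Omega> u G"
  unfolding is_weak_gradient_iff[OF \<Omega>]
proof (intro conjI ballI allI)
  have p0: "0 < p" using p by simp
  show "locally_integrable \<Omega> u" "locally_integrable \<Omega> G"
    using Lp_locally_integrable[OF p] W0D[OF u] by blast+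
  fix \<psi> i assume \<psi>: "\<psi> \<in> test_functions \<Omega>"
  let ?d\<psi> = "partial_deriv i \<psi>"
  have d\<psi>: "?d\<psi> \<in> test_functions \<Omega>" by (rule test_functions_partial_deriv[OF \<psi>])
  obtain K1 where K1: "compact K1" "K1 \<subseteq> \<Omega>" "\<And>x. x \<notin> K1 \<Longrightarrow> \<psi> x = 0"
    by (rule test_functions_support[OF \<psi>]) (rule that)
  obtain K2 where K2: "compact K2" "K2 \<subseteq> \<Omega>" "\<And>x. x \<notin> K2 \<Longrightarrow> ?d\<psi> x = 0"
    by (rule test_functions_support[OF d\<psi>]) (rule that)
  obtain B1 where B1: "0 \<le> B1" "\<And>x. \<bar>\<psi> x\<bar> \<le> B1" by (rule test_functions_bounded[OF \<psi>]) (rule that)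
  obtain B2 where B2: "0 \<le> B2" "\<And>x. \<bar>?d\<psi> x\<bar> \<le> B2" by (rule test_functions_bounded[OF d\<psi>]) (rule that)
  let ?I = "(\<integral>x. u x * ?d\<psi> x \<partial>lebesgue) + (\<integral>x. G x $ i * \<psi> x \<partial>lebesgue)"
  let ?m1 = "measure lebesgue K1" and ?m2 = "measure lebesgue K2"
  have bound: "\<bar>?I\<bar> \<le> B2 * (d * ?m2 + d powr (1 - p) * \<epsilon>) + B1 * (d * ?m1 + d powr (1 - p) * \<epsilon>)"
    if d: "0 < d" and \<epsilon>: "0 < \<epsilon>" for d \<epsilon>
  proof -
    obtain \<phi> where \<phi>: "\<phi> \<in> test_functions \<Omega>" "pint p (\<lambda>x. u x - \<phi> x) + pint p (\<lambda>x. G x - grad \<phi> x) < \<epsilon>"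
      by (rule W0_approx[OF u \<epsilon>])
    have L: "Lp p (\<lambda>x. u x - \<phi> x)" "Lp p (\<lambda>x. G x - grad \<phi> x)"
      by (intro Lp_diff(1) p0 W0D[OF u] Lp_test[OF p0 \<phi>(1)])+
    have e: "pint p (\<lambda>x. u x - \<phi> x) \<le> \<epsilon>" "pint p (\<lambda>x. (G x - grad \<phi> x) $ i) \<le> \<epsilon>"
      using \<phi>(2) pint_nonneg[of p "\<lambda>x. u x - \<phi> x"] pint_nonneg[of p "\<lambda>x. G x - grad \<phi> x"] Lp_nth(2)[OF p0 L(2), of i]
      by linarith+
    have int: "integrable lebesgue (\<lambda>x. w x * \<eta> x)" if "Lp p w" "\<eta> \<in> test_functions \<Omega>" for w \<eta>
      using Lp_integrable_compact(1)[OF p that(1) _ d] by (intro locally_integrable_mult_test[OF that(2)]) auto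
    have "(\<integral>x. \<phi> x * ?d\<psi> x \<partial>lebesgue) + (\<integral>x. partial_deriv i \<phi> x * \<psi> x \<partial>lebesgue) = 0"
      using integration_by_parts[OF \<phi>(1) \<psi>, of i] by simp
    then have "?I = (\<integral>x. (u x - \<phi> x) * ?d\<psi> x \<partial>lebesgue) + (\<integral>x. (G x - grad \<phi> x) $ i * \<psi> x \<partial>lebesgue)"
      using int[OF W0D(1)[OF u] d\<psi>] int[OF Lp_test(1)[OF p0 \<phi>(1)] d\<psi>]
        int[OF Lp_nth(1)[OF p0 W0D(2)[OF u]] \<psi>] int[OF Lp_nth(1)[OF p0 Lp_test(2)[OF p0 \<phi>(1)]] \<psi>]
      by (simp add: left_diff_distrib grad_nth)
    then have "\<bar>?I\<bar> \<le> \<bar>\<integral>x. (u x - \<phi> x) * ?d\<psi> x \<partial>lebesgue\<bar> + \<bar>\<integral>x. (G x - grad \<phi> x) $ i * \<psi> x \<partial>lebesgue\<bar>"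
      by linarith
    also have "\<dots> \<le> B2 * (d * ?m2 + d powr (1 - p) * pint p (\<lambda>x. u x - \<phi> x))
        + B1 * (d * ?m1 + d powr (1 - p) * pint p (\<lambda>x. (G x - grad \<phi> x) $ i))"
      by (intro add_mono Lp_integral_mult_test[OF p L(1) d\<psi> K2(1,3) B2 d]
          Lp_integral_mult_test[OF p Lp_nth(1)[OF p0 L(2)] \<psi> K1(1,3) B1 d])
    also have "\<dots> \<le> B2 * (d * ?m2 + d powr (1 - p) * \<epsilon>) + B1 * (d * ?m1 + d powr (1 - p) * \<epsilon>)"
      by (intro add_mono mult_left_mono add_left_mono e B1 B2) auto
    finally show ?thesis .
  qed
  \<comment> \<open>The approximation error \<epsilon> tends to 0 with \<open>d\<close> fixed, and
    \<open>d\<close> afterwards; the factor \<open>d powr (1 - p)\<close> forbids the opposite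
    order.\<close>
  have "\<bar>?I\<bar> \<le> B2 * (d * ?m2) + B1 * (d * ?m1)" if d: "0 < d" for d
  proof (rule tendsto_lowerbound)
    have "((\<lambda>\<epsilon>. B2 * (d * ?m2 + d powr (1 - p) * \<epsilon>) + B1 * (d * ?m1 + d powr (1 - p) * \<epsilon>))
       \<longlongrightarrow> B2 * (d * ?m2 + d powr (1 - p) * 0) + B1 * (d * ?m1 + d powr (1 - p) * 0)) (at_right 0)"
      by (intro tendsto_intros)
    then show "((\<lambda>\<epsilon>. B2 * (d * ?m2 + d powr (1 - p) * \<epsilon>) + B1 * (d * ?m1 + d powr (1 - p) * \<epsilon>))
       \<longlongrightarrow> B2 * (d * ?m2) + B1 * (d * ?m1)) (at_right 0)" by simp
    show "\<forall>\<^sub>F \<epsilon> in at_right 0. \<bar>?I\<bar> \<le> B2 * (d * ?m2 + d powr (1 - p) * \<epsilon>) + B1 * (d * ?m1 + d powr (1 - p) * \<epsilon>)"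
      using bound[OF d] by (auto simp: eventually_at_right_field intro: exI[of _ 1])
  qed simp
  then have "\<forall>\<^sub>F d in at_right 0. \<bar>?I\<bar> \<le> B2 * (d * ?m2) + B1 * (d * ?m1)"
    by (auto simp: eventually_at_right_field intro: exI[of _ 1])
  moreover have "((\<lambda>d. B2 * (d * ?m2) + B1 * (d * ?m1)) \<longlongrightarrow> B2 * (0 * ?m2) + B1 * (0 * ?m1)) (at_right 0)"
    by (intro tendsto_intros)
  ultimately have "\<bar>?I\<bar> \<le> B2 * (0 * ?m2) + B1 * (0 * ?m1)"
    by (intro tendsto_lowerbound) auto
  then show "(\<integral>x. u x * ?d\<psi> x \<partial>lebesgue) = - (\<integral>x. G x $ i * \<psi> x \<partial>lebesgue)" by simp
qed

lemma zext_W0: "(u, G) \<in> W0 p \<Omega> \<Longrightarrow> zext \<Omega> u = u" "(u, G) \<in> W0 p \<Omega> \<Longrightarrow> zext \<Omega> G = G"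
  by (auto simp: zext_def fun_eq_iff W0D)

lemma zext_diff: "zext \<Omega> (\<lambda>x. f x - g x) = (\<lambda>x. zext \<Omega> f x - zext \<Omega> g x)"
  by (auto simp: zext_def fun_eq_iff)

lemma W0_dirichlet_energy:
  assumes p: "1 < p" and \<Omega>: "open \<Omega>" and u: "(u, G) \<in> W0 p \<Omega>"
  shows "dirichlet_energy p \<Omega> u = pint p G"
proof -
  have "dirichlet_energy p \<Omega> u = pint p (zext \<Omega> G)"
    by (rule dirichlet_energy_eq[OF \<Omega> _ W0_is_weak_gradient[OF p \<Omega> u]])
       (use p zext_W0(2)[OF u] LpD(1)[OF W0D(2)[OF u]] in auto)
  then show ?thesis using zext_W0(2)[OF u] by simp
qed

lemma sobolev_norm_diff:
  assumes p: "1 < p" and \<Omega>: "open \<Omega>" and u: "is_weak_gradient \<Omega> u G" "Lp p (zext \<Omega> G)"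
    and v: "is_weak_gradient \<Omega> v H" "Lp p (zext \<Omega> H)"
  shows "sobolev_norm p \<Omega> (\<lambda>x. u x - v x)
    = (pint p (\<lambda>x. zext \<Omega> u x - zext \<Omega> v x) + pint p (\<lambda>x. zext \<Omega> G x - zext \<Omega> H x)) powr (1 / p)"
  using sobolev_norm_eq[OF \<Omega> _ is_weak_gradient_diff[OF \<Omega> u(1) v(1)], of p] p LpD(1)[OF Lp_diff(1)[OF _ u(2) v(2)]]
  by (simp add: zext_diff)

lemma sobolev_norm_diff_less_iff:
  assumes p: "1 < p" and \<Omega>: "open \<Omega>" and u: "is_weak_gradient \<Omega> u G" "Lp p (zext \<Omega> G)"
    and v: "is_weak_gradient \<Omega> v H" "Lp p (zext \<Omega> H)" and r: "0 < r"
  shows "sobolev_norm p \<Omega> (\<lambda>x. u x - v x) < r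
    \<longleftrightarrow> pint p (\<lambda>x. zext \<Omega> u x - zext \<Omega> v x) + pint p (\<lambda>x. zext \<Omega> G x - zext \<Omega> H x) < r powr p"
  unfolding sobolev_norm_diff[OF assms(1-6)]
  by (rule powr_inverse_less_iff[OF _ add_nonneg_nonneg[OF pint_nonneg pint_nonneg] r]) (use p in simp)

lemma W0_imp_sobolev0:
  assumes p: "1 < p" and \<Omega>: "open \<Omega>" and u: "(u, G) \<in> W0 p \<Omega>"
  shows "u \<in> sobolev0 p \<Omega>"
proof -
  have p0: "0 < p" "p \<noteq> 0" using p by auto
  have w: "is_weak_gradient \<Omega> u G" by (rule W0_is_weak_gradient[OF p \<Omega> u])
  have "u \<in> sobolev p \<Omega>"
    unfolding sobolev_def using w W0D(1,2)[OF u] zext_W0[OF u] by (auto simp: Lp_fun_iff_zext[OF \<Omega> p0(2)])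
  moreover have "\<exists>\<phi>\<in>test_functions \<Omega>. sobolev_norm p \<Omega> (\<lambda>x. u x - \<phi> x) < \<epsilon>" if \<epsilon>: "0 < \<epsilon>" for \<epsilon>
  proof -
    have "0 < \<epsilon> powr p" using \<epsilon> by simp
    then obtain \<phi> where \<phi>: "\<phi> \<in> test_functions \<Omega>"
      "pint p (\<lambda>x. u x - \<phi> x) + pint p (\<lambda>x. G x - grad \<phi> x) < \<epsilon> powr p"
      by (rule W0_approx[OF u])
    note W = W0_test[OF p0(1) \<phi>(1)]
    have "sobolev_norm p \<Omega> (\<lambda>x. u x - \<phi> x) < \<epsilon>"
      using sobolev_norm_diff_less_iff[OF p \<Omega> w _ W0_is_weak_gradient[OF p \<Omega> W] _ \<epsilon>] \<phi>(2) W0D(2)[OF u] W0D(2)[OF W]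
      by (simp add: zext_W0[OF u] zext_W0[OF W])
    then show ?thesis using \<phi>(1) by (rule bexI[of _ \<phi>])
  qed
  ultimately show ?thesis by (simp add: sobolev0_def)
qed

text \<open>The values of a Sobolev representative outside \<Omega> are arbitrary, so it is the pair
  of extensions by zero that belongs to \<open>W0\<close>.\<close>

lemma sobolev0_imp_W0:
  assumes p: "1 < p" and \<Omega>: "open \<Omega>" and u: "u \<in> sobolev0 p \<Omega>"
  obtains G where "(zext \<Omega> u, zext \<Omega> G) \<in> W0 p \<Omega>" "is_weak_gradient \<Omega> u G"
proof -
  have p0: "0 < p" "p \<noteq> 0" using p by auto
  obtain G where G: "G \<in> Lp_fun p \<Omega>" "is_weak_gradient \<Omega> u G" and u': "u \<in> Lp_fun p \<Omega>"
    using u by (auto simp: sobolev0_def sobolev_def)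
  have L: "Lp p (zext \<Omega> u)" "Lp p (zext \<Omega> G)" using G u' Lp_fun_iff_zext[OF \<Omega> p0(2)] by blast+
  have "(zext \<Omega> u, zext \<Omega> G) \<in> W0 p \<Omega>"
  proof (rule W0I[OF L])
    fix \<epsilon> :: real assume "0 < \<epsilon>"
    then have \<epsilon>: "0 < \<epsilon> powr (1 / p)" by simp
    obtain \<phi> where \<phi>: "\<phi> \<in> test_functions \<Omega>" "sobolev_norm p \<Omega> (\<lambda>x. u x - \<phi> x) < \<epsilon> powr (1 / p)"
      using u \<epsilon> unfolding sobolev0_def by blast
    note W = W0_test[OF p0(1) \<phi>(1)]
    have "pint p (\<lambda>x. zext \<Omega> u x - \<phi> x) + pint p (\<lambda>x. zext \<Omega> G x - grad \<phi> x) < (\<epsilon> powr (1 / p)) powr p"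
      using sobolev_norm_diff_less_iff[OF p \<Omega> G(2) L(2) W0_is_weak_gradient[OF p \<Omega> W] _ \<epsilon>] \<phi>(2) W0D(2)[OF W]
      by (simp add: zext_W0[OF W])
    then show "\<exists>\<phi>\<in>test_functions \<Omega>. pint p (\<lambda>x. zext \<Omega> u x - \<phi> x) + pint p (\<lambda>x. zext \<Omega> G x - grad \<phi> x) < \<epsilon>"
      using \<phi>(1) \<open>0 < \<epsilon>\<close> p0 by (intro bexI[of _ \<phi>]) (simp_all add: powr_powr)
  qed (auto simp: zext_def)
  then show ?thesis using that G(2) by blast
qed

section \<open>Homogeneous odd maps into the closure of the test functions\<close>

text \<open>Unlike in \<open>at v within E\<close>, the point \<open>v\<close> is not removed, so
  limits compose with maps that take the value \<open>g v\<close> at other points as well.\<close>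

definition nhds_in :: "'a::topological_space set \<Rightarrow> 'a \<Rightarrow> 'a filter" where
  "nhds_in E v = inf (nhds v) (principal E)"

lemma eventually_nhds_in:
  "eventually P (nhds_in E v) \<longleftrightarrow> (\<exists>U. open U \<and> v \<in> U \<and> (\<forall>w\<in>U \<inter> E. P w))"
  unfolding nhds_in_def eventually_inf_principal eventually_nhds by blast

lemma eventually_nhds_in_mem: "eventually (\<lambda>w. w \<in> E) (nhds_in E v)"
  unfolding eventually_nhds_in by (intro exI[of _ UNIV]) auto

lemma nhds_in_mono: "E \<subseteq> E' \<Longrightarrow> nhds_in E v \<le> nhds_in E' v"
  unfolding nhds_in_def by (intro inf_mono) auto

lemma tendsto_nhds_in:
  assumes "continuous_on E g" "v \<in> E"
  shows "(g \<longlongrightarrow> g v) (nhds_in E v)"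
proof (rule topological_tendstoI)
  fix S assume S: "open S" "g v \<in> S"
  obtain A where A: "open A" "A \<inter> E = g -` S \<inter> E"
    using assms(1) S(1) unfolding continuous_on_open_invariant by blast
  then show "eventually (\<lambda>x. g x \<in> S) (nhds_in E v)"
    unfolding eventually_nhds_in using S assms(2) by (intro exI[of _ A]) auto
qed

lemma filterlim_nhds_in:
  assumes "continuous_on E g" "v \<in> E" "g ` E \<subseteq> E'"
  shows "filterlim g (nhds_in E' (g v)) (nhds_in E v)"
proof -
  have "eventually (\<lambda>w. g w \<in> E') (nhds_in E v)"
    using eventually_nhds_in_mem[of E v] by eventually_elim (use assms(3) in auto)
  then show ?thesis
    unfolding nhds_in_def[of E'] by (intro filterlim_inf[THEN iffD2] conjI tendsto_nhds_in assms)
      (simp add: filterlim_principal)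
qed

lemma continuous_onI_nhds_in:
  assumes "\<And>v. v \<in> E \<Longrightarrow> (g \<longlongrightarrow> g v) (nhds_in E v)"
  shows "continuous_on E g"
  unfolding continuous_on_topological
proof (intro ballI allI impI)
  fix v B assume v: "v \<in> E" and B: "open B" "g v \<in> B"
  from topological_tendstoD[OF assms[OF v] B]
  show "\<exists>A. open A \<and> v \<in> A \<and> (\<forall>y\<in>E. y \<in> A \<longrightarrow> g y \<in> B)"
    unfolding eventually_nhds_in by blast
qed

text \<open>Euclidean space as sequences that vanish from index \<open>k\<close> on, the form in
  which \<open>nsphere\<close> is given. Spaces of different dimensions are then nested, and
  lowering the dimension is mere restriction.\<close>

definition espace :: "nat \<Rightarrow> (nat \<Rightarrow> real) set" where
  "espace k = {v. \<forall>i\<ge>k. v i = 0}"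

definition sqn :: "nat \<Rightarrow> (nat \<Rightarrow> real) \<Rightarrow> real" where
  "sqn k v = (\<Sum>i<k. (v i)\<^sup>2)"

lemma sqn_nonneg: "0 \<le> sqn k v" by (simp add: sqn_def sum_nonneg)

lemma espace_mono: "j \<le> k \<Longrightarrow> espace j \<subseteq> espace k" by (auto simp: espace_def)

lemma sqn_espace: "j \<le> k \<Longrightarrow> v \<in> espace j \<Longrightarrow> sqn k v = sqn j v"
  unfolding sqn_def espace_def by (intro sum.mono_neutral_right) auto

lemma espace_uminus: "v \<in> espace k \<Longrightarrow> (\<lambda>i. - v i) \<in> espace k" by (simp add: espace_def)

lemma continuous_on_coordinate: "continuous_on S (\<lambda>v :: nat \<Rightarrow> real. v i)"
  by (rule continuous_on_subset[OF continuous_on_product_coordinates]) simp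

lemma continuous_on_sqn: "continuous_on S (sqn k)"
  unfolding sqn_def[abs_def] by (intro continuous_intros continuous_on_coordinate)

definition Wdist :: "real \<Rightarrow> ('v \<Rightarrow> real^'n \<Rightarrow> real) \<Rightarrow> ('v \<Rightarrow> real^'n \<Rightarrow> real^'n) \<Rightarrow> 'v \<Rightarrow> 'v \<Rightarrow> real" where
  "Wdist p H D w v = pint p (\<lambda>x. H w x - H v x) + pint p (\<lambda>x. D w x - D v x)"

lemma Wdist_nonneg: "0 \<le> Wdist p H D w v" by (simp add: Wdist_def pint_nonneg)

text \<open>The homogeneous extension \<open>v \<mapsto> |v| powr (2 / p) * h (v / |v|)\<close> of an odd map of the sphere; the
  exponent is chosen so that the \<open>p\<close>-th power of the norm is additive under joins.\<close>

definition adm_map :: "real \<Rightarrow> (real^'n) set \<Rightarrow> nat \<Rightarrow> real \<Rightarrow>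
    ((nat \<Rightarrow> real) \<Rightarrow> real^'n \<Rightarrow> real) \<Rightarrow> ((nat \<Rightarrow> real) \<Rightarrow> real^'n \<Rightarrow> real^'n) \<Rightarrow> bool" where
  "adm_map p \<Omega> k \<mu> H D \<longleftrightarrow>
     (\<forall>v\<in>espace k. (H v, D v) \<in> W0 p \<Omega> \<and> pint p (H v) = sqn k v \<and> pint p (D v) \<le> \<mu> * sqn k v \<and>
        pint p (\<lambda>x. H (\<lambda>i. - v i) x + H v x) = 0 \<and>
        ((\<lambda>w. Wdist p H D w v) \<longlongrightarrow> 0) (nhds_in (espace k) v))"

text \<open>The homogeneous form of the existence of an odd map on the sphere of dimension
  \<open>k - 1\<close> with energy at most \<mu>. The degenerate case \<open>k = 0\<close> always
  holds, which gives inductions over pieces, and the greatest admissible \<open>k\<close>, a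
  starting point.\<close>

definition adm :: "real \<Rightarrow> (real^'n) set \<Rightarrow> nat \<Rightarrow> real \<Rightarrow> bool" where
  "adm p \<Omega> k \<mu> \<longleftrightarrow> (\<exists>H D. adm_map p \<Omega> k \<mu> H D)"

lemma adm_mapD:
  assumes "adm_map p \<Omega> k \<mu> H D" "v \<in> espace k"
  shows "(H v, D v) \<in> W0 p \<Omega>" "pint p (H v) = sqn k v" "pint p (D v) \<le> \<mu> * sqn k v"
    "pint p (\<lambda>x. H (\<lambda>i. - v i) x + H v x) = 0" "((\<lambda>w. Wdist p H D w v) \<longlongrightarrow> 0) (nhds_in (espace k) v)"
  using assms by (auto simp: adm_map_def)

lemma adm_mapI:
  assumes "\<And>v. v \<in> espace k \<Longrightarrow> (H v, D v) \<in> W0 p \<Omega>" "\<And>v. v \<in> espace k \<Longrightarrow> pint p (H v) = sqn k v"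
    "\<And>v. v \<in> espace k \<Longrightarrow> pint p (D v) \<le> \<mu> * sqn k v"
    "\<And>v. v \<in> espace k \<Longrightarrow> pint p (\<lambda>x. H (\<lambda>i. - v i) x + H v x) = 0"
    "\<And>v. v \<in> espace k \<Longrightarrow> ((\<lambda>w. Wdist p H D w v) \<longlongrightarrow> 0) (nhds_in (espace k) v)"
  shows "adm_map p \<Omega> k \<mu> H D"
  unfolding adm_map_def using assms by simp

lemma adm_mono:
  assumes "adm p \<Omega> k \<mu>" "\<Omega> \<subseteq> \<Omega>'" "\<mu> \<le> \<mu>'" "j \<le> k"
  shows "adm p \<Omega>' j \<mu>'"
proof -
  obtain H D where HD: "adm_map p \<Omega> k \<mu> H D" using assms(1) by (auto simp: adm_def)
  have "adm_map p \<Omega>' j \<mu>' H D"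
  proof (rule adm_mapI)
    fix v assume v: "v \<in> espace j"
    then have v': "v \<in> espace k" using espace_mono[OF assms(4)] by blast
    note d = adm_mapD[OF HD v']
    show "(H v, D v) \<in> W0 p \<Omega>'" by (rule W0_mono[OF assms(2) d(1)])
    show "pint p (H v) = sqn j v" using d(2) sqn_espace[OF assms(4) v] by simp
    show "pint p (D v) \<le> \<mu>' * sqn j v"
      using d(3) sqn_espace[OF assms(4) v] mult_right_mono[OF assms(3) sqn_nonneg[of j v]] by simp
    show "pint p (\<lambda>x. H (\<lambda>i. - v i) x + H v x) = 0" by (rule d(4))
    show "((\<lambda>w. Wdist p H D w v) \<longlongrightarrow> 0) (nhds_in (espace j) v)"
      by (rule tendsto_mono[OF nhds_in_mono[OF espace_mono[OF assms(4)]] d(5)])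
  qed
  then show ?thesis by (auto simp: adm_def)
qed

lemma pint_disjoint_add:
  assumes "Lp p f" "Lp p g" "\<And>x. f x = 0 \<or> g x = 0"
  shows "pint p (\<lambda>x. f x + g x) = pint p f + pint p g"
proof -
  have "(\<lambda>x. norm (f x + g x) powr p) = (\<lambda>x. norm (f x) powr p + norm (g x) powr p)"
  proof
    fix x show "norm (f x + g x) powr p = norm (f x) powr p + norm (g x) powr p"
      using assms(3)[of x] by auto
  qed
  then show ?thesis using LpD(2)[OF assms(1)] LpD(2)[OF assms(2)] by (simp add: pint_def)
qed

text \<open>The vector is split into its first \<open>k1\<close> and its next \<open>k2\<close>
  coordinates, and the two maps are added. As the supports are disjoint, norms and energies add in
  p-th powers exactly as \<open>sqn\<close> does. On vector spaces nothing special happens where one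
  of the two parts vanishes.\<close>

lemma adm_join:
  assumes p: "1 < p" and 1: "adm p \<Omega>1 k1 \<mu>" and 2: "adm p \<Omega>2 k2 \<mu>"
    and sub: "\<Omega>1 \<subseteq> \<Omega>" "\<Omega>2 \<subseteq> \<Omega>" "\<Omega>1 \<inter> \<Omega>2 = {}"
  shows "adm p \<Omega> (k1 + k2) \<mu>"
proof -
  have p0: "0 < p" using p by simp
  obtain H1 D1 where HD1: "adm_map p \<Omega>1 k1 \<mu> H1 D1" using 1 by (auto simp: adm_def)
  obtain H2 D2 where HD2: "adm_map p \<Omega>2 k2 \<mu> H2 D2" using 2 by (auto simp: adm_def)
  define l where "l v = (\<lambda>i. if i < k1 then v i else 0)" for v :: "nat \<Rightarrow> real"
  define r where "r v = (\<lambda>i. if i < k2 then v (k1 + i) else 0)" for v :: "nat \<Rightarrow> real"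
  let ?E = "espace (k1 + k2)"
  have lE: "l v \<in> espace k1" and rE: "r v \<in> espace k2" for v by (auto simp: l_def r_def espace_def)
  have cl: "continuous_on S l" for S
  proof (rule continuous_on_coordinatewise_then_product)
    show "continuous_on S (\<lambda>v. l v i)" for i
      unfolding l_def by (cases "i < k1") (auto intro: continuous_on_coordinate)
  qed
  have cr: "continuous_on S r" for S
  proof (rule continuous_on_coordinatewise_then_product)
    show "continuous_on S (\<lambda>v. r v i)" for i
      unfolding r_def by (cases "i < k2") (auto intro: continuous_on_coordinate)
  qed
  have sq: "sqn (k1 + k2) v = sqn k1 (l v) + sqn k2 (r v)" for v
  proof -
    have "(\<Sum>i<k1 + k2. (v i)\<^sup>2) = (\<Sum>i=0..<k1. (v i)\<^sup>2) + (\<Sum>i=k1..<k1 + k2. (v i)\<^sup>2)"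
      by (simp add: lessThan_atLeast0 sum.atLeastLessThan_concat)
    also have "(\<Sum>i=k1..<k1 + k2. (v i)\<^sup>2) = (\<Sum>i=0..<k2. (v (k1 + i))\<^sup>2)"
      using sum.shift_bounds_nat_ivl[of "\<lambda>i. (v i)\<^sup>2" 0 k1 k2] by (simp add: add.commute)
    finally show ?thesis by (simp add: sqn_def l_def r_def lessThan_atLeast0)
  qed
  let ?H = "\<lambda>v x. H1 (l v) x + H2 (r v) x" and ?D = "\<lambda>v x. D1 (l v) x + D2 (r v) x"
  have "adm_map p \<Omega> (k1 + k2) \<mu> ?H ?D"
  proof (rule adm_mapI)
    fix v assume v: "v \<in> ?E"
    note d1 = adm_mapD[OF HD1 lE[of v]] and d2 = adm_mapD[OF HD2 rE[of v]]
    note w1 = W0D[OF d1(1)] and w2 = W0D[OF d2(1)]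
    show "(?H v, ?D v) \<in> W0 p \<Omega>" by (intro W0_add p0 W0_mono[OF sub(1) d1(1)] W0_mono[OF sub(2) d2(1)])
    have z: "H1 (l v) x = 0 \<or> H2 (r v) x = 0" "D1 (l v) x = 0 \<or> D2 (r v) x = 0" for x
      using sub(3) w1(3,4)[of x] w2(3,4)[of x] by blast+
    show "pint p (?H v) = sqn (k1 + k2) v"
      using pint_disjoint_add[OF w1(1) w2(1) z(1)] d1(2) d2(2) sq by simp
    show "pint p (?D v) \<le> \<mu> * sqn (k1 + k2) v"
      using pint_disjoint_add[OF w1(2) w2(2) z(2)] d1(3) d2(3) sq by (simp add: distrib_left)
    have neg: "l (\<lambda>i. - v i) = (\<lambda>i. - l v i)" "r (\<lambda>i. - v i) = (\<lambda>i. - r v i)" by (auto simp: l_def r_def)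
    note n1 = W0D[OF adm_mapD(1)[OF HD1 espace_uminus[OF lE[of v]]]]
      and n2 = W0D[OF adm_mapD(1)[OF HD2 espace_uminus[OF rE[of v]]]]
    have "pint p (\<lambda>x. (H1 (\<lambda>i. - l v i) x + H1 (l v) x) + (H2 (\<lambda>i. - r v i) x + H2 (r v) x))
      \<le> 2 powr p * (pint p (\<lambda>x. H1 (\<lambda>i. - l v i) x + H1 (l v) x) + pint p (\<lambda>x. H2 (\<lambda>i. - r v i) x + H2 (r v) x))"
      by (intro Lp_add(2) Lp_add(1) p0 w1(1) w2(1) n1(1) n2(1))
    then have "pint p (\<lambda>x. ?H (\<lambda>i. - v i) x + ?H v x) \<le> 0"
      unfolding neg d1(4) d2(4) by (simp add: algebra_simps)
    then show "pint p (\<lambda>x. ?H (\<lambda>i. - v i) x + ?H v x) = 0" using pint_nonneg by (rule antisym)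
    have t1: "((\<lambda>w. Wdist p H1 D1 (l w) (l v)) \<longlongrightarrow> 0) (nhds_in ?E v)"
      by (rule filterlim_compose[OF d1(5) filterlim_nhds_in[OF cl v]]) (use lE in auto)
    have t2: "((\<lambda>w. Wdist p H2 D2 (r w) (r v)) \<longlongrightarrow> 0) (nhds_in ?E v)"
      by (rule filterlim_compose[OF d2(5) filterlim_nhds_in[OF cr v]]) (use rE in auto)
    have b: "Wdist p ?H ?D w v \<le> 2 powr p * (Wdist p H1 D1 (l w) (l v) + Wdist p H2 D2 (r w) (r v))" for w
    proof -
      note v1 = W0D[OF adm_mapD(1)[OF HD1 lE[of w]]] and v2 = W0D[OF adm_mapD(1)[OF HD2 rE[of w]]]
      have "pint p (\<lambda>x. (H1 (l w) x - H1 (l v) x) + (H2 (r w) x - H2 (r v) x))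
        \<le> 2 powr p * (pint p (\<lambda>x. H1 (l w) x - H1 (l v) x) + pint p (\<lambda>x. H2 (r w) x - H2 (r v) x))"
        by (intro Lp_add(2) Lp_diff(1) p0 w1 w2 v1 v2)
      moreover have "pint p (\<lambda>x. (D1 (l w) x - D1 (l v) x) + (D2 (r w) x - D2 (r v) x))
        \<le> 2 powr p * (pint p (\<lambda>x. D1 (l w) x - D1 (l v) x) + pint p (\<lambda>x. D2 (r w) x - D2 (r v) x))"
        by (intro Lp_add(2) Lp_diff(1) p0 w1 w2 v1 v2)
      ultimately show ?thesis unfolding Wdist_def by (simp add: algebra_simps)
    qed
    have "((\<lambda>w. 2 powr p * (Wdist p H1 D1 (l w) (l v) + Wdist p H2 D2 (r w) (r v))) \<longlongrightarrow> 2 powr p * (0 + 0)) (nhds_in ?E v)"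
      by (rule tendsto_mult[OF tendsto_const tendsto_add[OF t1 t2]])
    then have t: "((\<lambda>w. 2 powr p * (Wdist p H1 D1 (l w) (l v) + Wdist p H2 D2 (r w) (r v))) \<longlongrightarrow> 0) (nhds_in ?E v)"
      by simp
    show "((\<lambda>w. Wdist p ?H ?D w v) \<longlongrightarrow> 0) (nhds_in ?E v)"
      by (rule tendsto_sandwich[OF always_eventually[OF allI[OF Wdist_nonneg]] always_eventually[OF allI[OF b]] tendsto_const t])
  qed
  then show ?thesis by (auto simp: adm_def)
qed

lemma adm_zero:
  fixes \<Omega> :: "(real^'n) set"
  assumes p: "1 < p"
  shows "adm p \<Omega> 0 \<mu>"
proof -
  have z: "((\<lambda>_. 0), (\<lambda>_. 0)) \<in> W0 p \<Omega>"
  proof -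
    have t: "(\<lambda>_ :: real^'n. 0) \<in> test_functions \<Omega>"
      by (rule test_functionsI[where K="{}"]) (auto intro: Ck_const)
    have "grad (\<lambda>_ :: real^'n. 0) = (\<lambda>_. 0)" using grad_cmult[OF t, of 0] by (intro ext) simp
    then show ?thesis using W0_test[OF _ t, of p] p by simp
  qed
  have "adm_map p \<Omega> 0 \<mu> (\<lambda>_ _. 0) (\<lambda>_ _. 0)"
    by (rule adm_mapI) (use z in \<open>auto simp: pint_def sqn_def Wdist_def\<close>)
  then show ?thesis by (auto simp: adm_def)
qed

text \<open>Signed multiples of a single bump form an odd map of the zero-dimensional
  sphere.\<close>

lemma adm_one:
  fixes a b :: "real^'n"
  assumes p: "1 < p" and ab: "cbox a b \<subseteq> \<Omega>" "box a b \<noteq> {}"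
  shows "\<exists>\<mu>. adm p \<Omega> 1 \<mu>"
proof -
  have p0: "0 < p" using p by simp
  let ?\<phi> = "box_bump a b 0"
  have \<phi>: "?\<phi> \<in> test_functions \<Omega>" by (rule box_bump_test[OF ab(1)])
  note W = W0_test[OF p0 \<phi>]
  have pos: "0 < pint p ?\<phi>"
  proof (rule ccontr)
    assume "\<not> ?thesis"
    then have "pint p ?\<phi> = 0" using pint_nonneg[of p ?\<phi>] by linarith
    then have "AE x in lebesgue. norm (?\<phi> x) powr p = 0"
      unfolding pint_def using integral_nonneg_eq_0_iff_AE[OF LpD(2)[OF W0D(1)[OF W]]] by simp
    then have "AE x in lebesgue. x \<notin> box a b"
      by eventually_elim (use box_bump_nonzero_iff[of a b 0] in auto)
    then have "negligible (box a b)" by (simp add: negligible_iff_null_sets AE_iff_null_sets)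
    then show False using ab(2) by (simp add: negligible_interval)
  qed
  define \<gamma> where "\<gamma> = (1 / pint p ?\<phi>) powr (1 / p)"
  have \<gamma>: "\<gamma> powr p * pint p ?\<phi> = 1" "0 < \<gamma>"
    using pos p by (auto simp: \<gamma>_def powr_powr)
  \<comment> \<open>The odd root of exponent \<open>2 / p\<close>: the p-th power of its modulus is
    \<open>sqn 1 v\<close> up to the factor \<open>\<gamma> powr p\<close>, which normalises the
    bump.\<close>
  define c where "c v = \<gamma> * (sgn (v 0) * \<bar>v 0\<bar> powr (2 / p))" for v :: "nat \<Rightarrow> real"
  have cp: "\<bar>c v\<bar> powr p = \<gamma> powr p * sqn 1 v" for v
    using \<gamma>(2) p by (cases "v 0 = 0") (auto simp: c_def sqn_def abs_mult powr_mult powr_powr abs_sgn_eq)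
  have contc: "continuous_on S c" for S
  proof -
    have "continuous_on UNIV (\<lambda>t :: real. sgn t * \<bar>t\<bar> powr (2 / p))"
    proof (rule continuous_at_imp_continuous_on, rule ballI)
      fix t :: real
      show "isCont (\<lambda>t. sgn t * \<bar>t\<bar> powr (2 / p)) t"
      proof (cases "t = 0")
        case True
        have "((\<lambda>t. \<bar>t\<bar>) \<longlongrightarrow> \<bar>0\<bar>) (at (0::real))" by (intro tendsto_rabs tendsto_ident_at)
        from tendsto_powr'[OF this tendsto_const[of "2 / p"]]
        have "((\<lambda>t. \<bar>t\<bar> powr (2 / p)) \<longlongrightarrow> 0) (at (0::real))" using p by simp
        then have "((\<lambda>t. \<bar>sgn t * \<bar>t\<bar> powr (2 / p)\<bar>) \<longlongrightarrow> 0) (at (0::real))"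
          by (rule Lim_transform_eventually) (auto simp: eventually_at_filter abs_mult abs_sgn_eq)
        then show ?thesis using True by (simp add: isCont_def tendsto_rabs_zero_iff)
      next
        case False
        then show ?thesis unfolding isCont_def
          by (intro tendsto_mult tendsto_sgn tendsto_powr tendsto_rabs tendsto_ident_at tendsto_const) auto
      qed
    qed
    from continuous_on_compose2[OF this continuous_on_coordinate[of S 0] subset_UNIV]
    show ?thesis unfolding c_def by (rule continuous_on_mult[OF continuous_on_const])
  qed
  let ?H = "\<lambda>v x. c v * ?\<phi> x" and ?D = "\<lambda>v x. c v *\<^sub>R grad ?\<phi> x"
  have sc: "pint p (\<lambda>x. t * ?\<phi> x) = \<bar>t\<bar> powr p * pint p ?\<phi>"
    "pint p (\<lambda>x. t *\<^sub>R grad ?\<phi> x) = \<bar>t\<bar> powr p * pint p (grad ?\<phi>)" for t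
    using Lp_scale(2)[OF W0D(1)[OF W], of t] Lp_scale(2)[OF W0D(2)[OF W], of t] by simp_all
  have "adm_map p \<Omega> 1 (\<gamma> powr p * pint p (grad ?\<phi>)) ?H ?D"
  proof (rule adm_mapI)
    fix v assume v: "v \<in> espace 1"
    show "(?H v, ?D v) \<in> W0 p \<Omega>" by (rule W0_scale[OF p0 W])
    show "pint p (?H v) = sqn 1 v" using \<gamma>(1) by (simp add: sc cp)
    show "pint p (?D v) \<le> \<gamma> powr p * pint p (grad ?\<phi>) * sqn 1 v" by (simp add: sc cp)
    have "c (\<lambda>i. - v i) = - c v" by (simp add: c_def sgn_minus)
    then show "pint p (\<lambda>x. ?H (\<lambda>i. - v i) x + ?H v x) = 0" by (simp add: pint_def)
    have eq: "Wdist p ?H ?D w v = \<bar>c w - c v\<bar> powr p * (pint p ?\<phi> + pint p (grad ?\<phi>))" for w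
      unfolding Wdist_def using sc[of "c w - c v"] by (simp add: left_diff_distrib scaleR_left_diff_distrib distrib_left)
    have "((\<lambda>w. \<bar>c w - c v\<bar> powr p * (pint p ?\<phi> + pint p (grad ?\<phi>)))
       \<longlongrightarrow> \<bar>c v - c v\<bar> powr p * (pint p ?\<phi> + pint p (grad ?\<phi>))) (nhds_in (espace 1) v)"
      by (intro tendsto_mult tendsto_powr' tendsto_rabs tendsto_diff tendsto_const tendsto_nhds_in[OF contc v])
         (use p in auto)
    then show "((\<lambda>w. Wdist p ?H ?D w v) \<longlongrightarrow> 0) (nhds_in (espace 1) v)" unfolding eq using p by simp
  qed
  then show ?thesis by (auto simp: adm_def)
qed

section \<open>Scaling\<close>

lemma lebesgue_affine:
  fixes b :: "real^'n"
  assumes "r \<noteq> 0"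
  shows "lebesgue = density (distr lebesgue lebesgue (\<lambda>x. b + r *\<^sub>R x)) (\<lambda>_. ennreal (\<bar>r\<bar> ^ CARD('n)))"
    and "(\<lambda>x. b + r *\<^sub>R x) \<in> lebesgue \<rightarrow>\<^sub>M lebesgue"
proof -
  have eq: "(\<lambda>x::real^'n. b + (\<Sum>j\<in>Basis. (r * (x \<bullet> j)) *\<^sub>R j)) = (\<lambda>x. b + r *\<^sub>R x)"
    by (simp only: scaleR_scaleR[symmetric] scaleR_sum_right[symmetric] euclidean_representation)
  show "lebesgue = density (distr lebesgue lebesgue (\<lambda>x. b + r *\<^sub>R x)) (\<lambda>_. ennreal (\<bar>r\<bar> ^ CARD('n)))"
    using lebesgue_affine_euclidean[of "\<lambda>_::real^'n. r" b] assms unfolding eq by simp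
  show "(\<lambda>x. b + r *\<^sub>R x) \<in> lebesgue \<rightarrow>\<^sub>M lebesgue"
    using lebesgue_affine_measurable[of "\<lambda>_::real^'n. r" b] assms unfolding eq by simp
qed

lemma lebesgue_integral_affine:
  fixes f :: "real^'n \<Rightarrow> real"
  assumes r: "r \<noteq> 0" and f: "integrable lebesgue f"
  shows "integrable lebesgue (\<lambda>x. f (b + r *\<^sub>R x))"
    and "(\<integral>x. f (b + r *\<^sub>R x) \<partial>lebesgue) = (\<integral>x. f x \<partial>lebesgue) / \<bar>r\<bar> ^ CARD('n)"
proof -
  let ?T = "\<lambda>x::real^'n. b + r *\<^sub>R x" and ?c = "\<bar>r\<bar> ^ CARD('n)"
  note T = lebesgue_affine(2)[OF r, of b]
  have fm: "f \<in> borel_measurable lebesgue" using f by simp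
  have c: "?c > 0" using r by simp
  have "integrable (density (distr lebesgue lebesgue ?T) (\<lambda>_. ennreal ?c)) f"
    using f by (subst lebesgue_affine(1)[OF r, of b, symmetric])
  then have "integrable (distr lebesgue lebesgue ?T) (\<lambda>x. ?c *\<^sub>R f x)"
    by (subst (asm) integrable_density) (use fm in auto)
  then have "integrable lebesgue (\<lambda>x. ?c *\<^sub>R f (?T x))"
    by (subst (asm) integrable_distr_eq) (use fm T in auto)
  then show "integrable lebesgue (\<lambda>x. f (?T x))" using c by simp
  have "(\<integral>x. f x \<partial>lebesgue) = (\<integral>x. f x \<partial>density (distr lebesgue lebesgue ?T) (\<lambda>_. ennreal ?c))"
    by (subst (1) lebesgue_affine(1)[OF r, of b]) simp
  also have "\<dots> = (\<integral>x. ?c *\<^sub>R f x \<partial>distr lebesgue lebesgue ?T)"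
    by (subst integral_density) (use fm in auto)
  also have "\<dots> = (\<integral>x. ?c *\<^sub>R f (?T x) \<partial>lebesgue)"
    by (subst integral_distr) (use fm T in auto)
  finally show "(\<integral>x. f (?T x) \<partial>lebesgue) = (\<integral>x. f x \<partial>lebesgue) / ?c" using c by simp
qed

lemma Lp_affine:
  fixes f :: "real^'n \<Rightarrow> 'b::euclidean_space"
  assumes r: "r \<noteq> 0" and f: "Lp p f"
  shows "Lp p (\<lambda>x. f (b + r *\<^sub>R x))" "pint p (\<lambda>x. f (b + r *\<^sub>R x)) = pint p f / \<bar>r\<bar> ^ CARD('n)"
  using lebesgue_integral_affine[OF r LpD(2)[OF f], of b]
    measurable_compose[OF lebesgue_affine(2)[OF r, of b] LpD(1)[OF f]]
  by (auto simp: Lp_def pint_def)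

lemma W0_affine:
  fixes u :: "real^'n \<Rightarrow> real"
  assumes p: "0 < p" and r: "r \<noteq> 0" and u: "(u, G) \<in> W0 p \<Omega>"
  shows "(\<lambda>x. u (b + r *\<^sub>R x), \<lambda>x. r *\<^sub>R G (b + r *\<^sub>R x)) \<in> W0 p ((\<lambda>x. b + r *\<^sub>R x) -` \<Omega>)"
proof (rule W0I)
  show "Lp p (\<lambda>x. u (b + r *\<^sub>R x))" "Lp p (\<lambda>x. r *\<^sub>R G (b + r *\<^sub>R x))"
    by (intro Lp_scale(1) Lp_affine(1)[OF r] W0D[OF u])+
  fix \<epsilon> :: real assume \<epsilon>: "0 < \<epsilon>"
  let ?c = "\<bar>r\<bar> ^ CARD('n)"
  define m where "m = 1 + \<bar>r\<bar> powr p"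
  have c: "0 < ?c" "0 < m" using r by (auto simp: m_def add_pos_nonneg)
  define \<delta> where "\<delta> = \<epsilon> * ?c / m"
  have \<delta>: "0 < \<delta>" using \<epsilon> c by (simp add: \<delta>_def)
  obtain \<phi> where \<phi>: "\<phi> \<in> test_functions \<Omega>" "pint p (\<lambda>x. u x - \<phi> x) + pint p (\<lambda>x. G x - grad \<phi> x) < \<delta>"
    by (rule W0_approx[OF u \<delta>])
  have L: "Lp p (\<lambda>x. u x - \<phi> x)" "Lp p (\<lambda>x. G x - grad \<phi> x)"
    by (intro Lp_diff(1) p W0D[OF u] Lp_test[OF p \<phi>(1)])+
  have "pint p (\<lambda>x. u (b + r *\<^sub>R x) - \<phi> (b + r *\<^sub>R x)) = pint p (\<lambda>x. u x - \<phi> x) / ?c"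
    by (rule Lp_affine(2)[OF r L(1)])
  moreover have "pint p (\<lambda>x. r *\<^sub>R (G (b + r *\<^sub>R x) - grad \<phi> (b + r *\<^sub>R x))) = \<bar>r\<bar> powr p * (pint p (\<lambda>x. G x - grad \<phi> x) / ?c)"
    using Lp_scale(2)[OF Lp_affine(1)[OF r L(2), of b], of r] Lp_affine(2)[OF r L(2), of b] by simp
  ultimately have "pint p (\<lambda>x. u (b + r *\<^sub>R x) - \<phi> (b + r *\<^sub>R x))
      + pint p (\<lambda>x. r *\<^sub>R (G (b + r *\<^sub>R x) - grad \<phi> (b + r *\<^sub>R x)))
     = (1 * pint p (\<lambda>x. u x - \<phi> x) + \<bar>r\<bar> powr p * pint p (\<lambda>x. G x - grad \<phi> x)) / ?c"
    by (simp add: add_divide_distrib)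
  also have "\<dots> \<le> (m * pint p (\<lambda>x. u x - \<phi> x) + m * pint p (\<lambda>x. G x - grad \<phi> x)) / ?c"
    using c by (intro divide_right_mono add_mono mult_right_mono pint_nonneg) (auto simp: m_def)
  also have "\<dots> = m * (pint p (\<lambda>x. u x - \<phi> x) + pint p (\<lambda>x. G x - grad \<phi> x)) / ?c" by (simp add: distrib_left)
  also have "\<dots> < m * \<delta> / ?c" using c \<phi>(2) by (intro divide_strict_right_mono mult_strict_left_mono)
  also have "\<dots> = \<epsilon>" using c by (simp add: \<delta>_def)
  finally have "pint p (\<lambda>x. u (b + r *\<^sub>R x) - \<phi> (b + r *\<^sub>R x))
      + pint p (\<lambda>x. r *\<^sub>R G (b + r *\<^sub>R x) - grad (\<lambda>x. \<phi> (b + r *\<^sub>R x)) x) < \<epsilon>"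
    by (simp add: grad_affine[OF \<phi>(1)] scaleR_diff_right)
  then show "\<exists>\<phi>\<in>test_functions ((\<lambda>x. b + r *\<^sub>R x) -` \<Omega>).
      pint p (\<lambda>x. u (b + r *\<^sub>R x) - \<phi> x) + pint p (\<lambda>x. r *\<^sub>R G (b + r *\<^sub>R x) - grad \<phi> x) < \<epsilon>"
    by (rule bexI[of _ "\<lambda>x. \<phi> (b + r *\<^sub>R x)"]) (rule test_functions_affine[OF \<phi>(1) r])
qed (auto simp: W0D[OF u])

text \<open>Composition with the affine map divides both integrals by \<open>r ^ CARD('n)\<close>,
  which \<open>\<gamma>\<close> undoes; the chain rule leaves the factor \<open>r powr p\<close> in
  the energy.\<close>

lemma adm_affine:
  fixes \<Omega> :: "(real^'n) set"
  assumes p: "1 < p" and r: "0 < r" and a: "adm p \<Omega> k \<mu>"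
  shows "adm p ((\<lambda>x. b + r *\<^sub>R x) -` \<Omega>) k (r powr p * \<mu>)"
proof -
  have p0: "0 < p" using p by simp
  have r0: "r \<noteq> 0" using r by simp
  obtain H D where HD: "adm_map p \<Omega> k \<mu> H D" using a by (auto simp: adm_def)
  let ?c = "\<bar>r\<bar> ^ CARD('n)"
  define \<gamma> where "\<gamma> = ?c powr (1 / p)"
  have c: "0 < ?c" using r by simp
  have \<gamma>: "\<bar>\<gamma>\<bar> powr p = ?c" using p0 r by (simp add: \<gamma>_def powr_powr)
  let ?H = "\<lambda>v x. \<gamma> * H v (b + r *\<^sub>R x)" and ?D = "\<lambda>v x. \<gamma> *\<^sub>R (r *\<^sub>R D v (b + r *\<^sub>R x))"
  have sc1: "pint p (\<lambda>x. \<gamma> * f (b + r *\<^sub>R x)) = pint p f" if "Lp p f" for f :: "real^'n \<Rightarrow> real"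
    using Lp_scale(2)[OF Lp_affine(1)[OF r0 that, of b], of \<gamma>] Lp_affine(2)[OF r0 that, of b] \<gamma> c by simp
  have sc2: "pint p (\<lambda>x. \<gamma> *\<^sub>R (r *\<^sub>R f (b + r *\<^sub>R x))) = r powr p * pint p f" if "Lp p f" for f :: "real^'n \<Rightarrow> real^'n"
    using Lp_scale(2)[OF Lp_scale(1)[OF Lp_affine(1)[OF r0 that, of b], of r], of \<gamma>]
      Lp_scale(2)[OF Lp_affine(1)[OF r0 that, of b], of r] Lp_affine(2)[OF r0 that, of b] \<gamma> c r by simp
  have "adm_map p ((\<lambda>x. b + r *\<^sub>R x) -` \<Omega>) k (r powr p * \<mu>) ?H ?D"
  proof (rule adm_mapI)
    fix v assume v: "v \<in> espace k"
    note d = adm_mapD[OF HD v] and n = adm_mapD[OF HD espace_uminus[OF v]]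
    note w = W0D[OF d(1)]
    show "(?H v, ?D v) \<in> W0 p ((\<lambda>x. b + r *\<^sub>R x) -` \<Omega>)"
      by (rule W0_scale[OF p0 W0_affine[OF p0 r0 d(1)]])
    show "pint p (?H v) = sqn k v" using sc1[OF w(1)] d(2) by simp
    show "pint p (?D v) \<le> r powr p * \<mu> * sqn k v" using sc2[OF w(2)] d(3) r by simp
    have "pint p (\<lambda>x. \<gamma> * (H (\<lambda>i. - v i) (b + r *\<^sub>R x) + H v (b + r *\<^sub>R x))) = 0"
      using sc1[OF Lp_add(1)[OF p0 W0D(1)[OF n(1)] w(1)]] d(4) by simp
    then show "pint p (\<lambda>x. ?H (\<lambda>i. - v i) x + ?H v x) = 0" by (simp add: distrib_left)
    have b: "Wdist p ?H ?D u v \<le> (1 + r powr p) * Wdist p H D u v" if u: "u \<in> espace k" for u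
    proof -
      note w' = W0D[OF adm_mapD(1)[OF HD u]]
      have "Wdist p ?H ?D u v = pint p (\<lambda>x. H u x - H v x) + r powr p * pint p (\<lambda>x. D u x - D v x)"
        using sc1[OF Lp_diff(1)[OF p0 w'(1) w(1)]] sc2[OF Lp_diff(1)[OF p0 w'(2) w(2)]]
        by (simp add: Wdist_def right_diff_distrib scaleR_diff_right)
      then show ?thesis
        using pint_nonneg[of p "\<lambda>x. H u x - H v x"] pint_nonneg[of p "\<lambda>x. D u x - D v x"]
        by (simp add: Wdist_def algebra_simps add_nonneg_nonneg)
    qed
    have t: "((\<lambda>u. (1 + r powr p) * Wdist p H D u v) \<longlongrightarrow> 0) (nhds_in (espace k) v)"
      by (rule tendsto_mult_right_zero[OF d(5)])
    show "((\<lambda>u. Wdist p ?H ?D u v) \<longlongrightarrow> 0) (nhds_in (espace k) v)"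
    proof (rule tendsto_sandwich[OF _ _ tendsto_const t])
      show "\<forall>\<^sub>F u in nhds_in (espace k) v. Wdist p ?H ?D u v \<le> (1 + r powr p) * Wdist p H D u v"
        using eventually_nhds_in_mem by eventually_elim (rule b)
    qed (simp add: Wdist_nonneg)
  qed
  then show ?thesis by (auto simp: adm_def)
qed

section \<open>Odd maps of spheres\<close>

lemma topspace_nsphere_eq:
  assumes "1 \<le> k"
  shows "topspace (nsphere (k - 1)) = {x \<in> espace k. sqn k x = 1}"
proof -
  have "{..k - 1} = {..<k}" using assms by auto
  moreover have "(\<forall>i>k - 1. x i = 0) \<longleftrightarrow> (\<forall>i\<ge>k. x i = 0)" for x :: "nat \<Rightarrow> real" using assms by (auto simp: less_eq_Suc_le)
  ultimately show ?thesis by (auto simp: nsphere espace_def sqn_def)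
qed

lemma nsphere_top_of_set: "nsphere n = top_of_set (topspace (nsphere n))"
  by (simp add: nsphere euclidean_product_topology)

text \<open>The sphere is a closed subset of a product of intervals, which is compact by Tychonoff
  in the product topology that \<open>nsphere\<close> carries.\<close>

lemma compact_nsphere: "compact (topspace (nsphere n))"
proof -
  let ?S = "topspace (nsphere n)"
  let ?B = "PiE UNIV (\<lambda>_::nat. {- 1..1::real})"
  have S: "?S = {x. (\<forall>i>n. x i = 0) \<and> (\<Sum>i\<le>n. (x i)\<^sup>2) = 1}" by (auto simp: nsphere)
  have "compactin (powertop_real UNIV) ?B" by (subst compactin_PiE) auto
  then have "compact ?B" by (simp add: euclidean_product_topology)
  moreover have "closed ?S"
  proof -
    have "?S = (\<Inter>i\<in>{n<..}. {x. x i = 0}) \<inter> {x. (\<Sum>i\<le>n. (x i)\<^sup>2) = 1}" by (auto simp: S)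
    then show ?thesis
      by (auto intro!: closed_INT closed_Int closed_Collect_eq continuous_intros continuous_on_coordinate)
  qed
  moreover have "?S \<subseteq> ?B"
  proof
    fix x assume x: "x \<in> ?S"
    have "\<bar>x i\<bar> \<le> 1" for i
    proof (cases "i \<le> n")
      case True
      have "(x i)\<^sup>2 \<le> (\<Sum>i\<le>n. (x i)\<^sup>2)" using True by (intro member_le_sum) auto
      then show ?thesis using x S by (simp add: abs_square_le_1)
    qed (use x S in auto)
    then show "x \<in> ?B" by (auto simp: PiE_def abs_le_iff minus_le_iff)
  qed
  ultimately show ?thesis using compact_Int_closed[of ?B ?S] by (simp add: inf.absorb2)
qed

lemma nhds_in_open:
  assumes "open U" "v \<in> U"
  shows "nhds_in (E \<inter> U) v = nhds_in E v"
proof (rule antisym)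
  show "nhds_in (E \<inter> U) v \<le> nhds_in E v" by (rule nhds_in_mono) simp
  show "nhds_in E v \<le> nhds_in (E \<inter> U) v"
  proof (rule filter_leI)
    fix P assume "eventually P (nhds_in (E \<inter> U) v)"
    then obtain A where "open A" "v \<in> A" "\<forall>w\<in>A \<inter> (E \<inter> U). P w" unfolding eventually_nhds_in by blast
    then show "eventually P (nhds_in E v)"
      unfolding eventually_nhds_in using assms by (intro exI[of _ "A \<inter> U"]) auto
  qed
qed

lemma AE_zero_if_pint_zero:
  assumes "Lp p f" "pint p f = 0"
  shows "AE x in lebesgue. f x = 0"
proof -
  have "AE x in lebesgue. norm (f x) powr p = 0"
    using assms integral_nonneg_eq_0_iff_AE[OF LpD(2)[OF assms(1)]] by (simp add: pint_def)
  then show ?thesis by eventually_elim simp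
qed

lemma pint_zero_if_AE:
  assumes "Lp p f" "AE x in lebesgue. f x = 0"
  shows "pint p f = 0"
proof -
  have "Lp p (\<lambda>x. 0 *\<^sub>R f x)" by (rule Lp_scale(1)[OF assms(1)])
  from pint_cong_AE[OF assms(1) this] assms(2) show ?thesis by (simp add: pint_def)
qed

text \<open>The generating balls have arbitrary centres. For each of them \<open>F\<close>, the p-th
  power of the distance to the centre, is continuous along the map by \<open>pint_tendsto\<close>,
  and the preimage of the ball is a sublevel set of \<open>F\<close>.\<close>

lemma continuous_map_sobolev0:
  fixes \<Omega> :: "(real^'n) set"
  assumes p: "1 < p" and \<Omega>: "open \<Omega>" and W: "\<And>\<xi>. \<xi> \<in> S \<Longrightarrow> (H \<xi>, D \<xi>) \<in> W0 p \<Omega>"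
    and lim: "\<And>\<xi>. \<xi> \<in> S \<Longrightarrow> ((\<lambda>w. Wdist p H D w \<xi>) \<longlongrightarrow> 0) (nhds_in S \<xi>)"
  shows "continuous_map (top_of_set S) (sobolev0_topology p \<Omega>) H"
  unfolding sobolev0_topology_def
proof (rule continuous_on_generated_topo)
  have p0: "0 < p" using p by simp
  have s0: "H \<xi> \<in> sobolev0 p \<Omega>" if "\<xi> \<in> S" for \<xi> by (rule W0_imp_sobolev0[OF p \<Omega> W[OF that]])
  fix U assume "U \<in> {{v \<in> sobolev0 p \<Omega>. sobolev_norm p \<Omega> (\<lambda>x. v x - u x) < r} |u r. u \<in> sobolev0 p \<Omega> \<and> 0 < r}"
  then obtain u r where u: "u \<in> sobolev0 p \<Omega>" and r: "0 < r"
    and U: "U = {v \<in> sobolev0 p \<Omega>. sobolev_norm p \<Omega> (\<lambda>x. v x - u x) < r}" by blast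
  obtain G where G: "(zext \<Omega> u, zext \<Omega> G) \<in> W0 p \<Omega>" "is_weak_gradient \<Omega> u G"
    by (rule sobolev0_imp_W0[OF p \<Omega> u])
  define F where "F \<xi> = pint p (\<lambda>x. H \<xi> x - zext \<Omega> u x) + pint p (\<lambda>x. D \<xi> x - zext \<Omega> G x)" for \<xi>
  have cont: "continuous_on S F"
  proof (rule continuous_onI_nhds_in)
    fix \<xi> assume \<xi>: "\<xi> \<in> S"
    have b1: "((\<lambda>w. pint p (\<lambda>x. H w x - H \<xi> x)) \<longlongrightarrow> 0) (nhds_in S \<xi>)"
      by (rule tendsto_sandwich[OF _ _ tendsto_const lim[OF \<xi>]]) (auto simp: Wdist_def pint_nonneg)
    have b2: "((\<lambda>w. pint p (\<lambda>x. D w x - D \<xi> x)) \<longlongrightarrow> 0) (nhds_in S \<xi>)"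
      by (rule tendsto_sandwich[OF _ _ tendsto_const lim[OF \<xi>]]) (auto simp: Wdist_def pint_nonneg)
    have "((\<lambda>w. pint p (\<lambda>x. H w x - zext \<Omega> u x)) \<longlongrightarrow> pint p (\<lambda>x. H \<xi> x - zext \<Omega> u x)) (nhds_in S \<xi>)"
    proof (rule pint_tendsto[OF p _ _ eventually_nhds_in_mem])
      show "Lp p (\<lambda>x. H w x - zext \<Omega> u x)" if "w \<in> S" for w
        by (rule Lp_diff(1)[OF p0 W0D(1)[OF W[OF that]] W0D(1)[OF G(1)]])
      show "Lp p (\<lambda>x. H \<xi> x - zext \<Omega> u x)" by (rule Lp_diff(1)[OF p0 W0D(1)[OF W[OF \<xi>]] W0D(1)[OF G(1)]])
    qed (use b1 in simp)
    moreover have "((\<lambda>w. pint p (\<lambda>x. D w x - zext \<Omega> G x)) \<longlongrightarrow> pint p (\<lambda>x. D \<xi> x - zext \<Omega> G x)) (nhds_in S \<xi>)"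
    proof (rule pint_tendsto[OF p _ _ eventually_nhds_in_mem])
      show "Lp p (\<lambda>x. D w x - zext \<Omega> G x)" if "w \<in> S" for w
        by (rule Lp_diff(1)[OF p0 W0D(2)[OF W[OF that]] W0D(2)[OF G(1)]])
      show "Lp p (\<lambda>x. D \<xi> x - zext \<Omega> G x)" by (rule Lp_diff(1)[OF p0 W0D(2)[OF W[OF \<xi>]] W0D(2)[OF G(1)]])
    qed (use b2 in simp)
    ultimately show "(F \<longlongrightarrow> F \<xi>) (nhds_in S \<xi>)" unfolding F_def by (rule tendsto_add)
  qed
  have iff: "H \<xi> \<in> U \<longleftrightarrow> F \<xi> < r powr p" if "\<xi> \<in> S" for \<xi>
    using sobolev_norm_diff_less_iff[OF p \<Omega> W0_is_weak_gradient[OF p \<Omega> W[OF that]] _ G(2) W0D(2)[OF G(1)] r]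
      W0D(2)[OF W[OF that]] s0[OF that]
    by (simp add: U F_def zext_W0[OF W[OF that]])
  have "H -` U \<inter> topspace (top_of_set S) = S \<inter> F -` {..<r powr p}" using iff by auto
  then show "openin (top_of_set S) (H -` U \<inter> topspace (top_of_set S))"
    using continuous_openin_preimage_gen[OF cont open_lessThan] by simp
next
  show "H ` topspace (top_of_set S)
    \<subseteq> \<Union>{{v \<in> sobolev0 p \<Omega>. sobolev_norm p \<Omega> (\<lambda>x. v x - u x) < r} |u r. u \<in> sobolev0 p \<Omega> \<and> 0 < r}"
  proof
    fix v assume "v \<in> H ` topspace (top_of_set S)"
    then obtain \<xi> where \<xi>: "\<xi> \<in> S" "v = H \<xi>" by auto
    have v: "v \<in> sobolev0 p \<Omega>" unfolding \<xi>(2) by (rule W0_imp_sobolev0[OF p \<Omega> W[OF \<xi>(1)]])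
    have "sobolev_norm p \<Omega> (\<lambda>x. v x - v x) < 1"
      using sobolev_norm_diff_less_iff[OF p \<Omega> W0_is_weak_gradient[OF p \<Omega> W[OF \<xi>(1)]] _ W0_is_weak_gradient[OF p \<Omega> W[OF \<xi>(1)]] _ zero_less_one]
        W0D(2)[OF W[OF \<xi>(1)]] by (simp add: zext_W0[OF W[OF \<xi>(1)]] \<xi>(2) pint_def)
    then have "v \<in> {w \<in> sobolev0 p \<Omega>. sobolev_norm p \<Omega> (\<lambda>x. w x - v x) < 1}" using v by simp
    then show "v \<in> \<Union>{{v \<in> sobolev0 p \<Omega>. sobolev_norm p \<Omega> (\<lambda>x. v x - u x) < r} |u r. u \<in> sobolev0 p \<Omega> \<and> 0 < r}"
      using v zero_less_one[where 'a=real] by blast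
  qed
qed

text \<open>The ball around \<open>h \<xi>\<close> is itself a generating open set, so its preimage
  is a neighbourhood of \<xi> on which \<open>Wdist\<close> is small.\<close>

lemma sobolev0_continuous_mapD:
  fixes \<Omega> :: "(real^'n) set"
  assumes p: "1 < p" and \<Omega>: "open \<Omega>"
    and h: "continuous_map (top_of_set S) (sobolev0_topology p \<Omega>) h"
    and W: "\<And>\<xi>. \<xi> \<in> S \<Longrightarrow> h \<xi> \<in> sobolev0 p \<Omega>" "\<And>\<xi>. \<xi> \<in> S \<Longrightarrow> (zext \<Omega> (h \<xi>), zext \<Omega> (G \<xi>)) \<in> W0 p \<Omega>"
      "\<And>\<xi>. \<xi> \<in> S \<Longrightarrow> is_weak_gradient \<Omega> (h \<xi>) (G \<xi>)"
    and \<xi>: "\<xi> \<in> S"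
  shows "((\<lambda>w. Wdist p (\<lambda>w. zext \<Omega> (h w)) (\<lambda>w. zext \<Omega> (G w)) w \<xi>) \<longlongrightarrow> 0) (nhds_in S \<xi>)"
proof (rule order_tendstoI)
  fix a :: real assume "a < 0"
  then show "\<forall>\<^sub>F w in nhds_in S \<xi>. a < Wdist p (\<lambda>w. zext \<Omega> (h w)) (\<lambda>w. zext \<Omega> (G w)) w \<xi>"
    using Wdist_nonneg by (intro always_eventually allI) (rule less_le_trans)
next
  fix e :: real assume "0 < e"
  have p0: "0 < p" using p by simp
  define r where "r = e powr (1 / p)"
  have r: "0 < r" "r powr p = e" using \<open>0 < e\<close> p0 by (auto simp: r_def powr_powr)
  let ?U = "{v \<in> sobolev0 p \<Omega>. sobolev_norm p \<Omega> (\<lambda>x. v x - h \<xi> x) < r}"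
  have iff: "h w \<in> ?U \<longleftrightarrow> Wdist p (\<lambda>w. zext \<Omega> (h w)) (\<lambda>w. zext \<Omega> (G w)) w \<xi> < e" if "w \<in> S" for w
    using sobolev_norm_diff_less_iff[OF p \<Omega> W(3)[OF that] W0D(2)[OF W(2)[OF that]] W(3)[OF \<xi>] W0D(2)[OF W(2)[OF \<xi>]] r(1)]
      W(1)[OF that] by (simp add: r(2) Wdist_def)
  have "openin (sobolev0_topology p \<Omega>) ?U"
    unfolding sobolev0_topology_def by (rule topology_generated_by_Basis) (use W(1)[OF \<xi>] r(1) in blast)
  then have "openin (top_of_set S) {w \<in> topspace (top_of_set S). h w \<in> ?U}"
    by (rule openin_continuous_map_preimage[OF h])
  then obtain A where A: "open A" "{w \<in> topspace (top_of_set S). h w \<in> ?U} = S \<inter> A"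
    unfolding openin_open by blast
  have m: "w \<in> A \<longleftrightarrow> Wdist p (\<lambda>w. zext \<Omega> (h w)) (\<lambda>w. zext \<Omega> (G w)) w \<xi> < e" if "w \<in> S" for w
    using A(2) iff[OF that] that by (simp add: set_eq_iff) blast
  have "Wdist p (\<lambda>w. zext \<Omega> (h w)) (\<lambda>w. zext \<Omega> (G w)) \<xi> \<xi> < e"
    using \<open>0 < e\<close> by (simp add: Wdist_def pint_def)
  then have "\<xi> \<in> A" using m[OF \<xi>] by simp
  then show "\<forall>\<^sub>F w in nhds_in S \<xi>. Wdist p (\<lambda>w. zext \<Omega> (h w)) (\<lambda>w. zext \<Omega> (G w)) w \<xi> < e"
    unfolding eventually_nhds_in using A(1) m by (intro exI[of _ A]) auto
qed

lemma adm_imp_odd_map: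
  fixes \<Omega> :: "(real^'n) set"
  assumes p: "1 < p" and \<Omega>: "open \<Omega>" and k: "1 \<le> k" and a: "adm p \<Omega> k \<mu>"
  shows "\<exists>h\<in>odd_maps p \<Omega> k. \<forall>\<xi>\<in>topspace (nsphere (k - 1)). dirichlet_energy p \<Omega> (h \<xi>) \<le> \<mu>"
proof -
  have p0: "0 < p" "p \<noteq> 0" using p by auto
  obtain H D where HD: "adm_map p \<Omega> k \<mu> H D" using a by (auto simp: adm_def)
  let ?S = "topspace (nsphere (k - 1))"
  have S: "\<xi> \<in> espace k" "sqn k \<xi> = 1" if "\<xi> \<in> ?S" for \<xi>
    using that unfolding topspace_nsphere_eq[OF k] by auto
  have sub: "?S \<subseteq> espace k" using S by blast
  note d = adm_mapD[OF HD S(1)]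
  have "continuous_map (top_of_set ?S) (sobolev0_topology p \<Omega>) H"
    by (rule continuous_map_sobolev0[OF p \<Omega> d(1)]) (assumption, rule tendsto_mono[OF nhds_in_mono[OF sub] d(5)])
  moreover have "H ` ?S \<subseteq> Lp_sphere p \<Omega>"
  proof
    fix v assume "v \<in> H ` ?S"
    then obtain \<xi> where \<xi>: "\<xi> \<in> ?S" "v = H \<xi>" by auto
    have "(\<integral>x. \<bar>H \<xi> x\<bar> powr p \<partial>lebesgue_on \<Omega>) = 1"
      using pint_zext[OF \<Omega> p0(2), of "H \<xi>"] zext_W0(1)[OF d(1)[OF \<xi>(1)]] d(2)[OF \<xi>(1)] S(2)[OF \<xi>(1)] by simp
    then show "v \<in> Lp_sphere p \<Omega>"
      using W0_imp_sobolev0[OF p \<Omega> d(1)[OF \<xi>(1)]] \<xi>(2) by (simp add: Lp_sphere_def)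
  qed
  moreover have "AE x in lebesgue_on \<Omega>. H (\<lambda>i. - \<xi> i) x = - H \<xi> x" if \<xi>: "\<xi> \<in> ?S" for \<xi>
  proof -
    have "Lp p (\<lambda>x. H (\<lambda>i. - \<xi> i) x + H \<xi> x)"
      by (rule Lp_add(1)[OF p0(1) W0D(1)[OF adm_mapD(1)[OF HD espace_uminus[OF S(1)[OF \<xi>]]]] W0D(1)[OF d(1)[OF \<xi>]]])
    from AE_zero_if_pint_zero[OF this d(4)[OF \<xi>]]
    have "AE x in lebesgue. x \<in> \<Omega> \<longrightarrow> H (\<lambda>i. - \<xi> i) x = - H \<xi> x"
      by eventually_elim linarith
    then show ?thesis using \<Omega> by (simp add: AE_restrict_space_iff)
  qed
  ultimately have "H \<in> odd_maps p \<Omega> k"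
    unfolding odd_maps_def by (subst nsphere_top_of_set) (auto simp: continuous_map_in_subtopology simp flip: nsphere_top_of_set)
  moreover have "dirichlet_energy p \<Omega> (H \<xi>) \<le> \<mu>" if "\<xi> \<in> ?S" for \<xi>
    using d(3)[OF that] S(2)[OF that] W0_dirichlet_energy[OF p \<Omega> d(1)[OF that]] by simp
  ultimately show ?thesis by blast
qed

text \<open>A weak gradient is chosen at each point of the sphere separately. The chosen gradients
  still vary continuously in the sense of \<open>Wdist\<close>, because the Sobolev norm can be
  computed from any of them.\<close>

lemma odd_mapD:
  fixes \<Omega> :: "(real^'n) set"
  assumes p: "1 < p" and \<Omega>: "open \<Omega>" and h: "h \<in> odd_maps p \<Omega> k"
  defines "S \<equiv> topspace (nsphere (k - 1))"
  obtains G where "\<And>\<xi>. \<xi> \<in> S \<Longrightarrow> (zext \<Omega> (h \<xi>), zext \<Omega> (G \<xi>)) \<in> W0 p \<Omega>"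
    "\<And>\<xi>. \<xi> \<in> S \<Longrightarrow> pint p (zext \<Omega> (h \<xi>)) = 1"
    "\<And>\<xi>. \<xi> \<in> S \<Longrightarrow> dirichlet_energy p \<Omega> (h \<xi>) = pint p (zext \<Omega> (G \<xi>))"
    "\<And>\<xi>. \<xi> \<in> S \<Longrightarrow> ((\<lambda>w. Wdist p (\<lambda>w. zext \<Omega> (h w)) (\<lambda>w. zext \<Omega> (G w)) w \<xi>) \<longlongrightarrow> 0) (nhds_in S \<xi>)"
    "\<And>\<xi>. \<xi> \<in> S \<Longrightarrow> AE x in lebesgue. zext \<Omega> (h (\<lambda>i. - \<xi> i)) x + zext \<Omega> (h \<xi>) x = 0"
proof -
  have p0: "0 < p" "p \<noteq> 0" using p by auto
  have cm: "continuous_map (top_of_set S) (subtopology (sobolev0_topology p \<Omega>) (Lp_sphere p \<Omega>)) h"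
    using h unfolding odd_maps_def S_def nsphere_top_of_set[symmetric] by simp
  then have cm': "continuous_map (top_of_set S) (sobolev0_topology p \<Omega>) h" and im: "h ` S \<subseteq> Lp_sphere p \<Omega>"
    by (auto simp: continuous_map_in_subtopology)
  have s0: "h \<xi> \<in> sobolev0 p \<Omega>" "(\<integral>x. \<bar>h \<xi> x\<bar> powr p \<partial>lebesgue_on \<Omega>) = 1" if "\<xi> \<in> S" for \<xi>
    using im that by (auto simp: Lp_sphere_def)
  have "\<forall>\<xi>. \<exists>G. \<xi> \<in> S \<longrightarrow> (zext \<Omega> (h \<xi>), zext \<Omega> G) \<in> W0 p \<Omega> \<and> is_weak_gradient \<Omega> (h \<xi>) G"
  proof
    fix \<xi> show "\<exists>G. \<xi> \<in> S \<longrightarrow> (zext \<Omega> (h \<xi>), zext \<Omega> G) \<in> W0 p \<Omega> \<and> is_weak_gradient \<Omega> (h \<xi>) G"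
    proof (cases "\<xi> \<in> S")
      case True
      obtain G where "(zext \<Omega> (h \<xi>), zext \<Omega> G) \<in> W0 p \<Omega>" "is_weak_gradient \<Omega> (h \<xi>) G"
        by (rule sobolev0_imp_W0[OF p \<Omega> s0(1)[OF True]])
      then show ?thesis by blast
    qed simp
  qed
  from choice[OF this] obtain G where "\<forall>\<xi>. \<xi> \<in> S \<longrightarrow> (zext \<Omega> (h \<xi>), zext \<Omega> (G \<xi>)) \<in> W0 p \<Omega> \<and> is_weak_gradient \<Omega> (h \<xi>) (G \<xi>)"
    by blast
  then have G: "(zext \<Omega> (h \<xi>), zext \<Omega> (G \<xi>)) \<in> W0 p \<Omega>" "is_weak_gradient \<Omega> (h \<xi>) (G \<xi>)" if "\<xi> \<in> S" for \<xi>
    using that by blast+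
  have n: "pint p (zext \<Omega> (h \<xi>)) = 1" if "\<xi> \<in> S" for \<xi>
    using pint_zext[OF \<Omega> p0(2), of "h \<xi>"] s0(2)[OF that] by simp
  have e: "dirichlet_energy p \<Omega> (h \<xi>) = pint p (zext \<Omega> (G \<xi>))" if "\<xi> \<in> S" for \<xi>
    by (rule dirichlet_energy_eq[OF \<Omega> p0(2) G(2)[OF that] LpD(1)[OF W0D(2)[OF G(1)[OF that]]]])
  have o: "AE x in lebesgue. zext \<Omega> (h (\<lambda>i. - \<xi> i)) x + zext \<Omega> (h \<xi>) x = 0" if "\<xi> \<in> S" for \<xi>
  proof -
    have "AE x in lebesgue_on \<Omega>. h (\<lambda>i. - \<xi> i) x = - h \<xi> x" using h that by (simp add: odd_maps_def S_def)
    then have "AE x in lebesgue. x \<in> \<Omega> \<longrightarrow> h (\<lambda>i. - \<xi> i) x = - h \<xi> x" using \<Omega> by (simp add: AE_restrict_space_iff)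
    then show ?thesis by eventually_elim (simp add: zext_def)
  qed
  show ?thesis by (rule that[OF G(1) n e sobolev0_continuous_mapD[OF p \<Omega> cm' s0(1) G] o])
qed

text \<open>The energy is continuous on a compact sphere. This makes the supremum in
  \<open>cogenus_eigenvalue\<close> a genuine upper bound.\<close>

lemma odd_map_energy_bounded:
  fixes \<Omega> :: "(real^'n) set"
  assumes p: "1 < p" and \<Omega>: "open \<Omega>" and h: "h \<in> odd_maps p \<Omega> k"
  shows "bdd_above (dirichlet_energy p \<Omega> ` h ` topspace (nsphere (k - 1)))"
proof -
  let ?S = "topspace (nsphere (k - 1))"
  obtain G where W: "\<And>\<xi>. \<xi> \<in> ?S \<Longrightarrow> (zext \<Omega> (h \<xi>), zext \<Omega> (G \<xi>)) \<in> W0 p \<Omega>"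
    and e: "\<And>\<xi>. \<xi> \<in> ?S \<Longrightarrow> dirichlet_energy p \<Omega> (h \<xi>) = pint p (zext \<Omega> (G \<xi>))"
    and lim: "\<And>\<xi>. \<xi> \<in> ?S \<Longrightarrow> ((\<lambda>w. Wdist p (\<lambda>w. zext \<Omega> (h w)) (\<lambda>w. zext \<Omega> (G w)) w \<xi>) \<longlongrightarrow> 0) (nhds_in ?S \<xi>)"
    by (rule odd_mapD[OF p \<Omega> h]) (rule that)
  have "continuous_on ?S (\<lambda>\<xi>. pint p (zext \<Omega> (G \<xi>)))"
  proof (rule continuous_onI_nhds_in)
    fix \<xi> assume \<xi>: "\<xi> \<in> ?S"
    have b: "((\<lambda>w. pint p (\<lambda>x. zext \<Omega> (G w) x - zext \<Omega> (G \<xi>) x)) \<longlongrightarrow> 0) (nhds_in ?S \<xi>)"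
      by (rule tendsto_sandwich[OF _ _ tendsto_const lim[OF \<xi>]]) (auto simp: Wdist_def pint_nonneg)
    show "((\<lambda>\<xi>. pint p (zext \<Omega> (G \<xi>))) \<longlongrightarrow> pint p (zext \<Omega> (G \<xi>))) (nhds_in ?S \<xi>)"
      by (rule pint_tendsto[OF p W0D(2)[OF W] W0D(2)[OF W[OF \<xi>]] eventually_nhds_in_mem b])
  qed
  then have "compact ((\<lambda>\<xi>. pint p (zext \<Omega> (G \<xi>))) ` ?S)" by (rule compact_continuous_image[OF _ compact_nsphere])
  moreover have "dirichlet_energy p \<Omega> ` h ` ?S = (\<lambda>\<xi>. pint p (zext \<Omega> (G \<xi>))) ` ?S"
    unfolding image_image by (rule image_cong[OF refl e])
  ultimately show ?thesis by (simp add: bounded_imp_bdd_above compact_imp_bounded)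
qed

text \<open>The converse of restriction to the sphere: the homogeneous extension is a product of a
  scalar and a map, hence continuous off the origin; at the origin it is continuous because its own
  integrals tend to 0.\<close>

lemma odd_map_imp_adm:
  fixes \<Omega> :: "(real^'n) set"
  assumes p: "1 < p" and \<Omega>: "open \<Omega>" and k: "1 \<le> k" and h: "h \<in> odd_maps p \<Omega> k"
    and \<mu>: "\<And>\<xi>. \<xi> \<in> topspace (nsphere (k - 1)) \<Longrightarrow> dirichlet_energy p \<Omega> (h \<xi>) \<le> \<mu>"
  shows "adm p \<Omega> k \<mu>"
proof -
  have p0: "0 < p" "p \<noteq> 0" using p by auto
  let ?S = "topspace (nsphere (k - 1))" and ?E = "espace k"
  obtain G where W: "\<And>\<xi>. \<xi> \<in> ?S \<Longrightarrow> (zext \<Omega> (h \<xi>), zext \<Omega> (G \<xi>)) \<in> W0 p \<Omega>"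
    and n: "\<And>\<xi>. \<xi> \<in> ?S \<Longrightarrow> pint p (zext \<Omega> (h \<xi>)) = 1"
    and e: "\<And>\<xi>. \<xi> \<in> ?S \<Longrightarrow> dirichlet_energy p \<Omega> (h \<xi>) = pint p (zext \<Omega> (G \<xi>))"
    and lim: "\<And>\<xi>. \<xi> \<in> ?S \<Longrightarrow> ((\<lambda>w. Wdist p (\<lambda>w. zext \<Omega> (h w)) (\<lambda>w. zext \<Omega> (G w)) w \<xi>) \<longlongrightarrow> 0) (nhds_in ?S \<xi>)"
    and o: "\<And>\<xi>. \<xi> \<in> ?S \<Longrightarrow> AE x in lebesgue. zext \<Omega> (h (\<lambda>i. - \<xi> i)) x + zext \<Omega> (h \<xi>) x = 0"
    by (rule odd_mapD[OF p \<Omega> h]) (rule that)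
  have e\<mu>: "pint p (zext \<Omega> (G \<xi>)) \<le> \<mu>" if "\<xi> \<in> ?S" for \<xi> using \<mu>[OF that] e[OF that] by simp
  obtain \<xi>0 where "\<xi>0 \<in> ?S" using in_topspace_nsphere by blast
  then have \<mu>0: "0 \<le> \<mu>" using e\<mu> pint_nonneg order_trans by blast
  define c where "c v = sqn k v powr (1 / p)" for v
  define nm where "nm v = (\<lambda>i. v i / sqrt (sqn k v))" for v :: "nat \<Rightarrow> real"
  define H where "H v = (\<lambda>x. c v * (if 0 < sqn k v then zext \<Omega> (h (nm v)) x else 0))" for v
  define D where "D v = (\<lambda>x. c v *\<^sub>R (if 0 < sqn k v then zext \<Omega> (G (nm v)) x else 0))" for v
  have nmS: "nm v \<in> ?S" if "v \<in> ?E" "0 < sqn k v" for v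
  proof -
    have "sqn k (nm v) = 1"
      using that(2) by (simp add: sqn_def nm_def power_divide sum_nonneg flip: sum_divide_distrib)
    moreover have "nm v \<in> ?E" using that(1) by (simp add: espace_def nm_def)
    ultimately show ?thesis unfolding topspace_nsphere_eq[OF k] by simp
  qed
  have cp: "\<bar>c v\<bar> powr p = sqn k v" for v using sqn_nonneg[of k v] p0 by (simp add: c_def powr_powr)
  have W0: "((\<lambda>_::real^'n. 0), (\<lambda>_. 0)) \<in> W0 p \<Omega>"
    using W0_scale[OF p0(1) W[OF \<open>\<xi>0 \<in> ?S\<close>], of 0] by simp
  have HD: "(H v, D v) \<in> W0 p \<Omega>" if "v \<in> ?E" for v
  proof (cases "0 < sqn k v")
    case True
    then show ?thesis using W0_scale[OF p0(1) W[OF nmS[OF that True]], of "c v"] by (simp add: H_def D_def)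
  qed (use W0 in \<open>simp add: H_def D_def\<close>)
  have pH: "pint p (H v) = sqn k v" if "v \<in> ?E" for v
  proof (cases "0 < sqn k v")
    case True
    then show ?thesis
      using Lp_scale(2)[OF W0D(1)[OF W[OF nmS[OF that True]]], of "c v"] n[OF nmS[OF that True]] cp by (simp add: H_def)
  next
    case False
    then have "sqn k v = 0" using sqn_nonneg[of k v] by linarith
    then show ?thesis using False p0 by (simp add: H_def pint_def)
  qed
  have pD: "pint p (D v) \<le> \<mu> * sqn k v" if "v \<in> ?E" for v
  proof (cases "0 < sqn k v")
    case True
    then show ?thesis
      using Lp_scale(2)[OF W0D(2)[OF W[OF nmS[OF that True]]], of "c v"]
        mult_left_mono[OF e\<mu>[OF nmS[OF that True]], of "sqn k v"] cp by (simp add: D_def mult.commute)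
  next
    case False
    then have "sqn k v = 0" using sqn_nonneg[of k v] by linarith
    then show ?thesis using False p0 by (simp add: D_def pint_def)
  qed
  have "adm_map p \<Omega> k \<mu> H D"
  proof (rule adm_mapI[OF HD pH pD])
    fix v assume v: "v \<in> ?E"
    show "pint p (\<lambda>x. H (\<lambda>i. - v i) x + H v x) = 0"
    proof (rule pint_zero_if_AE)
      show "Lp p (\<lambda>x. H (\<lambda>i. - v i) x + H v x)"
        by (rule Lp_add(1)[OF p0(1) W0D(1)[OF HD[OF espace_uminus[OF v]]] W0D(1)[OF HD[OF v]]])
      have sq: "sqn k (\<lambda>i. - v i) = sqn k v" by (simp add: sqn_def)
      have nmm: "nm (\<lambda>i. - v i) = (\<lambda>i. - nm v i)" by (simp add: nm_def sq)
      show "AE x in lebesgue. H (\<lambda>i. - v i) x + H v x = 0"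
      proof (cases "0 < sqn k v")
        case True
        from o[OF nmS[OF v True]] show ?thesis
        proof eventually_elim
          case (elim x)
          have "H (\<lambda>i. - v i) x + H v x = c v * (zext \<Omega> (h (\<lambda>i. - nm v i)) x + zext \<Omega> (h (nm v)) x)"
            using True by (simp add: H_def nmm sq c_def distrib_left)
          then show ?case using elim by simp
        qed
      qed (simp add: H_def sq)
    qed
    show "((\<lambda>w. Wdist p H D w v) \<longlongrightarrow> 0) (nhds_in ?E v)"
    proof (cases "0 < sqn k v")
      case False
      then have sv: "sqn k v = 0" using sqn_nonneg[of k v] by linarith
      have Hv: "H v = (\<lambda>_. 0)" "D v = (\<lambda>_. 0)" using False by (simp_all add: H_def D_def)
      \<comment> \<open>At the origin \<open>Wdist\<close> is just the sum of the two integrals of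
        the moving point, at most \<open>(1 + \<mu>) * sqn k w\<close>.\<close>
      have "(sqn k \<longlongrightarrow> 0) (nhds_in ?E v)" using tendsto_nhds_in[OF continuous_on_sqn v, of k] sv by simp
      then have t: "((\<lambda>w. (1 + \<mu>) * sqn k w) \<longlongrightarrow> 0) (nhds_in ?E v)" by (rule tendsto_mult_right_zero)
      show ?thesis
      proof (rule tendsto_sandwich[OF always_eventually[OF allI[OF Wdist_nonneg]] _ tendsto_const t])
        show "\<forall>\<^sub>F w in nhds_in ?E v. Wdist p H D w v \<le> (1 + \<mu>) * sqn k w"
          using eventually_nhds_in_mem
        proof eventually_elim
          case (elim w)
          then show ?case using pH[OF elim] pD[OF elim] by (simp add: Wdist_def Hv distrib_right)
        qed
      qed
    next
      case True
      let ?U = "{w. 0 < sqn k w}"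
      have oU: "open ?U" using open_Collect_less[OF continuous_on_const continuous_on_sqn] by simp
      \<comment> \<open>The normalisation \<open>nm\<close> is continuous only off the origin, so
        the neighbourhood filter is first moved to the open set \<open>?U\<close>.\<close>
      have eq: "nhds_in ?E v = nhds_in (?E \<inter> ?U) v" using nhds_in_open[OF oU, of v ?E] True by simp
      have vU: "v \<in> ?E \<inter> ?U" using v True by simp
      have cnm: "continuous_on (?E \<inter> ?U) nm"
      proof (rule continuous_on_coordinatewise_then_product)
        show "continuous_on (?E \<inter> ?U) (\<lambda>v. nm v i)" for i
          unfolding nm_def by (intro continuous_on_divide continuous_on_coordinate continuous_on_real_sqrt continuous_on_sqn) auto
      qed
      have cc: "continuous_on (?E \<inter> ?U) c"
        unfolding c_def[abs_def] by (intro continuous_on_powr continuous_on_sqn continuous_on_const) auto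
      let ?A = "\<lambda>w. zext \<Omega> (h (nm w))" and ?B = "\<lambda>w. zext \<Omega> (G (nm w))"
      have t1: "((\<lambda>w. Wdist p (\<lambda>w. zext \<Omega> (h w)) (\<lambda>w. zext \<Omega> (G w)) (nm w) (nm v)) \<longlongrightarrow> 0) (nhds_in (?E \<inter> ?U) v)"
        by (rule filterlim_compose[OF lim[OF nmS[OF v True]] filterlim_nhds_in[OF cnm vU]]) (use nmS in auto)
      have "((\<lambda>w. \<bar>c w - c v\<bar> powr p) \<longlongrightarrow> \<bar>c v - c v\<bar> powr p) (nhds_in (?E \<inter> ?U) v)"
        by (rule tendsto_powr'[OF tendsto_rabs[OF tendsto_diff[OF tendsto_nhds_in[OF cc vU] tendsto_const]] tendsto_const])
           (use p0 in auto)
      then have t2: "((\<lambda>w. \<bar>c w - c v\<bar> powr p) \<longlongrightarrow> 0) (nhds_in (?E \<inter> ?U) v)" using p0 by simp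
      have "((\<lambda>w. 2 powr p * (\<bar>c w - c v\<bar> powr p * (1 + \<mu>)
          + \<bar>c v\<bar> powr p * Wdist p (\<lambda>w. zext \<Omega> (h w)) (\<lambda>w. zext \<Omega> (G w)) (nm w) (nm v)))
          \<longlongrightarrow> 2 powr p * (0 * (1 + \<mu>) + \<bar>c v\<bar> powr p * 0)) (nhds_in (?E \<inter> ?U) v)"
        by (rule tendsto_mult[OF tendsto_const tendsto_add[OF tendsto_mult[OF t2 tendsto_const] tendsto_mult[OF tendsto_const t1]]])
      then have t: "((\<lambda>w. 2 powr p * (\<bar>c w - c v\<bar> powr p * (1 + \<mu>)
          + \<bar>c v\<bar> powr p * Wdist p (\<lambda>w. zext \<Omega> (h w)) (\<lambda>w. zext \<Omega> (G w)) (nm w) (nm v))) \<longlongrightarrow> 0) (nhds_in (?E \<inter> ?U) v)"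
        by simp
      show ?thesis unfolding eq
      proof (rule tendsto_sandwich[OF always_eventually[OF allI[OF Wdist_nonneg]] _ tendsto_const t])
        show "\<forall>\<^sub>F w in nhds_in (?E \<inter> ?U) v. Wdist p H D w v \<le> 2 powr p * (\<bar>c w - c v\<bar> powr p * (1 + \<mu>)
          + \<bar>c v\<bar> powr p * Wdist p (\<lambda>w. zext \<Omega> (h w)) (\<lambda>w. zext \<Omega> (G w)) (nm w) (nm v))"
          using eventually_nhds_in_mem
        proof eventually_elim
          case (elim w)
          then have w: "w \<in> ?E" "0 < sqn k w" by auto
          note Ww = W0D[OF W[OF nmS[OF w]]] and Wv = W0D[OF W[OF nmS[OF v True]]]
          have g: "pint p (\<lambda>x. c w *\<^sub>R f x - c v *\<^sub>R g x)
             \<le> 2 powr p * (\<bar>c w - c v\<bar> powr p * pint p f + \<bar>c v\<bar> powr p * pint p (\<lambda>x. f x - g x))"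
            if "Lp p f" "Lp p g" for f g :: "real^'n \<Rightarrow> 'z::euclidean_space"
          proof -
            have "pint p (\<lambda>x. (c w - c v) *\<^sub>R f x + c v *\<^sub>R (f x - g x))
              \<le> 2 powr p * (pint p (\<lambda>x. (c w - c v) *\<^sub>R f x) + pint p (\<lambda>x. c v *\<^sub>R (f x - g x)))"
              by (intro Lp_add(2) p0 Lp_scale(1) Lp_diff(1) that)
            also have "(\<lambda>x. (c w - c v) *\<^sub>R f x + c v *\<^sub>R (f x - g x)) = (\<lambda>x. c w *\<^sub>R f x - c v *\<^sub>R g x)"
              by (simp add: algebra_simps)
            finally show ?thesis
              by (simp only: Lp_scale(2)[OF that(1)] Lp_scale(2)[OF Lp_diff(1)[OF p0(1) that]])
          qed
          have 1: "pint p (\<lambda>x. H w x - H v x) \<le> 2 powr p * (\<bar>c w - c v\<bar> powr p * 1 + \<bar>c v\<bar> powr p * pint p (\<lambda>x. ?A w x - ?A v x))"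
            using g[OF Ww(1) Wv(1)] n[OF nmS[OF w]] w True by (simp add: H_def)
          have "pint p (\<lambda>x. D w x - D v x) \<le> 2 powr p * (\<bar>c w - c v\<bar> powr p * pint p (?B w) + \<bar>c v\<bar> powr p * pint p (\<lambda>x. ?B w x - ?B v x))"
            using g[OF Ww(2) Wv(2)] w True by (simp add: D_def)
          also have "\<dots> \<le> 2 powr p * (\<bar>c w - c v\<bar> powr p * \<mu> + \<bar>c v\<bar> powr p * pint p (\<lambda>x. ?B w x - ?B v x))"
            by (intro mult_left_mono add_right_mono e\<mu>[OF nmS[OF w]]) auto
          finally show ?case using 1 unfolding Wdist_def by (simp add: algebra_simps)
        qed
      qed
    qed
  qed
  then show ?thesis by (auto simp: adm_def)
qed

section \<open>A Poincare inequality for functions with vanishing averages\<close>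

text \<open>Jensen's inequality up to the factor \<open>2 powr p\<close>, from the bounds that \<open>young_split\<close> yields for an average.\<close>

lemma weak_jensen:
  fixes A J p :: real
  assumes p: "1 < p" and A: "0 \<le> A" and J: "\<And>d. 0 < d \<Longrightarrow> A \<le> d + d powr (1 - p) * J"
  shows "A powr p \<le> 2 powr p * J"
proof (cases "A = 0")
  case True
  have "0 \<le> J"
  proof (rule ccontr)
    assume "\<not> 0 \<le> J"
    \<comment> \<open>For this \<open>d\<close> the hypothesis, multiplied by
      \<open>d powr (p - 1)\<close>, reads \<open>0 \<le> d powr p + J = J / 2\<close>.\<close>
    define d where "d = (- J / 2) powr (1 / p)"
    have d: "0 < d" "d powr p = - J / 2" using \<open>\<not> 0 \<le> J\<close> p by (auto simp: d_def powr_powr)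
    have "d powr (p - 1) * 0 \<le> d powr (p - 1) * (d + d powr (1 - p) * J)"
      using J[OF d(1)] True by (intro mult_left_mono) auto
    also have "\<dots> = d powr (p - 1) * d powr 1 + (d powr (p - 1) * d powr (1 - p)) * J"
      using d(1) by (simp add: algebra_simps)
    also have "d powr (p - 1) * d powr 1 = d powr p" by (subst powr_add[symmetric]) simp
    also have "d powr (p - 1) * d powr (1 - p) = 1" using d(1) by (subst powr_add[symmetric]) simp
    finally show False using d(2) \<open>\<not> 0 \<le> J\<close> by simp
  qed
  then show ?thesis using True p by simp
next
  case False
  \<comment> \<open>The choice \<open>d = A / 2\<close> absorbs half of the left-hand side.\<close>
  then have a: "0 < A / 2" using A by simp
  have "A / 2 \<le> (A / 2) powr (1 - p) * J" using J[OF a] by simp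
  then have "(A / 2) powr (p - 1) * (A / 2) \<le> (A / 2) powr (p - 1) * ((A / 2) powr (1 - p) * J)"
    by (rule mult_left_mono) simp
  also have "\<dots> = ((A / 2) powr (p - 1) * (A / 2) powr (1 - p)) * J" by simp
  also have "(A / 2) powr (p - 1) * (A / 2) powr (1 - p) = 1" using a by (simp flip: powr_add)
  also have "(A / 2) powr (p - 1) * (A / 2) = (A / 2) powr (p - 1) * (A / 2) powr 1" using a by simp
  also have "\<dots> = (A / 2) powr p" by (subst powr_add[symmetric]) simp
  finally have "(A / 2) powr p \<le> J" by simp
  then have "2 powr p * (A / 2) powr p \<le> 2 powr p * J" by simp
  then show ?thesis by (simp flip: powr_mult)
qed

text \<open>The fundamental theorem of calculus along the segment from \<open>x\<close> to
  \<open>h + x\<close>, then Cauchy--Schwarz, then \<open>weak_jensen\<close> on the unit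
  interval.\<close>

lemma test_functions_shift_pointwise:
  fixes \<phi> :: "real^'n \<Rightarrow> real"
  assumes p: "1 < p" and \<phi>: "\<phi> \<in> test_functions \<Omega>"
  shows "\<bar>\<phi> (h + x) - \<phi> x\<bar> powr p
    \<le> 2 powr p * norm h powr p * integral {0..1} (\<lambda>t. norm (grad \<phi> (t *\<^sub>R h + x)) powr p)"
proof -
  let ?g = "\<lambda>t. norm (grad \<phi> (t *\<^sub>R h + x))"
  have cg: "continuous_on {0..1} ?g"
    by (intro continuous_intros continuous_on_compose2[OF continuous_grad[OF \<phi>, of UNIV]]) auto
  have cgp: "continuous_on {0..1} (\<lambda>t. ?g t powr p)"
    by (rule continuous_on_powr'[OF cg continuous_on_const]) (use p in auto)
  note ig = integrable_continuous_real[OF cg] and igp = integrable_continuous_real[OF cgp]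
  have ftc: "((\<lambda>t. grad \<phi> (t *\<^sub>R h + x) \<bullet> h) has_integral (\<phi> (1 *\<^sub>R h + x) - \<phi> (0 *\<^sub>R h + x))) {0..1}"
  proof (rule fundamental_theorem_of_calculus)
    fix t :: real
    have "((\<lambda>t. t *\<^sub>R h + x) has_derivative (\<lambda>s. s *\<^sub>R h)) (at t)" by (auto intro!: derivative_eq_intros)
    from has_derivative_compose[OF this test_functions_has_derivative[OF \<phi>]]
    have "((\<lambda>t. \<phi> (t *\<^sub>R h + x)) has_derivative (\<lambda>s. s * (grad \<phi> (t *\<^sub>R h + x) \<bullet> h))) (at t)"
      by (simp add: frechet_derivative_eq_grad[OF \<phi>])
    then show "((\<lambda>t. \<phi> (t *\<^sub>R h + x)) has_vector_derivative grad \<phi> (t *\<^sub>R h + x) \<bullet> h) (at t within {0..1})"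
      unfolding has_vector_derivative_def by (simp add: has_derivative_at_withinI)
  qed simp
  have "\<bar>\<phi> (h + x) - \<phi> x\<bar> = norm (integral {0..1} (\<lambda>t. grad \<phi> (t *\<^sub>R h + x) \<bullet> h))"
    using integral_unique[OF ftc] by simp
  also have "\<dots> \<le> integral {0..1} (\<lambda>t. norm h * ?g t)"
  proof (rule integral_norm_bound_integral)
    show "(\<lambda>t. grad \<phi> (t *\<^sub>R h + x) \<bullet> h) integrable_on {0..1}" using ftc by blast
    show "(\<lambda>t. norm h * ?g t) integrable_on {0..1}" using integrable_on_cmult_left[OF ig] by simp
    show "norm (grad \<phi> (t *\<^sub>R h + x) \<bullet> h) \<le> norm h * ?g t" for t
      using Cauchy_Schwarz_ineq2[of "grad \<phi> (t *\<^sub>R h + x)" h] by (simp add: mult.commute)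
  qed
  also have "\<dots> = norm h * integral {0..1} ?g" by simp
  finally have 1: "\<bar>\<phi> (h + x) - \<phi> x\<bar> \<le> norm h * integral {0..1} ?g" .
  have A: "0 \<le> integral {0..1} ?g" by (rule integral_nonneg[OF ig]) simp
  have "integral {0..1} ?g powr p \<le> 2 powr p * integral {0..1} (\<lambda>t. ?g t powr p)"
  proof (rule weak_jensen[OF p A])
    fix d :: real assume d: "0 < d"
    have i: "(\<lambda>t. d powr (1 - p) * ?g t powr p) integrable_on {0..1}" using integrable_on_cmult_left[OF igp] by simp
    have "integral {0..1} ?g \<le> integral {0..1} (\<lambda>t. d + d powr (1 - p) * ?g t powr p)"
      by (rule integral_le[OF ig integrable_add[OF integrable_const_ivl i]]) (rule young_split[OF p d norm_ge_zero])
    also have "\<dots> = integral {0..1::real} (\<lambda>t. d) + integral {0..1} (\<lambda>t. d powr (1 - p) * ?g t powr p)"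
      by (rule Henstock_Kurzweil_Integration.integral_add[OF integrable_const_ivl i])
    finally show "integral {0..1} ?g \<le> d + d powr (1 - p) * integral {0..1} (\<lambda>t. ?g t powr p)" by simp
  qed
  then have "norm h powr p * integral {0..1} ?g powr p \<le> norm h powr p * (2 powr p * integral {0..1} (\<lambda>t. ?g t powr p))"
    by (rule mult_left_mono) simp
  moreover have "\<bar>\<phi> (h + x) - \<phi> x\<bar> powr p \<le> (norm h * integral {0..1} ?g) powr p"
    by (rule powr_mono2) (use p 1 in auto)
  ultimately show ?thesis by (simp add: powr_mult mult_ac)
qed

lemma nn_integral_lborel_translation:
  fixes f :: "'a::euclidean_space \<Rightarrow> ennreal"
  assumes "f \<in> borel_measurable borel"
  shows "(\<integral>\<^sup>+x. f (h + x) \<partial>lborel) = (\<integral>\<^sup>+x. f x \<partial>lborel)"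
  by (subst (2) lborel_distr_plus[of h, symmetric]) (simp add: nn_integral_distr assms)

lemma nn_integral_pint:
  fixes f :: "real^'n \<Rightarrow> 'b::euclidean_space"
  assumes "Lp p f"
  shows "(\<integral>\<^sup>+x. ennreal (norm (f x) powr p) \<partial>lborel) = ennreal (pint p f)"
  unfolding pint_def using nn_integral_eq_integral[OF LpD(2)[OF assms]] by (simp add: nn_integral_completion)

lemma Lp_shift:
  fixes f :: "real^'n \<Rightarrow> 'b::euclidean_space"
  assumes "Lp p f"
  shows "Lp p (\<lambda>x. f (h + x))" "pint p (\<lambda>x. f (h + x)) = pint p f"
  using Lp_affine[of 1 p f h] assms by simp_all

text \<open>The pointwise bound is integrated over \<open>x\<close>. After exchanging the integrals
  every \<open>t\<close> contributes the same amount, by translation invariance. Integrals of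
  nonnegative extended functions make the exchange unconditional.\<close>

lemma test_functions_shift:
  fixes \<phi> :: "real^'n \<Rightarrow> real"
  assumes p: "1 < p" and \<phi>: "\<phi> \<in> test_functions \<Omega>"
  shows "pint p (\<lambda>x. \<phi> (h + x) - \<phi> x) \<le> 2 powr p * norm h powr p * pint p (grad \<phi>)"
proof -
  have p0: "0 < p" using p by simp
  let ?C = "2 powr p * norm h powr p"
  have gm: "grad \<phi> \<in> borel_measurable borel" by (rule borel_measurable_continuous_onI[OF continuous_grad[OF \<phi>]])
  note [measurable] = gm test_functions_integrable(1)[OF \<phi>]
  define F where "F x t = indicator {0..1} t * ennreal (norm (grad \<phi> (t *\<^sub>R h + x)) powr p)" for x and t :: real
  have Fm: "case_prod F \<in> borel_measurable (lborel \<Otimes>\<^sub>M lborel)" unfolding F_def by measurable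
  have int: "ennreal (integral {0..1} (\<lambda>t. norm (grad \<phi> (t *\<^sub>R h + x)) powr p)) = (\<integral>\<^sup>+t. F x t \<partial>lborel)" for x
  proof -
    let ?g = "\<lambda>t. norm (grad \<phi> (t *\<^sub>R h + x)) powr p"
    have c: "continuous_on {0..1} ?g"
      by (intro continuous_on_powr' continuous_intros continuous_on_compose2[OF continuous_grad[OF \<phi>, of UNIV]]) (use p in auto)
    have "(?g has_integral integral {0..1} ?g) {0..1}" using integrable_continuous_real[OF c] by (rule integrable_integral)
    then have "((\<lambda>t. if t \<in> {0..1} then ?g t else 0) has_integral integral {0..1} ?g) UNIV"
      by (simp only: has_integral_restrict_UNIV)
    from nn_integral_has_integral_lborel[OF _ _ this]
    have "integral\<^sup>N lborel (\<lambda>t. if t \<in> {0..1} then ?g t else 0) = ennreal (integral {0..1} ?g)" by simp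
    moreover have "F x t = ennreal (if t \<in> {0..1} then ?g t else 0)" for t by (simp add: F_def indicator_def)
    ultimately show ?thesis by simp
  qed
  have "ennreal (pint p (\<lambda>x. \<phi> (h + x) - \<phi> x)) = (\<integral>\<^sup>+x. ennreal (norm (\<phi> (h + x) - \<phi> x) powr p) \<partial>lborel)"
    by (rule nn_integral_pint[symmetric]) (intro Lp_diff(1) p0 Lp_shift(1) Lp_test(1)[OF p0 \<phi>])
  also have "\<dots> \<le> (\<integral>\<^sup>+x. ennreal ?C * (\<integral>\<^sup>+t. F x t \<partial>lborel) \<partial>lborel)"
  proof (rule nn_integral_mono)
    fix x
    have "ennreal (norm (\<phi> (h + x) - \<phi> x) powr p)
        \<le> ennreal (?C * integral {0..1} (\<lambda>t. norm (grad \<phi> (t *\<^sub>R h + x)) powr p))"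
      using test_functions_shift_pointwise[OF p \<phi>, of h x] by (intro ennreal_leI) simp
    also have "\<dots> = ennreal ?C * (\<integral>\<^sup>+t. F x t \<partial>lborel)" by (simp add: ennreal_mult' int)
    finally show "ennreal (norm (\<phi> (h + x) - \<phi> x) powr p) \<le> ennreal ?C * (\<integral>\<^sup>+t. F x t \<partial>lborel)" .
  qed
  also have "\<dots> = ennreal ?C * (\<integral>\<^sup>+x. (\<integral>\<^sup>+t. F x t \<partial>lborel) \<partial>lborel)"
    by (intro nn_integral_cmult lborel.borel_measurable_nn_integral Fm)
  also have "(\<integral>\<^sup>+x. (\<integral>\<^sup>+t. F x t \<partial>lborel) \<partial>lborel) = (\<integral>\<^sup>+t. (\<integral>\<^sup>+x. F x t \<partial>lborel) \<partial>lborel)"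
    by (rule lborel_pair.Fubini'[OF Fm, symmetric])
  also have "\<dots> = (\<integral>\<^sup>+t. indicator {0..1::real} t * ennreal (pint p (grad \<phi>)) \<partial>lborel)"
  proof (rule nn_integral_cong)
    fix t :: real
    have "(\<integral>\<^sup>+x. F x t \<partial>lborel) = indicator {0..1} t * (\<integral>\<^sup>+x. ennreal (norm (grad \<phi> (t *\<^sub>R h + x)) powr p) \<partial>lborel)"
      unfolding F_def by (rule nn_integral_cmult) measurable
    also have "(\<integral>\<^sup>+x. ennreal (norm (grad \<phi> (t *\<^sub>R h + x)) powr p) \<partial>lborel) = ennreal (pint p (grad \<phi>))"
      by (subst nn_integral_lborel_translation[where f="\<lambda>x. ennreal (norm (grad \<phi> x) powr p)"])
         (use nn_integral_pint[OF Lp_test(2)[OF p0 \<phi>]] in auto)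
    finally show "(\<integral>\<^sup>+x. F x t \<partial>lborel) = indicator {0..1} t * ennreal (pint p (grad \<phi>))" .
  qed
  also have "\<dots> = ennreal (pint p (grad \<phi>))" by (simp add: nn_integral_multc)
  finally have "ennreal (pint p (\<lambda>x. \<phi> (h + x) - \<phi> x)) \<le> ennreal (?C * pint p (grad \<phi>))"
    by (simp add: ennreal_mult')
  then show ?thesis by (simp add: pint_nonneg)
qed

text \<open>Passage to the closure. The factor 8 collects three factors 2: from the estimate for
  test functions, from splitting off the remainder, and from replacing \<open>grad \<phi>\<close> by
  \<open>G\<close>.\<close>

lemma W0_shift:
  fixes u :: "real^'n \<Rightarrow> real"
  assumes p: "1 < p" and u: "(u, G) \<in> W0 p \<Omega>"
  shows "pint p (\<lambda>x. u (h + x) - u x) \<le> 8 powr p * norm h powr p * pint p G"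
proof -
  have p0: "0 < p" using p by simp
  let ?b = "\<lambda>e. 2 powr p * (2 powr p * norm h powr p * (2 powr p * (pint p G + e)) + 2 powr p * (e + e))"
  have bound: "pint p (\<lambda>x. u (h + x) - u x) \<le> ?b e" if e: "0 < e" for e
  proof -
    obtain \<phi> where \<phi>: "\<phi> \<in> test_functions \<Omega>" "pint p (\<lambda>x. u x - \<phi> x) + pint p (\<lambda>x. G x - grad \<phi> x) < e"
      by (rule W0_approx[OF u e])
    have e12: "pint p (\<lambda>x. u x - \<phi> x) \<le> e" "pint p (\<lambda>x. G x - grad \<phi> x) \<le> e"
      using \<phi>(2) pint_nonneg[of p "\<lambda>x. u x - \<phi> x"] pint_nonneg[of p "\<lambda>x. G x - grad \<phi> x"] by linarith+
    note W = W0D[OF u] and T = Lp_test[OF p0 \<phi>(1)]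
    note L = Lp_diff(1)[OF p0 W(1) T(1)]
    have g: "pint p (grad \<phi>) \<le> 2 powr p * (pint p G + e)"
    proof -
      have "pint p (\<lambda>x. G x - (G x - grad \<phi> x)) \<le> 2 powr p * (pint p G + pint p (\<lambda>x. G x - grad \<phi> x))"
        by (rule Lp_diff(2)[OF p0 W(2) Lp_diff(1)[OF p0 W(2) T(2)]])
      also have "\<dots> \<le> 2 powr p * (pint p G + e)" using e12 by (intro mult_left_mono add_left_mono) auto
      finally show ?thesis by simp
    qed
    let ?w = "\<lambda>x. u x - \<phi> x"
    have 2: "pint p (\<lambda>x. ?w (h + x) - ?w x) \<le> 2 powr p * (e + e)"
    proof -
      have "pint p (\<lambda>x. ?w (h + x) - ?w x) \<le> 2 powr p * (pint p (\<lambda>x. ?w (h + x)) + pint p ?w)"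
        by (rule Lp_diff(2)[OF p0 Lp_shift(1)[OF L] L])
      also have "\<dots> \<le> 2 powr p * (e + e)" unfolding Lp_shift(2)[OF L] using e12 by (intro mult_left_mono add_mono) auto
      finally show ?thesis .
    qed
    have "pint p (\<lambda>x. (\<phi> (h + x) - \<phi> x) + (?w (h + x) - ?w x))
       \<le> 2 powr p * (pint p (\<lambda>x. \<phi> (h + x) - \<phi> x) + pint p (\<lambda>x. ?w (h + x) - ?w x))"
      by (rule Lp_add(2)[OF p0 Lp_diff(1)[OF p0 Lp_shift(1)[OF T(1)] T(1)] Lp_diff(1)[OF p0 Lp_shift(1)[OF L] L]])
    also have "\<dots> \<le> 2 powr p * (2 powr p * norm h powr p * pint p (grad \<phi>) + 2 powr p * (e + e))"
      by (intro mult_left_mono add_mono 2 test_functions_shift[OF p \<phi>(1)]) simp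
    also have "\<dots> \<le> ?b e" by (intro mult_left_mono add_right_mono g) auto
    finally show ?thesis by simp
  qed
  have "pint p (\<lambda>x. u (h + x) - u x) \<le> ?b 0"
  proof (rule tendsto_lowerbound)
    show "(?b \<longlongrightarrow> ?b 0) (at_right 0)" by (intro tendsto_intros)
    show "\<forall>\<^sub>F e in at_right 0. pint p (\<lambda>x. u (h + x) - u x) \<le> ?b e"
      unfolding eventually_at_right_field using bound by (intro exI[of _ 1]) simp
  qed simp
  also have "?b 0 = (2 * 2 * 2) powr p * norm h powr p * pint p G" unfolding powr_mult by simp
  finally show ?thesis by simp
qed

text \<open>On a cell with vanishing average, \<open>u x\<close> is the average of
  \<open>u x - u y\<close> over \<open>y\<close>. Writing \<open>y = x + h\<close> with
  \<open>norm h \<le> d\<close> reduces everything to the translation estimate. Of the shape of the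
  cells only measure and diameter enter; cells may overlap and may leave \<Omega>, where
  \<open>u\<close> is zero.\<close>

lemma poincare:
  fixes u :: "real^'n \<Rightarrow> real" and Q :: "'z \<Rightarrow> (real^'n) set"
  assumes p: "1 < p" and u: "(u, G) \<in> W0 p \<Omega>" and \<Omega>: "\<Omega> \<subseteq> (\<Union>z\<in>Z. Q z)"
    and Q: "\<And>z. z \<in> Z \<Longrightarrow> compact (Q z)" "\<And>z. z \<in> Z \<Longrightarrow> measure lebesgue (Q z) = m" "0 < m"
    and diam: "\<And>z x y. z \<in> Z \<Longrightarrow> x \<in> Q z \<Longrightarrow> y \<in> Q z \<Longrightarrow> norm (y - x) \<le> d" and d: "0 \<le> d"
    and avg: "\<And>z. z \<in> Z \<Longrightarrow> (\<integral>x. indicator (Q z) x * u x \<partial>lebesgue) = 0"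
  shows "pint p u \<le> (2 powr p / m) * (measure lborel (cball (0::real^'n) d) * (8 powr p * d powr p * pint p G))"
proof -
  have p0: "0 < p" using p by simp
  let ?K = "cball (0::real^'n) d" and ?c = "2 powr p / m"
  \<comment> \<open>A Borel representative is taken to have joint measurability in \<open>x\<close>
    and \<open>h\<close> for the exchange of integrals.\<close>
  obtain v where v: "v \<in> borel_measurable lborel" "AE x in lborel. u x = v x"
    using completion_ex_borel_measurable_real[OF LpD(1)[OF W0D(1)[OF u]]] by blast
  have vm[measurable]: "v \<in> borel_measurable borel" using v(1) by simp
  have ae: "AE x in lebesgue. u x = v x" by (rule AE_completion[OF v(2)])
  have vl: "v \<in> borel_measurable lebesgue" by (rule measurable_completion[OF v(1)])
  have Lv: "Lp p v"
  proof -
    have "integrable lebesgue (\<lambda>x. norm (v x) powr p)"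
    proof (rule integrable_cong_AE_imp[OF LpD(2)[OF W0D(1)[OF u]]])
      show "AE x in lebesgue. norm (u x) powr p = norm (v x) powr p" using ae by eventually_elim simp
    qed (use vl in measurable)
    then show ?thesis using vl by (simp add: Lp_def)
  qed
  have Km[measurable]: "?K \<in> sets borel" by simp
  define F where "F x h = indicator ?K h * ennreal (norm (v (h + x) - v x) powr p)" for x h
  have Fm: "case_prod F \<in> borel_measurable (lborel \<Otimes>\<^sub>M lborel)" unfolding F_def by measurable
  have shift: "pint p (\<lambda>x. v (h + x) - v x) \<le> 8 powr p * norm h powr p * pint p G" for h
  proof -
    have ae': "AE x in lborel. u (h + x) = v (h + x)"
    proof -
      from v(2) obtain N where N: "N \<in> null_sets lborel" "{x \<in> space lborel. u x \<noteq> v x} \<subseteq> N"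
        by (auto simp: eventually_ae_filter)
      have Nm[measurable]: "N \<in> sets borel" using N(1) by (auto simp: null_sets_def)
      have "AE x in lborel. x \<notin> N" by (rule AE_not_in[OF N(1)])
      then have "AE x in distr lborel borel ((+) h). x \<notin> N" by (subst lborel_distr_plus)
      then have "AE x in lborel. h + x \<notin> N" by (subst (asm) AE_distr_iff) auto
      then show ?thesis by eventually_elim (use N(2) in auto)
    qed
    have "pint p (\<lambda>x. v (h + x) - v x) = pint p (\<lambda>x. u (h + x) - u x)"
    proof (rule pint_cong_AE)
      show "AE x in lebesgue. v (h + x) - v x = u (h + x) - u x"
        using ae AE_completion[OF ae'] by eventually_elim simp
    qed (intro Lp_diff(1) p0 Lp_shift(1) Lv W0D(1)[OF u])+
    then show ?thesis using W0_shift[OF p u, of h] by simp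
  qed
  have pt: "ennreal (norm (v x) powr p) \<le> ennreal ?c * (\<integral>\<^sup>+h. F x h \<partial>lborel)" if x: "x \<in> \<Omega>" for x
  proof -
    obtain z where z: "z \<in> Z" "x \<in> Q z" using \<Omega> x by blast
    let ?q = "Q z"
    have qm: "?q \<in> sets borel" "?q \<in> sets lebesgue" using Q(1)[OF z(1)] by (auto simp: borel_compact)
    have qf: "emeasure lebesgue ?q < \<infinity>"
      using emeasure_bounded_finite[OF compact_imp_bounded[OF Q(1)[OF z(1)]]] qm by simp
    have iv: "integrable lebesgue (\<lambda>y. indicator ?q y * v y)"
      using Lp_integrable_compact(1)[OF p Lv Q(1)[OF z(1)] zero_less_one] by simp
    have ivp: "integrable lebesgue (\<lambda>y. indicator ?q y * norm (v y - v x) powr p)"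
    proof (rule Bochner_Integration.integrable_bound)
      show "integrable lebesgue (\<lambda>y. 2 powr p * (norm (v y) powr p + norm (- v x) powr p * indicator ?q y))"
        using qm qf by (intro integrable_mult_right Bochner_Integration.integrable_add LpD(2)[OF Lv] integrable_real_indicator) auto
      show "(\<lambda>y. indicator ?q y * norm (v y - v x) powr p) \<in> borel_measurable lebesgue"
        using qm vl by measurable
      show "AE y in lebesgue. norm (indicator ?q y * norm (v y - v x) powr p)
          \<le> norm (2 powr p * (norm (v y) powr p + norm (- v x) powr p * indicator ?q y))"
        using norm_add_powr2[OF p0, of _ "- v x"] by (intro AE_I2) (auto simp: indicator_def)
    qed
    have avg0: "(\<integral>y. indicator ?q y * v y \<partial>lebesgue) = 0"
    proof -
      have "(\<integral>y. indicator ?q y * v y \<partial>lebesgue) = (\<integral>y. indicator ?q y * u y \<partial>lebesgue)"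
      proof (rule integral_cong_AE)
        show "AE y in lebesgue. indicator ?q y * v y = indicator ?q y * u y" using ae by eventually_elim simp
        show "(\<lambda>y. indicator ?q y * u y) \<in> borel_measurable lebesgue"
          by (rule borel_measurable_times[OF borel_measurable_indicator[OF qm(2)] LpD(1)[OF W0D(1)[OF u]]])
      qed (use iv in simp)
      then show ?thesis using avg[OF z(1)] by simp
    qed
    have diff: "(\<integral>y. indicator ?q y * (v y - v x) \<partial>lebesgue) = - (m * v x)"
      using iv avg0 qm qf Q(2)[OF z(1)] by (simp add: right_diff_distrib integrable_real_indicator)
    have idiff: "integrable lebesgue (\<lambda>y. indicator ?q y * (v y - v x))"
      using iv qm qf by (simp add: right_diff_distrib integrable_real_indicator)
    have "\<bar>v x\<bar> powr p \<le> 2 powr p * ((\<integral>y. indicator ?q y * norm (v y - v x) powr p \<partial>lebesgue) / m)"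
    proof (rule weak_jensen[OF p abs_ge_zero])
      fix e :: real assume e: "0 < e"
      have "m * \<bar>v x\<bar> = \<bar>\<integral>y. indicator ?q y * (v y - v x) \<partial>lebesgue\<bar>" using Q(3) by (simp add: diff abs_mult)
      also have "\<dots> \<le> (\<integral>y. \<bar>indicator ?q y * (v y - v x)\<bar> \<partial>lebesgue)" by (rule integral_abs_bound)
      also have "\<dots> \<le> (\<integral>y. e * indicator ?q y + e powr (1 - p) * (indicator ?q y * norm (v y - v x) powr p) \<partial>lebesgue)"
      proof (rule integral_mono)
        show "integrable lebesgue (\<lambda>y. \<bar>indicator ?q y * (v y - v x)\<bar>)" using idiff by (rule integrable_abs)
        show "integrable lebesgue (\<lambda>y. e * indicator ?q y + e powr (1 - p) * (indicator ?q y * norm (v y - v x) powr p))"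
          using qm qf by (intro Bochner_Integration.integrable_add integrable_mult_right ivp integrable_real_indicator) auto
        show "\<bar>indicator ?q y * (v y - v x)\<bar> \<le> e * indicator ?q y + e powr (1 - p) * (indicator ?q y * norm (v y - v x) powr p)" for y
          using young_split[OF p e, of "\<bar>v y - v x\<bar>"] by (auto simp: indicator_def)
      qed
      also have "\<dots> = e * m + e powr (1 - p) * (\<integral>y. indicator ?q y * norm (v y - v x) powr p \<partial>lebesgue)"
        using qm qf ivp Q(2)[OF z(1)] by (simp add: integrable_real_indicator)
      finally show "\<bar>v x\<bar> \<le> e + e powr (1 - p) * ((\<integral>y. indicator ?q y * norm (v y - v x) powr p \<partial>lebesgue) / m)"
        using Q(3) by (simp add: field_simps)
    qed
    also have "\<dots> = ?c * (\<integral>y. indicator ?q y * norm (v y - v x) powr p \<partial>lebesgue)" by simp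
    finally have "ennreal (norm (v x) powr p) \<le> ennreal (?c * (\<integral>y. indicator ?q y * norm (v y - v x) powr p \<partial>lebesgue))"
      by (intro ennreal_leI) simp
    also have "\<dots> = ennreal ?c * ennreal (\<integral>y. indicator ?q y * norm (v y - v x) powr p \<partial>lebesgue)"
      by (rule ennreal_mult') (use Q(3) in simp)
    also have "ennreal (\<integral>y. indicator ?q y * norm (v y - v x) powr p \<partial>lebesgue)
      = (\<integral>\<^sup>+y. ennreal (indicator ?q y * norm (v y - v x) powr p) \<partial>lborel)"
      using nn_integral_eq_integral[OF ivp] by (simp add: nn_integral_completion)
    \<comment> \<open>The substitution \<open>y = x + h\<close> replaces the cell by the ball
      \<open>?K\<close>, which is the same for all \<open>x\<close>.\<close>
    also have "\<dots> \<le> (\<integral>\<^sup>+y. F x (- x + y) \<partial>lborel)"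
    proof (rule nn_integral_mono)
      fix y
      show "ennreal (indicator ?q y * norm (v y - v x) powr p) \<le> F x (- x + y)"
        using diam[OF z, of y] by (cases "y \<in> ?q") (auto simp: F_def indicator_def)
    qed
    also have "\<dots> = (\<integral>\<^sup>+h. F x h \<partial>lborel)"
    proof (rule nn_integral_lborel_translation)
      show "F x \<in> borel_measurable borel" unfolding F_def by measurable
    qed
    finally show ?thesis by (simp add: mult_left_mono)
  qed
  have aev: "AE x in lborel. ennreal (norm (v x) powr p) \<le> ennreal ?c * (\<integral>\<^sup>+h. F x h \<partial>lborel)"
    using v(2)
  proof eventually_elim
    case (elim x)
    show ?case
    proof (cases "x \<in> \<Omega>")
      case False
      then have "v x = 0" using W0D(3)[OF u] elim by simp
      then show ?thesis using p0 by simp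
    qed (rule pt)
  qed
  have "ennreal (pint p u) = ennreal (pint p v)" using pint_cong_AE[OF W0D(1)[OF u] Lv ae] by simp
  also have "\<dots> = (\<integral>\<^sup>+x. ennreal (norm (v x) powr p) \<partial>lborel)" by (rule nn_integral_pint[OF Lv, symmetric])
  also have "\<dots> \<le> (\<integral>\<^sup>+x. ennreal ?c * (\<integral>\<^sup>+h. F x h \<partial>lborel) \<partial>lborel)" by (rule nn_integral_mono_AE[OF aev])
  also have "\<dots> = ennreal ?c * (\<integral>\<^sup>+x. (\<integral>\<^sup>+h. F x h \<partial>lborel) \<partial>lborel)"
    by (intro nn_integral_cmult lborel.borel_measurable_nn_integral Fm)
  also have "(\<integral>\<^sup>+x. (\<integral>\<^sup>+h. F x h \<partial>lborel) \<partial>lborel) = (\<integral>\<^sup>+h. (\<integral>\<^sup>+x. F x h \<partial>lborel) \<partial>lborel)"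
    by (rule lborel_pair.Fubini'[OF Fm, symmetric])
  also have "\<dots> \<le> (\<integral>\<^sup>+h. ennreal (8 powr p * d powr p * pint p G) * indicator ?K h \<partial>lborel)"
  proof (rule nn_integral_mono)
    fix h
    have "(\<integral>\<^sup>+x. F x h \<partial>lborel) = indicator ?K h * (\<integral>\<^sup>+x. ennreal (norm (v (h + x) - v x) powr p) \<partial>lborel)"
      unfolding F_def by (rule nn_integral_cmult) measurable
    also have "(\<integral>\<^sup>+x. ennreal (norm (v (h + x) - v x) powr p) \<partial>lborel) = ennreal (pint p (\<lambda>x. v (h + x) - v x))"
      by (rule nn_integral_pint) (intro Lp_diff(1) p0 Lp_shift(1) Lv)
    also have "indicator ?K h * ennreal (pint p (\<lambda>x. v (h + x) - v x)) \<le> ennreal (8 powr p * d powr p * pint p G) * indicator ?K h"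
    proof (cases "h \<in> ?K")
      case True
      have "pint p (\<lambda>x. v (h + x) - v x) \<le> 8 powr p * norm h powr p * pint p G" by (rule shift)
      also have "\<dots> \<le> 8 powr p * d powr p * pint p G"
        using True p0 by (intro mult_right_mono mult_left_mono powr_mono2 pint_nonneg) auto
      finally show ?thesis using True by (simp add: ennreal_leI)
    qed simp
    finally show "(\<integral>\<^sup>+x. F x h \<partial>lborel) \<le> ennreal (8 powr p * d powr p * pint p G) * indicator ?K h" .
  qed
  also have "\<dots> = ennreal (8 powr p * d powr p * pint p G) * emeasure lborel ?K" by (simp add: nn_integral_cmult_indicator)
  also have "emeasure lborel ?K = ennreal (measure lborel ?K)"
    by (rule emeasure_eq_ennreal_measure) (use emeasure_bounded_finite[OF bounded_cball, of "0::real^'n" d] in auto)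
  finally have "ennreal (pint p u) \<le> ennreal ?c * (ennreal (8 powr p * d powr p * pint p G) * ennreal (measure lborel ?K))"
    by (simp add: mult_left_mono)
  also have "\<dots> = ennreal (?c * (8 powr p * d powr p * pint p G * measure lborel ?K))"
  proof -
    have "ennreal (8 powr p * d powr p * pint p G * measure lborel ?K)
        = ennreal (8 powr p * d powr p * pint p G) * ennreal (measure lborel ?K)"
      by (rule ennreal_mult) (auto intro!: mult_nonneg_nonneg pint_nonneg)
    moreover have "ennreal (?c * (8 powr p * d powr p * pint p G * measure lborel ?K))
        = ennreal ?c * ennreal (8 powr p * d powr p * pint p G * measure lborel ?K)"
      by (rule ennreal_mult') (use Q(3) in simp)
    ultimately show ?thesis by simp
  qed
  finally show ?thesis
    using Q(3) by (subst (asm) ennreal_le_iff) (auto simp: pint_nonneg mult_ac intro!: mult_nonneg_nonneg)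
qed

lemma Lp_integral_tendsto:
  assumes p: "1 < p" and Q: "compact Q" and f: "\<And>w. w \<in> S \<Longrightarrow> Lp p (f w)" and g: "Lp p g"
    and F: "eventually (\<lambda>w. w \<in> S) F"
    and lim: "((\<lambda>w. pint p (\<lambda>x. f w x - g x)) \<longlongrightarrow> 0) F"
  shows "((\<lambda>w. \<integral>x. indicator Q x * f w x \<partial>lebesgue) \<longlongrightarrow> (\<integral>x. indicator Q x * (g x :: real) \<partial>lebesgue)) F"
proof (rule tendstoI)
  fix e :: real assume e: "0 < e"
  have p0: "0 < p" using p by simp
  \<comment> \<open>The summand 1 keeps \<open>m\<close> positive when \<open>Q\<close> is a null
    set.\<close>
  define m where "m = measure lebesgue Q + 1"
  define d where "d = e / (2 * m)"
  have m: "0 < m" by (simp add: m_def add_nonneg_pos)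
  then have d: "0 < d" using e by (simp add: d_def)
  have "d * measure lebesgue Q \<le> d * m" using d by (simp add: m_def)
  also have "\<dots> = e / 2" using m by (simp add: d_def)
  finally have dm: "d * measure lebesgue Q \<le> e / 2" .
  have "((\<lambda>w. d powr (1 - p) * pint p (\<lambda>x. f w x - g x)) \<longlongrightarrow> 0) F" by (rule tendsto_mult_right_zero[OF lim])
  then have "eventually (\<lambda>w. d powr (1 - p) * pint p (\<lambda>x. f w x - g x) < e / 2) F"
    using e by (intro order_tendstoD(2)) auto
  with F show "\<forall>\<^sub>F w in F. dist (\<integral>x. indicator Q x * f w x \<partial>lebesgue) (\<integral>x. indicator Q x * g x \<partial>lebesgue) < e"
  proof eventually_elim
    case (elim w)
    note L = Lp_diff(1)[OF p0 f[OF elim(1)] g]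
    have i: "integrable lebesgue (\<lambda>x. indicator Q x * h x)" if "Lp p h" for h :: "real^'a \<Rightarrow> real"
      using Lp_integrable_compact(1)[OF p that Q d] by simp
    have "(\<integral>x. indicator Q x * f w x \<partial>lebesgue) - (\<integral>x. indicator Q x * g x \<partial>lebesgue)
        = (\<integral>x. indicator Q x * (f w x - g x) \<partial>lebesgue)"
      using i[OF f[OF elim(1)]] i[OF g] by (simp add: right_diff_distrib)
    also have "\<bar>\<dots>\<bar> \<le> (\<integral>x. \<bar>indicator Q x * (f w x - g x)\<bar> \<partial>lebesgue)" by (rule integral_abs_bound)
    also have "\<dots> = (\<integral>x. indicator Q x * norm (f w x - g x) \<partial>lebesgue)" by (simp add: abs_mult)
    also have "\<dots> \<le> d * measure lebesgue Q + d powr (1 - p) * pint p (\<lambda>x. f w x - g x)"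
      by (rule Lp_integrable_compact(2)[OF p L Q d])
    also have "\<dots> < e" using dm elim(2) by simp
    finally show ?case by (simp add: dist_real_def)
  qed
qed

definition ucube :: "(real^'n) set" where "ucube = box 0 (\<chi> i. 1)"

text \<open>Closed cells of side \<open>1 / n\<close>. Neighbours share faces, which is harmless
  because the Poincare estimate asks only for a cover.\<close>

definition gridcube :: "nat \<Rightarrow> ('n \<Rightarrow> nat) \<Rightarrow> (real^'n) set" where
  "gridcube n z = cbox (\<chi> i. real (z i) / real n) (\<chi> i. (real (z i) + 1) / real n)"

lemma measure_gridcube:
  assumes "1 \<le> n"
  shows "measure lebesgue (gridcube n z :: (real^'n) set) = (1 / real n) ^ CARD('n)"
proof -
  have "(\<chi> i. real (z i) / real n) \<in> (gridcube n z :: (real^'n) set)"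
    by (auto simp: gridcube_def mem_box_cart divide_right_mono)
  then have "(gridcube n z :: (real^'n) set) \<noteq> {}" by blast
  then have "measure lborel (gridcube n z :: (real^'n) set) = (\<Prod>i\<in>(UNIV::'n set). (real (z i) + 1) / real n - real (z i) / real n)"
    unfolding gridcube_def by (simp add: content_cbox_cart)
  also have "\<dots> = (1 / real n) ^ CARD('n)" by (simp flip: diff_divide_distrib)
  finally show ?thesis by (simp add: gridcube_def)
qed

lemma gridcube_diam:
  assumes "1 \<le> n" "x \<in> gridcube n z" "y \<in> gridcube n z"
  shows "norm (y - x :: real^'n) \<le> real CARD('n) / real n"
proof -
  have "\<bar>(y - x) $ i\<bar> \<le> 1 / real n" for i
  proof -
    have "real (z i) / real n \<le> x $ i" "x $ i \<le> (real (z i) + 1) / real n"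
      "real (z i) / real n \<le> y $ i" "y $ i \<le> (real (z i) + 1) / real n"
      using assms(2,3) by (auto simp: gridcube_def mem_box_cart)
    then show ?thesis by (simp add: add_divide_distrib abs_le_iff)
  qed
  then have "(\<Sum>i\<in>UNIV. \<bar>(y - x) $ i\<bar>) \<le> (\<Sum>i\<in>(UNIV::'n set). 1 / real n)" by (intro sum_mono)
  then show ?thesis using norm_le_l1_cart[of "y - x"] by simp
qed

lemma ucube_subset_gridcubes:
  assumes "1 \<le> n"
  shows "(ucube :: (real^'n) set) \<subseteq> (\<Union>z\<in>PiE UNIV (\<lambda>_. {..<n}). gridcube n z)"
proof
  fix x :: "real^'n" assume "x \<in> ucube"
  then have x: "0 < x $ i" "x $ i < 1" for i by (auto simp: ucube_def mem_box_cart)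
  have n: "real n > 0" using assms by simp
  define z where "z i = nat \<lfloor>real n * x $ i\<rfloor>" for i
  have z: "real (z i) \<le> real n * x $ i" "real n * x $ i < real (z i) + 1" for i
    using x(1)[of i] n by (auto simp: z_def)
  have "z i < n" for i
  proof -
    have "real n * x $ i < real n * 1" using x(2)[of i] n by (intro mult_strict_left_mono) auto
    then have "real (z i) < real n" using z(1)[of i] by linarith
    then show ?thesis by simp
  qed
  moreover have "x \<in> gridcube n z"
    using z n by (auto simp: gridcube_def mem_box_cart field_simps less_imp_le)
  ultimately show "x \<in> (\<Union>z\<in>PiE UNIV (\<lambda>_. {..<n}). gridcube n z)" by (intro UN_I[of z]) auto
qed

text \<open>
  The averages over the grid cells form an odd map from the sphere to \<open>n ^ CARD('n)\<close> dimensions,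
  which has a zero by the Borsuk--Ulam theorem.
\<close>

lemma adm_ucube_bound:
  fixes p :: real
  assumes p: "1 < p"
  shows "\<exists>c>0. \<forall>n k \<mu>. 1 \<le> n \<longrightarrow> n ^ CARD('n) < k \<longrightarrow> adm p (ucube :: (real^'n) set) k \<mu> \<longrightarrow> c * real n powr p \<le> \<mu>"
proof -
  let ?N = "CARD('n)"
  \<comment> \<open>The translation ball of radius \<open>CARD('n) / n\<close> has volume
    \<open>w / n ^ CARD('n)\<close>. Dividing by the volume of a cell cancels this power of
    \<open>n\<close>, so that only the factor from the diameter, of order \<open>n powr p\<close>,
    survives.\<close>
  define w where "w = unit_ball_vol (real ?N) * real ?N ^ ?N"
  have N: "0 < real ?N" by simp
  have w: "0 < w" by (simp add: w_def)
  define c where "c = 1 / (2 powr p * w * 8 powr p * real ?N powr p)"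
  have c: "0 < c" using w N by (simp add: c_def)
  have "c * real n powr p \<le> \<mu>" if n: "1 \<le> n" and k: "n ^ ?N < k" and a: "adm p (ucube :: (real^'n) set) k \<mu>" for n k \<mu>
  proof -
    have p0: "0 < p" using p by simp
    have n0: "real n > 0" using n by simp
    let ?Z = "PiE (UNIV :: 'n set) (\<lambda>_. {..<n})"
    let ?M = "n ^ ?N"
    have Z: "finite ?Z" "card ?Z = ?M" by (simp_all add: finite_PiE card_PiE)
    obtain e where e: "bij_betw e {0..<?M} ?Z" using ex_bij_betw_nat_finite[OF Z(1)] Z(2) by auto
    \<comment> \<open>To annihilate \<open>?M\<close> odd functions a sphere of dimension
      \<open>?M\<close> is needed, hence one coordinate more.\<close>
    have "adm p (ucube :: (real^'n) set) (Suc ?M) \<mu>" by (rule adm_mono[OF a]) (use k in auto)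
    then obtain H D where HD: "adm_map p (ucube :: (real^'n) set) (Suc ?M) \<mu> H D" by (auto simp: adm_def)
    let ?S = "topspace (nsphere ?M)"
    have S: "\<xi> \<in> espace (Suc ?M)" "sqn (Suc ?M) \<xi> = 1" if "\<xi> \<in> ?S" for \<xi>
      using that topspace_nsphere_eq[of "Suc ?M"] by auto
    note d = adm_mapD[OF HD S(1)]
    define f where "f i v = (\<integral>x. indicator (gridcube n (e i)) x * H v x \<partial>lebesgue)" for i v
    have cQ: "compact (gridcube n z :: (real^'n) set)" for z by (simp add: gridcube_def)
    have sub: "?S \<subseteq> espace (Suc ?M)" using S by blast
    have "\<exists>\<xi>\<in>?S. \<forall>i<?M. f i \<xi> = 0"
    proof (rule Borsuk_Ulam)
      fix i assume "i < ?M"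
      show "continuous_on ?S (f i)"
      proof (rule continuous_onI_nhds_in)
        fix v assume v: "v \<in> ?S"
        have l: "((\<lambda>w. Wdist p H D w v) \<longlongrightarrow> 0) (nhds_in ?S v)" by (rule tendsto_mono[OF nhds_in_mono[OF sub] d(5)[OF v]])
        have b: "((\<lambda>w. pint p (\<lambda>x. H w x - H v x)) \<longlongrightarrow> 0) (nhds_in ?S v)"
          by (rule tendsto_sandwich[OF _ _ tendsto_const l]) (auto simp: Wdist_def pint_nonneg)
        show "(f i \<longlongrightarrow> f i v) (nhds_in ?S v)"
          unfolding f_def by (rule Lp_integral_tendsto[OF p cQ W0D(1)[OF d(1)] W0D(1)[OF d(1)[OF v]] eventually_nhds_in_mem b])
      qed
      fix v assume v: "v \<in> ?S"
      note L = W0D(1)[OF adm_mapD(1)[OF HD espace_uminus[OF S(1)[OF v]]]] and L' = W0D(1)[OF d(1)[OF v]]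
      from AE_zero_if_pint_zero[OF Lp_add(1)[OF p0 L L'] d(4)[OF v]]
      have ae: "AE x in lebesgue. indicator (gridcube n (e i)) x * H (\<lambda>i. - v i) x = - (indicator (gridcube n (e i)) x * H v x)"
      proof eventually_elim
        case (elim x)
        then have "H (\<lambda>i. - v i) x = - H v x" by linarith
        then show ?case by simp
      qed
      have i: "integrable lebesgue (\<lambda>x. indicator (gridcube n (e i)) x * h x)" if "Lp p h" for h :: "real^'n \<Rightarrow> real"
        using Lp_integrable_compact(1)[OF p that cQ zero_less_one] by simp
      have "f i (\<lambda>j. - v j) = (\<integral>x. - (indicator (gridcube n (e i)) x * H v x) \<partial>lebesgue)"
        unfolding f_def
        by (rule integral_cong_AE[OF borel_measurable_integrable[OF i[OF L]] borel_measurable_uminus[OF borel_measurable_integrable[OF i[OF L']]] ae])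
      then show "f i (\<lambda>j. - v j) = - f i v" by (simp add: f_def)
    qed
    then obtain \<xi> where \<xi>: "\<xi> \<in> ?S" "\<forall>i<?M. f i \<xi> = 0" by (rule bexE)
    let ?d = "real ?N / real n" and ?m = "(1 / real n) ^ ?N"
    have avg: "(\<integral>x. indicator (gridcube n z) x * H \<xi> x \<partial>lebesgue) = 0" if "z \<in> ?Z" for z
    proof -
      from that have "z \<in> e ` {0..<?M}" using e by (simp only: bij_betw_def)
      then obtain i where i: "i < ?M" "z = e i" by auto
      from \<xi>(2) i(1) have "f i \<xi> = 0" by blast
      then show ?thesis unfolding f_def i(2) .
    qed
    have "pint p (H \<xi>) \<le> (2 powr p / ?m) * (measure lborel (cball (0::real^'n) ?d) * (8 powr p * ?d powr p * pint p (D \<xi>)))"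
      by (rule poincare[OF p d(1)[OF \<xi>(1)] ucube_subset_gridcubes[OF n] cQ measure_gridcube[OF n] _ gridcube_diam[OF n] _ avg])
         (use n0 in auto)
    also have "measure lborel (cball (0::real^'n) ?d) = unit_ball_vol (real ?N) * ?d ^ ?N"
      using content_cball[of ?d "0::real^'n"] by simp
    also have "(2 powr p / ?m) * (unit_ball_vol (real ?N) * ?d ^ ?N * (8 powr p * ?d powr p * pint p (D \<xi>)))
       = (2 powr p * w * 8 powr p * ?d powr p) * pint p (D \<xi>)"
      using n0 by (simp add: w_def power_divide field_simps)
    also have "\<dots> \<le> (2 powr p * w * 8 powr p * ?d powr p) * \<mu>"
      using d(3)[OF \<xi>(1)] S(2)[OF \<xi>(1)] w by (intro mult_left_mono) auto
    also have "?d powr p = real ?N powr p / real n powr p" by (rule powr_divide)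
    finally have "1 \<le> 2 powr p * w * 8 powr p * (real ?N powr p / real n powr p) * \<mu>"
      using d(2)[OF \<xi>(1)] S(2)[OF \<xi>(1)] by simp
    then show ?thesis using n0 w N by (simp add: c_def field_simps)
  qed
  then show ?thesis using c by blast
qed

section \<open>The counting function\<close>

definition cube :: "real^'n \<Rightarrow> real \<Rightarrow> (real^'n) set" where
  "cube a s = box a (\<chi> i. a $ i + s)"

lemma mem_cube: "x \<in> cube a s \<longleftrightarrow> (\<forall>i. a $ i < x $ i \<and> x $ i < a $ i + s)"
  by (simp add: cube_def mem_box_cart)

lemma open_cube: "open (cube a s)" unfolding cube_def by (rule open_box)

lemma bounded_cube: "bounded (cube a s)" by (simp add: cube_def)

lemma ucube_eq_cube: "ucube = cube 0 1" by (simp add: ucube_def cube_def)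

lemma cube_vimage:
  assumes "0 < r"
  shows "(\<lambda>x. b + r *\<^sub>R x) -` cube a s = cube ((1 / r) *\<^sub>R (a - b)) (s / r)"
proof -
  have "a $ i < b $ i + r * x $ i \<and> b $ i + r * x $ i < a $ i + s
     \<longleftrightarrow> (a $ i - b $ i) / r < x $ i \<and> x $ i < (a $ i - b $ i) / r + s / r" for x :: "real^'a" and i
    using assms by (simp add: field_simps add_divide_distrib[symmetric])
  then show ?thesis by (auto simp: mem_cube)
qed

text \<open>An affine map takes every cube to the unit cube, and homogeneity of the energy turns the
  side length into a factor of the level.\<close>

lemma adm_cube_iff:
  fixes a :: "real^'n"
  assumes p: "1 < p" and s: "0 < s"
  shows "adm p (cube a s) k \<mu> \<longleftrightarrow> adm p (ucube :: (real^'n) set) k (s powr p * \<mu>)"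
proof
  assume "adm p (cube a s) k \<mu>"
  from adm_affine[OF p s this, of a]
  show "adm p (ucube :: (real^'n) set) k (s powr p * \<mu>)" using s by (simp add: cube_vimage ucube_eq_cube)
next
  assume "adm p (ucube :: (real^'n) set) k (s powr p * \<mu>)"
  moreover have r: "0 < 1 / s" using s by simp
  ultimately have "adm p ((\<lambda>x. (- 1 / s) *\<^sub>R a + (1 / s) *\<^sub>R x) -` ucube) k ((1 / s) powr p * (s powr p * \<mu>))"
    using adm_affine[OF p] by blast
  moreover have "(\<lambda>x. (- 1 / s) *\<^sub>R a + (1 / s) *\<^sub>R x) -` ucube = cube a s"
    unfolding ucube_eq_cube cube_vimage[OF r] using s by simp
  ultimately show "adm p (cube a s) k \<mu>" using s by (simp add: powr_divide)
qed

text \<open>For bounded sets and \<open>1 < p\<close> the greatest element exists: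
  \<open>adm_zero\<close> provides a member and \<open>adm_bounded\<close> an upper bound.\<close>

definition cnt :: "real \<Rightarrow> (real^'n) set \<Rightarrow> real \<Rightarrow> nat" where
  "cnt p \<Omega> \<mu> = (GREATEST k. adm p \<Omega> k \<mu>)"

lemma bounded_subset_cube:
  fixes \<Omega> :: "(real^'n) set"
  assumes "bounded \<Omega>"
  obtains a s where "0 < s" "\<Omega> \<subseteq> cube a s"
proof -
  obtain B where B: "0 < B" "\<And>x. x \<in> \<Omega> \<Longrightarrow> norm x \<le> B" using assms bounded_pos by metis
  have "\<Omega> \<subseteq> cube (\<chi> i. - (B + 1)) (2 * (B + 1))"
  proof
    fix x assume x: "x \<in> \<Omega>"
    have "- (B + 1) < x $ i \<and> x $ i < - (B + 1) + 2 * (B + 1)" for i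
    proof -
      have "\<bar>x $ i\<bar> \<le> B" using B(2)[OF x] component_le_norm_cart[of x i] by simp
      then have "- B \<le> x $ i" "x $ i \<le> B" by (simp_all add: abs_le_iff)
      then show ?thesis by (simp add: algebra_simps)
    qed
    then show "x \<in> cube (\<chi> i. - (B + 1)) (2 * (B + 1))" unfolding mem_cube by simp
  qed
  then show ?thesis using that[of "2 * (B + 1)"] B(1) by simp
qed

text \<open>A bounded set lies in a cube. There \<open>adm_ucube_bound\<close> forces
  \<open>k \<le> n ^ CARD('n)\<close> as soon as \<open>c * n powr p\<close> exceeds the rescaled
  level.\<close>

lemma adm_bounded:
  fixes \<Omega> :: "(real^'n) set"
  assumes p: "1 < p" and b: "bounded \<Omega>"
  shows "\<exists>M. \<forall>k. adm p \<Omega> k \<mu> \<longrightarrow> k \<le> M"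
proof -
  obtain a :: "real^'n" and s where s: "0 < s" "\<Omega> \<subseteq> cube a s" by (rule bounded_subset_cube[OF b]) (rule that)
  obtain c where c: "0 < c" "\<And>n k \<mu>. 1 \<le> n \<Longrightarrow> n ^ CARD('n) < k \<Longrightarrow> adm p (ucube :: (real^'n) set) k \<mu> \<Longrightarrow> c * real n powr p \<le> \<mu>"
    using adm_ucube_bound[OF p, where 'n='n] by blast
  let ?\<mu> = "s powr p * \<mu>"
  obtain n :: nat where n: "(max 1 (?\<mu> / c + 1)) powr (1 / p) < real n" using reals_Archimedean2 by blast
  have n1: "1 \<le> n"
  proof -
    have "1 powr (1 / p) \<le> (max 1 (?\<mu> / c + 1)) powr (1 / p)" by (rule powr_mono2) (use p in auto)
    then have "1 < real n" using n by simp
    then show ?thesis by simp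
  qed
  have "((max 1 (?\<mu> / c + 1)) powr (1 / p)) powr p < real n powr p" by (rule powr_less_mono2) (use p n in auto)
  then have "?\<mu> / c + 1 < real n powr p" using p by (simp add: powr_powr)
  then have "?\<mu> / c < real n powr p" by linarith
  then have gt: "?\<mu> < c * real n powr p" using c(1) by (simp add: field_simps)
  have "k \<le> n ^ CARD('n)" if "adm p \<Omega> k \<mu>" for k
  proof (rule ccontr)
    assume "\<not> ?thesis"
    then have k: "n ^ CARD('n) < k" by simp
    have "adm p (cube a s) k \<mu>" by (rule adm_mono[OF that s(2)]) auto
    then have "adm p (ucube :: (real^'n) set) k ?\<mu>" using adm_cube_iff[OF p s(1)] by blast
    from c(2)[OF n1 k this] gt show False by simp
  qed
  then show ?thesis by blast
qed

lemma cnt_adm: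
  assumes "1 < p" "bounded \<Omega>"
  shows "adm p \<Omega> (cnt p \<Omega> \<mu>) \<mu>"
proof -
  obtain M where M: "\<forall>k. adm p \<Omega> k \<mu> \<longrightarrow> k \<le> M" using adm_bounded[OF assms, of \<mu>] by (rule exE)
  show ?thesis unfolding cnt_def
    by (rule GreatestI_nat[of "\<lambda>k. adm p \<Omega> k \<mu>" 0 M, OF adm_zero[OF assms(1)]]) (use M in simp)
qed

lemma adm_le_cnt:
  assumes "1 < p" "bounded \<Omega>" "adm p \<Omega> k \<mu>"
  shows "k \<le> cnt p \<Omega> \<mu>"
proof -
  obtain M where M: "\<forall>k. adm p \<Omega> k \<mu> \<longrightarrow> k \<le> M" using adm_bounded[OF assms(1,2), of \<mu>] by (rule exE)
  show ?thesis unfolding cnt_def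
    by (rule Greatest_le_nat[of "\<lambda>k. adm p \<Omega> k \<mu>" k M, OF assms(3)]) (use M in simp)
qed

lemma adm_iff_le_cnt:
  assumes "1 < p" "bounded \<Omega>"
  shows "adm p \<Omega> k \<mu> \<longleftrightarrow> k \<le> cnt p \<Omega> \<mu>"
  using adm_le_cnt[OF assms] adm_mono[OF cnt_adm[OF assms] order_refl order_refl] by blast

lemma cnt_mono:
  assumes "1 < p" "bounded \<Omega>'" "\<Omega> \<subseteq> \<Omega>'" "\<mu> \<le> \<mu>'"
  shows "cnt p \<Omega> \<mu> \<le> cnt p \<Omega>' \<mu>'"
  by (rule adm_le_cnt[OF assms(1,2) adm_mono[OF cnt_adm[OF assms(1) bounded_subset[OF assms(2,3)]] assms(3,4) order_refl]])

lemma cnt_cube: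
  fixes a :: "real^'n"
  assumes "1 < p" "0 < s"
  shows "cnt p (cube a s) \<mu> = cnt p (ucube :: (real^'n) set) (s powr p * \<mu>)"
  unfolding cnt_def adm_cube_iff[OF assms] ..

lemma cnt_superadditive:
  fixes \<Omega> :: "(real^'n) set"
  assumes p: "1 < p" and b: "bounded \<Omega>" and I: "finite I" and sub: "\<And>i. i \<in> I \<Longrightarrow> U i \<subseteq> \<Omega>"
    and disj: "\<And>i j. i \<in> I \<Longrightarrow> j \<in> I \<Longrightarrow> i \<noteq> j \<Longrightarrow> U i \<inter> U j = {}"
  shows "(\<Sum>i\<in>I. cnt p (U i) \<mu>) \<le> cnt p \<Omega> \<mu>"
proof -
  have "adm p (\<Union>i\<in>J. U i) (\<Sum>i\<in>J. cnt p (U i) \<mu>) \<mu>" if "J \<subseteq> I" for J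
    using finite_subset[OF that I] that
  proof (induction J rule: finite_induct)
    case empty
    show ?case using adm_zero[OF p] by simp
  next
    case (insert i J)
    have bi: "bounded (U i)" using bounded_subset[OF b sub] insert.prems by simp
    have "adm p (\<Union>i\<in>insert i J. U i) (cnt p (U i) \<mu> + (\<Sum>i\<in>J. cnt p (U i) \<mu>)) \<mu>"
    proof (rule adm_join[OF p cnt_adm[OF p bi] insert.IH])
      show "U i \<inter> (\<Union>i\<in>J. U i) = {}" using disj[of i] insert.prems insert.hyps by blast
    qed (use insert.prems in auto)
    then show ?case using insert.hyps by simp
  qed
  from this[OF order_refl] have "adm p \<Omega> (\<Sum>i\<in>I. cnt p (U i) \<mu>) \<mu>"
    by (rule adm_mono) (use sub in auto)
  then show ?thesis by (rule adm_le_cnt[OF p b])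
qed

text \<open>A multiplicative Fekete lemma whose limit is the supremum of \<open>f s / s ^ N\<close>.
  The assumed bound on \<open>f\<close> controls this quotient for large \<open>s\<close> only;
  since dilation by an integer does not decrease the quotient, \<open>grid\<close> carries the bound
  down to small \<open>s\<close>.\<close>

lemma asymptotic_from_superadditivity:
  fixes f :: "real \<Rightarrow> real"
  assumes mono: "\<And>s t. 0 < s \<Longrightarrow> s \<le> t \<Longrightarrow> f s \<le> f t"
    and grid: "\<And>m s. 1 \<le> m \<Longrightarrow> 0 < s \<Longrightarrow> real m ^ N * f s \<le> f (real m * s)"
    and bound: "\<And>s. 0 < s \<Longrightarrow> f s \<le> (c * s + 1) ^ N" and c: "0 < c"
    and nonneg: "\<And>s. 0 \<le> f s" and s1: "0 < s1" "0 < f s1"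
  shows "\<exists>L>0. ((\<lambda>s. f s / s ^ N) \<longlongrightarrow> L) at_top"
proof -
  let ?g = "\<lambda>s. f s / s ^ N"
  define L where "L = (SUP s\<in>{0<..}. ?g s)"
  have bdd: "?g s \<le> (c + 1) ^ N" if s: "0 < s" for s
  proof -
    obtain m :: nat where m: "1 / s < real m" using reals_Archimedean2 by blast
    then have "0 < real m" using s by (meson divide_pos_pos less_trans zero_less_one)
    then have m1: "1 \<le> m" "0 < real m" by auto
    have ms: "1 \<le> real m * s" using m s by (simp add: field_simps less_imp_le)
    have "real m ^ N * f s \<le> (c * (real m * s) + 1) ^ N"
      using grid[OF m1(1) s] bound[of "real m * s"] s m1 by (meson mult_pos_pos order_trans)
    also have "\<dots> \<le> ((c + 1) * (real m * s)) ^ N"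
      by (rule power_mono) (use ms c s m1 in \<open>auto simp: algebra_simps\<close>)
    also have "\<dots> = real m ^ N * ((c + 1) ^ N * s ^ N)" by (simp add: power_mult_distrib)
    finally have "f s \<le> (c + 1) ^ N * s ^ N" using m1(2) by simp
    then show ?thesis using s by (simp add: field_simps)
  qed
  have bddA: "bdd_above (?g ` {0<..})" using bdd by (intro bdd_aboveI2) auto
  have le: "?g s \<le> L" if "0 < s" for s unfolding L_def by (rule cSUP_upper[OF _ bddA]) (use that in auto)
  have "0 < ?g s1" using s1 by simp
  then have "0 < L" using le[OF s1(1)] by linarith
  moreover have "(?g \<longlongrightarrow> L) at_top"
  proof (rule order_tendstoI)
    fix a assume "L < a"
    show "\<forall>\<^sub>F s in at_top. ?g s < a"
      using eventually_gt_at_top[of 0] by eventually_elim (use le \<open>L < a\<close> in fastforce)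
  next
    fix a assume "a < L"
    then obtain s0 where s0: "0 < s0" "a < ?g s0"
      unfolding L_def using less_cSUP_iff[OF _ bddA, of a] by auto
    note f0 = nonneg[of s0]
    have lim: "((\<lambda>s. (1 - s0 / s) ^ N * ?g s0) \<longlongrightarrow> (1 - 0) ^ N * ?g s0) at_top"
      by (intro tendsto_intros tendsto_divide_0[OF tendsto_const] filterlim_at_top_imp_at_infinity filterlim_ident)
    then have ev: "\<forall>\<^sub>F s in at_top. a < (1 - s0 / s) ^ N * ?g s0"
      using s0(2) by (intro order_tendstoD(1)[OF lim]) simp
    show "\<forall>\<^sub>F s in at_top. a < ?g s"
      using ev eventually_ge_at_top[of s0]
    proof eventually_elim
      case (elim s)
      have s: "0 < s" using s0(1) elim(2) by linarith
      \<comment> \<open>As many multiples of \<open>s0\<close> as fit into \<open>s\<close>.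
        Rounding loses less than one of them, a factor \<open>(1 - s0 / s) ^ N\<close> that tends to
        1.\<close>
      define m where "m = nat \<lfloor>s / s0\<rfloor>"
      have q: "1 \<le> s / s0" using elim(2) s0(1) by simp
      have m: "real m \<le> s / s0" "s / s0 < real m + 1" "1 \<le> m" using q unfolding m_def by linarith+
      have "real m * s0 \<le> s" using m(1) s0(1) by (simp add: pos_le_divide_eq)
      then have "real m ^ N * f s0 \<le> f s"
        using grid[OF m(3) s0(1)] mono[of "real m * s0" s] m(3) s0(1) by (smt (verit) mult_pos_pos of_nat_0_less_iff less_le_trans zero_less_one)
      moreover have "(s / s0 - 1) ^ N * f s0 \<le> real m ^ N * f s0"
        using m(2) q f0 by (intro mult_right_mono power_mono) auto
      ultimately have "(s / s0 - 1) ^ N * f s0 \<le> f s" by linarith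
      then have "(s / s0 - 1) ^ N * f s0 / s ^ N \<le> ?g s" using s by (intro divide_right_mono) auto
      also have "(s / s0 - 1) ^ N * f s0 / s ^ N = (1 - s0 / s) ^ N * ?g s0"
      proof -
        have "(s / s0 - 1) = (1 - s0 / s) * (s / s0)" using s s0(1) by (simp add: field_simps)
        then have "(s / s0 - 1) ^ N = (1 - s0 / s) ^ N * (s ^ N / s0 ^ N)" by (simp only: power_mult_distrib power_divide)
        then show ?thesis using s by simp
      qed
      finally show ?case using elim(1) by linarith
    qed
  qed
  ultimately show ?thesis by blast
qed

section \<open>Asymptotics of the counting function and of the eigenvalues\<close>

text \<open>With the level written as \<open>s powr p\<close>, a cube of side \<open>r\<close> at
  parameter \<open>s\<close> counts like the unit cube at \<open>r * s\<close>. Cutting the unit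
  cube into equal cells is then precisely the hypothesis \<open>grid\<close>.\<close>

lemma cnt_ucube_asymptotic:
  assumes p: "1 < p"
  shows "\<exists>L>0. ((\<lambda>s. real (cnt p (ucube :: (real^'n) set) (s powr p)) / s ^ CARD('n)) \<longlongrightarrow> L) at_top"
proof -
  let ?N = "CARD('n)"
  define f where "f s = real (cnt p (ucube :: (real^'n) set) (s powr p))" for s
  have bu: "bounded (ucube :: (real^'n) set)" by (simp add: ucube_eq_cube bounded_cube)
  obtain c where c: "0 < c" "\<And>n k \<mu>. 1 \<le> n \<Longrightarrow> n ^ CARD('n) < k \<Longrightarrow> adm p (ucube :: (real^'n) set) k \<mu> \<Longrightarrow> c * real n powr p \<le> \<mu>"
    using adm_ucube_bound[OF p, where 'n='n] by blast
  have grid: "real m ^ ?N * f s \<le> f (real m * s)" if m: "1 \<le> m" and s: "0 < s" for m s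
  proof -
    let ?Z = "PiE (UNIV :: 'n set) (\<lambda>_. {..<m})"
    let ?U = "\<lambda>z. cube (\<chi> i. real (z i) / real m) (1 / real m) :: (real^'n) set"
    have m0: "0 < real m" using m by simp
    have "(\<Sum>z\<in>?Z. cnt p (?U z) ((real m * s) powr p)) \<le> cnt p (ucube :: (real^'n) set) ((real m * s) powr p)"
    proof (rule cnt_superadditive[OF p bu])
      show "finite ?Z" by (simp add: finite_PiE)
      show "?U z \<subseteq> ucube" if "z \<in> ?Z" for z
      proof
        fix x assume x: "x \<in> ?U z"
        have "0 < x $ i \<and> x $ i < 1" for i
        proof -
          have "z i < m" using that by auto
          then have "real (z i) + 1 \<le> real m" by simp
          then have "(real (z i) + 1) / real m \<le> 1" using m0 by simp
          moreover have "real (z i) / real m < x $ i" "x $ i < real (z i) / real m + 1 / real m"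
            using x by (auto simp: mem_cube)
          moreover have "0 \<le> real (z i) / real m" by simp
          ultimately show ?thesis unfolding add_divide_distrib by linarith
        qed
        then show "x \<in> ucube" by (simp add: ucube_eq_cube mem_cube)
      qed
      show "?U y \<inter> ?U z = {}" if "y \<in> ?Z" "z \<in> ?Z" "y \<noteq> z" for y z
      proof (rule ccontr)
        assume "?U y \<inter> ?U z \<noteq> {}"
        then obtain x where x: "x \<in> ?U y" "x \<in> ?U z" by blast
        have "y i = z i" for i
        proof -
          have "real (y i) / real m < x $ i" "x $ i < real (y i) / real m + 1 / real m"
            "real (z i) / real m < x $ i" "x $ i < real (z i) / real m + 1 / real m"
            using x by (auto simp: mem_cube)
          then have "real (y i) < real (z i) + 1" "real (z i) < real (y i) + 1"
            using m0 by (smt (verit) add_divide_distrib divide_le_cancel)+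
          then show ?thesis by linarith
        qed
        then show False using that(3) by blast
      qed
    qed
    moreover have "cnt p (?U z) ((real m * s) powr p) = cnt p (ucube :: (real^'n) set) (s powr p)" for z
    proof -
      have "(1 / real m) powr p * (real m * s) powr p = ((1 / real m) * (real m * s)) powr p" by (simp only: powr_mult)
      also have "\<dots> = s powr p" using m0 by simp
      finally have e: "(1 / real m) powr p * (real m * s) powr p = s powr p" .
      have "0 < 1 / real m" using m0 by simp
      then show ?thesis by (simp only: cnt_cube[OF p] e)
    qed
    moreover have "card ?Z = m ^ ?N" by (simp add: card_PiE)
    ultimately have "m ^ ?N * cnt p (ucube :: (real^'n) set) (s powr p) \<le> cnt p (ucube :: (real^'n) set) ((real m * s) powr p)"
      by simp
    then show ?thesis unfolding f_def by (metis of_nat_le_iff of_nat_mult of_nat_power)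
  qed
  have mono: "f s \<le> f t" if "0 < s" "s \<le> t" for s t
    unfolding f_def using cnt_mono[OF p bu order_refl powr_mono2[of p s t]] that p by simp
  \<comment> \<open>Chosen so that \<open>n > c' * s\<close> already gives
    \<open>c * n powr p > s powr p\<close>, beyond the reach of admissible maps of dimension above
    \<open>n ^ ?N\<close>.\<close>
  define c' where "c' = (1 / c) powr (1 / p)"
  have c': "0 < c'" "c' powr p = 1 / c" using c(1) p by (auto simp: c'_def powr_powr)
  have bound: "f s \<le> (c' * s + 1) ^ ?N" if s: "0 < s" for s
  proof -
    define n where "n = nat \<lfloor>c' * s\<rfloor> + 1"
    have cs: "0 < c' * s" using c'(1) s by simp
    then have n: "c' * s < real n" "real n \<le> c' * s + 1" "1 \<le> n" unfolding n_def by linarith+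
    have "s powr p = c * (c' * s) powr p" using c c' by (simp add: powr_mult)
    also have "\<dots> < c * real n powr p" using n(1) cs c(1) p by (intro mult_strict_left_mono powr_less_mono2) auto
    finally have lt: "s powr p < c * real n powr p" .
    have "cnt p (ucube :: (real^'n) set) (s powr p) \<le> n ^ ?N"
    proof (rule ccontr)
      assume "\<not> ?thesis"
      then have "n ^ ?N < cnt p (ucube :: (real^'n) set) (s powr p)" by simp
      from c(2)[OF n(3) this cnt_adm[OF p bu]] lt show False by simp
    qed
    then have "f s \<le> real n ^ ?N" unfolding f_def by (metis of_nat_le_iff of_nat_power)
    also have "\<dots> \<le> (c' * s + 1) ^ ?N" by (rule power_mono[OF n(2)]) simp
    finally show ?thesis .
  qed
  \<comment> \<open>One bump is admissible at some level, which makes the limit positive.\<close>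
  obtain \<mu> where \<mu>: "adm p (ucube :: (real^'n) set) 1 \<mu>"
  proof -
    let ?a = "(\<chi> i. 1 / 3) :: real^'n" and ?b = "(\<chi> i. 2 / 3) :: real^'n"
    have "cbox ?a ?b \<subseteq> ucube"
    proof
      fix x :: "real^'n" assume "x \<in> cbox ?a ?b"
      then have x: "1 / 3 \<le> x $ i" "x $ i \<le> 2 / 3" for i by (auto simp: mem_box_cart)
      have "0 < x $ i" "x $ i < 1" for i using x[of i] by linarith+
      then show "x \<in> ucube" by (simp add: ucube_eq_cube mem_cube)
    qed
    moreover have "(\<chi> i. 1 / 2) \<in> box ?a ?b" by (simp add: mem_box_cart)
    then have "box ?a ?b \<noteq> {}" by blast
    ultimately show ?thesis using adm_one[OF p] that by blast
  qed
  define s1 where "s1 = (max 1 \<mu>) powr (1 / p)"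
  have s1: "0 < s1" "s1 powr p = max 1 \<mu>" using p by (auto simp: s1_def powr_powr)
  have "adm p (ucube :: (real^'n) set) 1 (s1 powr p)" by (rule adm_mono[OF \<mu>]) (auto simp: s1)
  from adm_le_cnt[OF p bu this] have "0 < f s1" unfolding f_def by simp
  from asymptotic_from_superadditivity[OF mono grid bound c'(1) _ s1(1) this]
  show ?thesis unfolding f_def by simp
qed

text \<open>A compact \<open>K\<close> inside \<Omega> loses less measure than \<open>e\<close>.
  Lattice cells of small side that meet \<open>K\<close> cover it and stay in \<Omega>. The closed
  cells give the volume estimate, the open cubes are disjoint, and both have the same
  volume.\<close>

lemma inner_cubes:
  fixes \<Omega> :: "(real^'n) set"
  assumes \<Omega>: "open \<Omega>" "bounded \<Omega>" and e: "0 < e"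
  obtains \<delta> and Z :: "('n \<Rightarrow> int) set" and U where "0 < \<delta>" "finite Z" "\<And>z. z \<in> Z \<Longrightarrow> cube (U z) \<delta> \<subseteq> \<Omega>"
    "\<And>y z. y \<in> Z \<Longrightarrow> z \<in> Z \<Longrightarrow> y \<noteq> z \<Longrightarrow> cube (U y) \<delta> \<inter> cube (U z) \<delta> = {}"
    "measure lebesgue \<Omega> - e < real (card Z) * \<delta> ^ CARD('n)"
proof -
  have \<Omega>m: "\<Omega> \<in> lmeasurable" by (rule lmeasurable_open[OF \<Omega>(2,1)])
  obtain K where K: "closed K" "K \<subseteq> \<Omega>" "\<Omega> - K \<in> lmeasurable" "emeasure lebesgue (\<Omega> - K) < ennreal e"
    by (rule sets_lebesgue_inner_closed[of \<Omega> e]) (use \<Omega>m e in auto)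
  have Kc: "compact K" using K bounded_subset[OF \<Omega>(2) K(2)] by (simp add: compact_eq_bounded_closed)
  have Km: "K \<in> lmeasurable" by (rule lmeasurable_compact[OF Kc])
  have "measure lebesgue (\<Omega> - K) < e"
    using K(3,4) e by (simp add: emeasure_eq_measure2 ennreal_less_iff)
  moreover have "measure lebesgue (\<Omega> - K) = measure lebesgue \<Omega> - measure lebesgue K"
    by (rule measurable_measure_Diff[OF \<Omega>m _ K(2)]) (use Km in auto)
  ultimately have mK: "measure lebesgue \<Omega> - e < measure lebesgue K" by simp
  obtain d where d: "0 < d" "(\<Union>x\<in>K. ball x d) \<subseteq> \<Omega>"
    by (rule compact_subset_open_imp_ball_epsilon_subset[OF Kc \<Omega>(1) K(2)])
  \<comment> \<open>A cell has diameter at most \<open>CARD('n) * \<delta>\<close>; this must be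
    strictly below \<open>d\<close>, hence the additional 1.\<close>
  define \<delta> where "\<delta> = d / (real CARD('n) + 1)"
  have \<delta>: "0 < \<delta>" "real CARD('n) * \<delta> < d"
    using d(1) by (auto simp: \<delta>_def field_simps add_pos_pos)
  define U where "U z = (\<chi> i. \<delta> * of_int (z i))" for z :: "'n \<Rightarrow> int"
  define C where "C z = cbox (U z) (\<chi> i. U z $ i + \<delta>)" for z
  have mem_C: "x \<in> C z \<longleftrightarrow> (\<forall>i. \<delta> * of_int (z i) \<le> x $ i \<and> x $ i \<le> \<delta> * of_int (z i) + \<delta>)" for x z
    by (simp add: C_def U_def mem_box_cart)
  define Z where "Z = {z. C z \<inter> K \<noteq> {}}"
  obtain B where B: "\<And>x. x \<in> K \<Longrightarrow> norm x \<le> B" using compact_imp_bounded[OF Kc] by (auto simp: bounded_iff)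
  define M where "M = \<lceil>B / \<delta>\<rceil> + 1"
  have "Z \<subseteq> PiE UNIV (\<lambda>_. {- M..M})"
  proof
    fix z assume "z \<in> Z"
    then obtain x where x: "x \<in> C z" "x \<in> K" unfolding Z_def by blast
    have "- M \<le> z i \<and> z i \<le> M" for i
    proof -
      have xi: "\<bar>x $ i\<bar> \<le> B" using B[OF x(2)] component_le_norm_cart[of x i] by linarith
      have "\<delta> * of_int (z i) \<le> x $ i" "x $ i \<le> \<delta> * of_int (z i) + \<delta>" using x(1) by (auto simp: mem_C)
      then have "\<delta> * of_int (z i) \<le> B" "- B \<le> \<delta> * (of_int (z i) + 1)" using xi by (auto simp: distrib_left)
      then have "of_int (z i) \<le> B / \<delta>" "- (B / \<delta>) \<le> of_int (z i) + 1" using \<delta>(1) by (simp_all add: field_simps)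
      then show ?thesis unfolding M_def by linarith
    qed
    then show "z \<in> PiE UNIV (\<lambda>_. {- M..M})" by auto
  qed
  then have fin: "finite Z" by (rule finite_subset) (simp add: finite_PiE)
  have CO: "C z \<subseteq> \<Omega>" if z: "z \<in> Z" for z
  proof
    fix y assume y: "y \<in> C z"
    obtain x where x: "x \<in> C z" "x \<in> K" using z unfolding Z_def by blast
    have "\<bar>(y - x) $ i\<bar> \<le> \<delta>" for i
    proof -
      have "\<delta> * of_int (z i) \<le> x $ i" "x $ i \<le> \<delta> * of_int (z i) + \<delta>"
        "\<delta> * of_int (z i) \<le> y $ i" "y $ i \<le> \<delta> * of_int (z i) + \<delta>"
        using x(1) y unfolding mem_C by blast+
      then show ?thesis unfolding vector_minus_component abs_le_iff by (intro conjI) linarith+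
    qed
    then have "(\<Sum>i\<in>UNIV. \<bar>(y - x) $ i\<bar>) \<le> (\<Sum>i\<in>(UNIV::'n set). \<delta>)" by (intro sum_mono)
    then have "norm (y - x) < d" using norm_le_l1_cart[of "y - x"] \<delta>(2) by simp
    then have "y \<in> ball x d" by (simp add: dist_norm norm_minus_commute)
    then show "y \<in> \<Omega>" using d(2) x(2) by blast
  qed
  have "cube (U z) \<delta> \<subseteq> C z" for z unfolding cube_def C_def by (rule box_subset_cbox)
  then have sub: "cube (U z) \<delta> \<subseteq> \<Omega>" if "z \<in> Z" for z using CO[OF that] by blast
  have disj: "cube (U y) \<delta> \<inter> cube (U z) \<delta> = {}" if "y \<noteq> z" for y z
  proof (rule ccontr)
    assume "cube (U y) \<delta> \<inter> cube (U z) \<delta> \<noteq> {}"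
    then obtain x where x: "x \<in> cube (U y) \<delta>" "x \<in> cube (U z) \<delta>" by blast
    have "y i = z i" for i
    proof -
      have "\<delta> * of_int (y i) < x $ i" "x $ i < \<delta> * of_int (y i) + \<delta>"
        "\<delta> * of_int (z i) < x $ i" "x $ i < \<delta> * of_int (z i) + \<delta>"
        using x by (auto simp: mem_cube U_def)
      then have "\<delta> * of_int (y i) < \<delta> * (of_int (z i) + 1)" "\<delta> * of_int (z i) < \<delta> * (of_int (y i) + 1)"
        by (auto simp: distrib_left)
      then have "of_int (y i) < (of_int (z i) + 1 :: real)" "of_int (z i) < (of_int (y i) + 1 :: real)"
        using \<delta>(1) by simp_all
      then show ?thesis by linarith
    qed
    then show False using that by blast
  qed
  have cov: "K \<subseteq> (\<Union>z\<in>Z. C z)"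
  proof
    fix x assume x: "x \<in> K"
    define z where "z i = \<lfloor>x $ i / \<delta>\<rfloor>" for i
    have "of_int (z i) \<le> x $ i / \<delta>" "x $ i / \<delta> \<le> of_int (z i) + 1" for i unfolding z_def by linarith+
    then have "x \<in> C z" using \<delta>(1) by (simp add: mem_C field_simps)
    then show "x \<in> (\<Union>z\<in>Z. C z)" using x unfolding Z_def by blast
  qed
  have mC: "measure lebesgue (C z) = \<delta> ^ CARD('n)" for z
  proof -
    have "U z \<in> C z" using \<delta>(1) by (simp add: mem_C U_def)
    then have "C z \<noteq> {}" by blast
    then have "measure lborel (C z) = (\<Prod>i\<in>(UNIV::'n set). \<delta>)" unfolding C_def by (simp add: content_cbox_cart)
    then show ?thesis by (simp add: C_def)
  qed
  have "measure lebesgue K \<le> measure lebesgue (\<Union>z\<in>Z. C z)"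
    by (rule measure_mono_fmeasurable[OF cov]) (use Km fin in \<open>auto simp: C_def intro!: fmeasurable.finite_UN\<close>)
  also have "\<dots> \<le> (\<Sum>z\<in>Z. measure lebesgue (C z))"
    by (rule measure_UNION_le[OF fin]) (simp add: C_def)
  also have "\<dots> = real (card Z) * \<delta> ^ CARD('n)" by (simp add: mC)
  finally have "measure lebesgue \<Omega> - e < real (card Z) * \<delta> ^ CARD('n)" using mK by simp
  then show ?thesis using that[OF \<delta>(1) fin sub disj] by simp
qed

text \<open>Locally the boundary lies in the graph of \<open>\<gamma>\<close>, the image of a
  hyperplane under the Lipschitz map \<open>v + \<gamma> v *\<^sub>R e\<close>, and Lipschitz maps
  of the space preserve null sets.\<close>

lemma lipschitz_boundary_negligible:
  fixes \<Omega> :: "(real^'n) set"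
  assumes "open \<Omega>" "lipschitz_boundary \<Omega>"
  shows "negligible (frontier \<Omega>)"
proof (subst locally_negligible_alt, rule ballI)
  fix x assume x: "x \<in> frontier \<Omega>"
  from bspec[OF assms(2)[unfolded lipschitz_boundary_def] this]
  obtain r and e :: "real^'n" and \<gamma> L where r: "0 < r" and e: "norm e = 1" and lip: "L-lipschitz_on {v. v \<bullet> e = 0} \<gamma>"
    and eq: "\<Omega> \<inter> ball x r = {y \<in> ball x r. \<gamma> (y - (y \<bullet> e) *\<^sub>R e) < y \<bullet> e}"
    by (elim exE conjE) (rule that)
  let ?P = "\<lambda>y. y - (y \<bullet> e) *\<^sub>R e" and ?H = "{v. v \<bullet> e = 0}"
  have ee: "e \<bullet> e = 1" using e by (simp add: norm_eq_1)
  have P: "?P y \<in> ?H" for y by (simp add: inner_diff_left ee)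
  have cont: "continuous_on UNIV (\<lambda>y. \<gamma> (?P y))"
    by (rule continuous_on_compose2[OF lipschitz_on_continuous_on[OF lip]]) (use P in \<open>auto intro!: continuous_intros\<close>)
  \<comment> \<open>A boundary point is outside the open set \<Omega>, hence not strictly above the
    graph; strictly below it a whole neighbourhood would miss \<Omega>.\<close>
  have gr: "\<gamma> (?P y) = y \<bullet> e" if y: "y \<in> frontier \<Omega>" "y \<in> ball x r" for y
  proof (rule ccontr)
    assume "\<gamma> (?P y) \<noteq> y \<bullet> e"
    moreover have "y \<notin> \<Omega>" using y(1) assms(1) by (simp add: frontier_def interior_open)
    then have "\<not> \<gamma> (?P y) < y \<bullet> e" using eq y(2) by blast
    ultimately have gt: "y \<bullet> e < \<gamma> (?P y)" by simp
    let ?V = "{z. z \<bullet> e < \<gamma> (?P z)} \<inter> ball x r"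
    have "open {z. z \<bullet> e < \<gamma> (?P z)}" by (rule open_Collect_less[OF _ cont]) (intro continuous_intros)
    then have oV: "open ?V" by (intro open_Int open_ball)
    have "y \<in> ?V \<inter> closure \<Omega>" using gt y by (simp add: frontier_def)
    then have "?V \<inter> \<Omega> \<noteq> {}" using open_Int_closure_eq_empty[OF oV, of \<Omega>] by blast
    then obtain z where z: "z \<in> \<Omega>" "z \<in> ?V" by blast
    then have "z \<in> \<Omega> \<inter> ball x r" by blast
    then show False using z(2) unfolding eq by simp
  qed
  let ?g = "\<lambda>v. v + \<gamma> v *\<^sub>R e"
  have "e \<noteq> 0" using e by auto
  then have "negligible ?H" using negligible_hyperplane[of e 0] by (simp add: inner_commute)
  then have neg: "negligible (?g ` ?H)"
  proof (rule negligible_locally_Lipschitz_image[rotated])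
    fix v assume v: "v \<in> ?H"
    have "norm (?g w - ?g v) \<le> (1 + L) * norm (w - v)" if w: "w \<in> ?H" for w
    proof -
      have "norm (?g w - ?g v) = norm ((w - v) + (\<gamma> w - \<gamma> v) *\<^sub>R e)" by (simp add: algebra_simps)
      also have "\<dots> \<le> norm (w - v) + norm ((\<gamma> w - \<gamma> v) *\<^sub>R e)" by (rule norm_triangle_ineq)
      also have "norm ((\<gamma> w - \<gamma> v) *\<^sub>R e) = dist (\<gamma> w) (\<gamma> v)" using e by (simp add: dist_real_def)
      also have "\<dots> \<le> L * dist w v" by (rule lipschitz_onD[OF lip w v])
      finally show ?thesis by (simp add: dist_norm distrib_right)
    qed
    then show "\<exists>T B. open T \<and> v \<in> T \<and> (\<forall>w\<in>?H \<inter> T. norm (?g w - ?g v) \<le> B * norm (w - v))"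
      by (intro exI[of _ UNIV] exI[of _ "1 + L"]) auto
  qed simp
  have "frontier \<Omega> \<inter> ball x r \<subseteq> ?g ` ?H"
  proof
    fix y assume y: "y \<in> frontier \<Omega> \<inter> ball x r"
    then have "y = ?g (?P y)" using gr[of y] by simp
    then show "y \<in> ?g ` ?H" using P by blast
  qed
  then have "negligible (frontier \<Omega> \<inter> ball x r)" by (rule negligible_subset[OF neg])
  moreover have "openin (top_of_set (frontier \<Omega>)) (frontier \<Omega> \<inter> ball x r)" by (rule openin_open_Int) simp
  ultimately show "\<exists>U. openin (top_of_set (frontier \<Omega>)) U \<and> x \<in> U \<and> negligible U" using x r by (intro exI[of _ "frontier \<Omega> \<inter> ball x r"]) auto
qed

text \<open>Each of the disjoint cubes of side \<delta> contributes asymptotically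
  \<open>L * \<delta> ^ CARD('n)\<close>, and their total volume is as close to that of \<Omega> as
  desired.\<close>

lemma cnt_lower:
  fixes \<Omega> :: "(real^'n) set"
  assumes p: "1 < p" and \<Omega>: "open \<Omega>" "bounded \<Omega>"
    and L: "0 < L" "((\<lambda>s. real (cnt p (ucube :: (real^'n) set) (s powr p)) / s ^ CARD('n)) \<longlongrightarrow> L) at_top"
    and a: "a < L * measure lebesgue \<Omega>"
  shows "\<forall>\<^sub>F t in at_top. a < real (cnt p \<Omega> (t powr p)) / t ^ CARD('n)"
proof -
  let ?N = "CARD('n)" and ?m = "measure lebesgue \<Omega>"
  define F where "F s = real (cnt p (ucube :: (real^'n) set) (s powr p)) / s ^ ?N" for s
  define e where "e = (?m - a / L) / 2"
  have aL: "a / L < ?m" using a L(1) by (simp add: pos_divide_less_eq mult.commute)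
  then have e: "0 < e" by (simp add: e_def)
  have half: "x < y - (y - x) / 2" if "x < y" for x y :: real using that by (simp add: field_simps)
  have eL: "a / L < ?m - e" unfolding e_def by (rule half[OF aL])
  obtain \<delta> and Z :: "('n \<Rightarrow> int) set" and U where \<delta>: "0 < \<delta>" and Z: "finite Z"
    and sub: "\<And>z. z \<in> Z \<Longrightarrow> cube (U z) \<delta> \<subseteq> \<Omega>"
    and disj: "\<And>y z. y \<in> Z \<Longrightarrow> z \<in> Z \<Longrightarrow> y \<noteq> z \<Longrightarrow> cube (U y) \<delta> \<inter> cube (U z) \<delta> = {}"
    and m: "?m - e < real (card Z) * \<delta> ^ ?N"
    by (rule inner_cubes[OF \<Omega> e]) (rule that)
  have "a < L * (?m - e)" using eL L(1) by (simp add: pos_divide_less_eq mult.commute)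
  also have "\<dots> < L * (real (card Z) * \<delta> ^ ?N)" using m L(1) by simp
  finally have lt: "a < real (card Z) * \<delta> ^ ?N * L" by (simp add: mult_ac)
  have "filterlim (\<lambda>t. \<delta> * t) at_top at_top"
    by (rule filterlim_tendsto_pos_mult_at_top[OF tendsto_const \<delta> filterlim_ident])
  then have "((\<lambda>t. F (\<delta> * t)) \<longlongrightarrow> L) at_top"
    using filterlim_compose[OF L(2)[folded F_def]] by blast
  then have "((\<lambda>t. real (card Z) * \<delta> ^ ?N * F (\<delta> * t)) \<longlongrightarrow> real (card Z) * \<delta> ^ ?N * L) at_top"
    by (rule tendsto_mult[OF tendsto_const])
  from order_tendstoD(1)[OF this lt] eventually_gt_at_top[of 0] show ?thesis
  proof eventually_elim
    case (elim t)
    have "(\<Sum>z\<in>Z. cnt p (cube (U z) \<delta>) (t powr p)) \<le> cnt p \<Omega> (t powr p)"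
      by (rule cnt_superadditive[OF p \<Omega>(2) Z sub disj])
    moreover have "cnt p (cube (U z) \<delta>) (t powr p) = cnt p (ucube :: (real^'n) set) ((\<delta> * t) powr p)" for z
      unfolding cnt_cube[OF p \<delta>] powr_mult ..
    ultimately have "card Z * cnt p (ucube :: (real^'n) set) ((\<delta> * t) powr p) \<le> cnt p \<Omega> (t powr p)" by simp
    then have "real (card Z) * real (cnt p (ucube :: (real^'n) set) ((\<delta> * t) powr p)) \<le> real (cnt p \<Omega> (t powr p))"
      by (metis of_nat_le_iff of_nat_mult)
    then have "real (card Z) * real (cnt p (ucube :: (real^'n) set) ((\<delta> * t) powr p)) / t ^ ?N \<le> real (cnt p \<Omega> (t powr p)) / t ^ ?N"
      by (rule divide_right_mono) (use elim(2) in simp)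
    moreover have "real (card Z) * \<delta> ^ ?N * F (\<delta> * t) = real (card Z) * real (cnt p (ucube :: (real^'n) set) ((\<delta> * t) powr p)) / t ^ ?N"
      using \<delta> elim(2) by (simp add: F_def power_mult_distrib)
    ultimately show ?case using elim(1) by linarith
  qed
qed

lemma measure_cube:
  fixes a :: "real^'n"
  assumes "0 < s"
  shows "measure lebesgue (cube a s) = s ^ CARD('n)"
proof -
  have "a \<in> cbox a (\<chi> i. a $ i + s)" using assms by (simp add: mem_box_cart)
  then have "cbox a (\<chi> i. a $ i + s) \<noteq> {}" by blast
  then have "measure lborel (cbox a (\<chi> i. a $ i + s)) = (\<Prod>i\<in>(UNIV::'n set). s)" by (simp add: content_cbox_cart)
  then show ?thesis by (simp add: cube_def measure_lborel_box_eq measure_lborel_cbox_eq)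
qed

text \<open>\<Omega> and \<open>R\<close> are disjoint and fill a cube up to a null set. The count
  of the cube is asymptotically exact, and \<open>R\<close>, being open and bounded, takes at least
  its share by \<open>cnt_lower\<close>; the rest is an upper bound for \<Omega>.\<close>

lemma cnt_upper:
  fixes \<Omega> :: "(real^'n) set"
  assumes p: "1 < p" and \<Omega>: "open \<Omega>" "bounded \<Omega>" "negligible (frontier \<Omega>)"
    and L: "0 < L" "((\<lambda>s. real (cnt p (ucube :: (real^'n) set) (s powr p)) / s ^ CARD('n)) \<longlongrightarrow> L) at_top"
    and a: "L * measure lebesgue \<Omega> < a"
  shows "\<forall>\<^sub>F t in at_top. real (cnt p \<Omega> (t powr p)) / t ^ CARD('n) < a"
proof -
  let ?N = "CARD('n)" and ?m = "measure lebesgue \<Omega>"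
  define F where "F s = real (cnt p (ucube :: (real^'n) set) (s powr p)) / s ^ ?N" for s
  obtain q :: "real^'n" and s where s: "0 < s" and q: "\<Omega> \<subseteq> cube q s" by (rule bounded_subset_cube[OF \<Omega>(2)]) (rule that)
  define R where "R = cube q s - closure \<Omega>"
  have R: "open R" "bounded R" unfolding R_def by (intro open_Diff open_cube closed_closure) (rule bounded_subset[OF bounded_cube], blast)
  have \<Omega>m: "\<Omega> \<in> lmeasurable" by (rule lmeasurable_open[OF \<Omega>(2,1)])
  have Rm: "R \<in> lmeasurable" by (rule lmeasurable_open[OF R(2,1)])
  have mR: "measure lebesgue R = s ^ ?N - ?m"
  proof -
    have "measure lebesgue (cube q s) = measure lebesgue (\<Omega> \<union> R)"
    proof (rule measure_negligible_symdiff[OF _ negligible_subset[OF \<Omega>(3)]])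
      show "\<Omega> \<union> R \<in> lmeasurable" by (rule fmeasurable.Un[OF \<Omega>m Rm])
      show "(\<Omega> \<union> R - cube q s) \<union> (cube q s - (\<Omega> \<union> R)) \<subseteq> frontier \<Omega>"
        using q interior_open[OF \<Omega>(1)] by (auto simp: R_def frontier_def)
    qed
    also have "\<dots> = ?m + measure lebesgue R"
      by (rule measure_Union)
         (use \<Omega>m Rm closure_subset[of \<Omega>] in \<open>auto simp: fmeasurable_def R_def\<close>)
    finally show ?thesis by (simp add: measure_cube[OF s])
  qed
  \<comment> \<open>Half of the slack is spent on the cube, the other half on
    \<open>R\<close>.\<close>
  define e where "e = (a - L * ?m) / 2"
  have e: "0 < e" using a by (simp add: e_def)
  have "filterlim (\<lambda>t. s * t) at_top at_top"
    by (rule filterlim_tendsto_pos_mult_at_top[OF tendsto_const s filterlim_ident])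
  then have "((\<lambda>t. F (s * t)) \<longlongrightarrow> L) at_top"
    using filterlim_compose[OF L(2)[folded F_def]] by blast
  then have "((\<lambda>t. s ^ ?N * F (s * t)) \<longlongrightarrow> s ^ ?N * L) at_top"
    by (rule tendsto_mult[OF tendsto_const])
  then have ev1: "\<forall>\<^sub>F t in at_top. s ^ ?N * F (s * t) < s ^ ?N * L + e"
    by (rule order_tendstoD(2)) (use e in simp)
  have ev2: "\<forall>\<^sub>F t in at_top. L * measure lebesgue R - e < real (cnt p R (t powr p)) / t ^ ?N"
    by (rule cnt_lower[OF p R L]) (use e in simp)
  from ev1 ev2 eventually_gt_at_top[of 0] show ?thesis
  proof eventually_elim
    case (elim t)
    let ?U = "\<lambda>b. if b then \<Omega> else R"
    have "(\<Sum>b\<in>UNIV. cnt p (?U b) (t powr p)) \<le> cnt p (cube q s) (t powr p)"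
    proof (rule cnt_superadditive[OF p bounded_cube])
      show "?U b \<subseteq> cube q s" for b using q by (simp add: R_def)
      show "?U b \<inter> ?U c = {}" if "b \<noteq> c" for b c
        using that closure_subset[of \<Omega>] by (cases b; cases c) (auto simp: R_def)
    qed simp
    then have "cnt p \<Omega> (t powr p) + cnt p R (t powr p) \<le> cnt p (cube q s) (t powr p)" by (simp add: UNIV_bool)
    also have "\<dots> = cnt p (ucube :: (real^'n) set) ((s * t) powr p)"
      unfolding cnt_cube[OF p s] powr_mult ..
    finally have "real (cnt p \<Omega> (t powr p)) + real (cnt p R (t powr p)) \<le> real (cnt p (ucube :: (real^'n) set) ((s * t) powr p))"
      by (metis of_nat_add of_nat_le_iff)
    then have "(real (cnt p \<Omega> (t powr p)) + real (cnt p R (t powr p))) / t ^ ?N \<le> real (cnt p (ucube :: (real^'n) set) ((s * t) powr p)) / t ^ ?N"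
      by (rule divide_right_mono) (use elim(3) in simp)
    also have "\<dots> = s ^ ?N * F (s * t)" using s elim(3) by (simp add: F_def power_mult_distrib)
    finally have "real (cnt p \<Omega> (t powr p)) / t ^ ?N + real (cnt p R (t powr p)) / t ^ ?N \<le> s ^ ?N * F (s * t)"
      by (simp add: add_divide_distrib)
    moreover have "L * measure lebesgue R = s ^ ?N * L - L * ?m" unfolding mR by (simp add: algebra_simps)
    moreover have "e + e = a - L * ?m" by (simp add: e_def)
    ultimately show ?case using elim(1,2) by linarith
  qed
qed

text \<open>The substitution makes \<open>t powr p\<close> the level
  \<open>m * k powr (p / N)\<close>, while \<open>t ^ N\<close> becomes a constant multiple of
  \<open>k\<close>.\<close>

lemma cnt_sequence:
  fixes \<Omega> :: "(real^'n) set"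
  assumes p: "1 < p" and m: "0 < m"
    and W: "((\<lambda>t. real (cnt p \<Omega> (t powr p)) / t ^ CARD('n)) \<longlongrightarrow> W) at_top"
  shows "(\<lambda>k. real (cnt p \<Omega> (m * real k powr (p / real CARD('n)))) / real k) \<longlonglongrightarrow> W * m powr (real CARD('n) / p)"
proof -
  let ?N = "real CARD('n)"
  have N: "0 < ?N" by simp
  define t where "t k = m powr (1 / p) * real k powr (1 / ?N)" for k
  have tp: "t k powr p = m * real k powr (p / ?N)" for k
    using m p by (simp add: t_def powr_mult powr_powr)
  have tN: "t k ^ CARD('n) = m powr (?N / p) * real k" if "0 < k" for k
  proof -
    have "t k ^ CARD('n) = t k powr ?N" using that m by (simp add: t_def powr_realpow)
    also have "\<dots> = m powr (?N / p) * real k" using that by (simp add: t_def powr_mult powr_powr)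
    finally show ?thesis .
  qed
  have "filterlim (\<lambda>k. real k powr (1 / ?N)) at_top sequentially"
    unfolding filterlim_at_top
  proof
    fix Z :: real
    have "\<forall>\<^sub>F k in sequentially. (max 1 Z) powr ?N \<le> real k"
      using filterlim_real_sequentially unfolding filterlim_at_top by blast
    then show "\<forall>\<^sub>F k in sequentially. Z \<le> real k powr (1 / ?N)"
    proof eventually_elim
      case (elim k)
      have "((max 1 Z) powr ?N) powr (1 / ?N) \<le> real k powr (1 / ?N)" by (rule powr_mono2) (use elim in auto)
      moreover have "((max 1 Z) powr ?N) powr (1 / ?N) = max 1 Z" by (simp add: powr_powr)
      ultimately show ?case by simp
    qed
  qed
  then have "filterlim t at_top sequentially"
    unfolding t_def by (rule filterlim_tendsto_pos_mult_at_top[OF tendsto_const, rotated]) (use m in simp)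
  from filterlim_compose[OF W this]
  have "(\<lambda>k. real (cnt p \<Omega> (t k powr p)) / t k ^ CARD('n) * m powr (?N / p)) \<longlonglongrightarrow> W * m powr (?N / p)"
    by (rule tendsto_mult[OF _ tendsto_const])
  then show ?thesis
  proof (rule Lim_transform_eventually)
    show "\<forall>\<^sub>F k in sequentially. real (cnt p \<Omega> (t k powr p)) / t k ^ CARD('n) * m powr (?N / p)
        = real (cnt p \<Omega> (m * real k powr (p / ?N))) / real k"
      using eventually_gt_at_top[of 0]
    proof eventually_elim
      case (elim k)
      have "m powr (?N / p) \<noteq> 0" using m by simp
      then show ?case unfolding tN[OF elim] tp by simp
    qed
  qed
qed

section \<open>From the counting function back to the eigenvalues\<close>

lemma cogenus_eigenvalue_le:
  fixes \<Omega> :: "(real^'n) set"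
  assumes p: "1 < p" and \<Omega>: "open \<Omega>" and k: "1 \<le> k" and a: "adm p \<Omega> k \<mu>"
  shows "cogenus_eigenvalue p \<Omega> k \<le> \<mu>"
proof -
  let ?S = "topspace (nsphere (k - 1))"
  let ?E = "\<lambda>h. SUP u\<in>h ` ?S. dirichlet_energy p \<Omega> u"
  obtain \<xi>0 where \<xi>0: "\<xi>0 \<in> ?S" using in_topspace_nsphere by blast
  obtain h where h: "h \<in> odd_maps p \<Omega> k" "\<And>\<xi>. \<xi> \<in> ?S \<Longrightarrow> dirichlet_energy p \<Omega> (h \<xi>) \<le> \<mu>"
    using adm_imp_odd_map[OF p \<Omega> k a] by blast
  \<comment> \<open>An infimum of reals lies below its members only if the set is bounded below;
    nonnegative energies provide this.\<close>
  have nonneg: "0 \<le> ?E g" if "g \<in> odd_maps p \<Omega> k" for g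
  proof -
    have "0 \<le> dirichlet_energy p \<Omega> (g \<xi>0)" by (simp add: dirichlet_energy_def)
    also have "\<dots> \<le> ?E g" by (rule cSUP_upper[OF imageI[OF \<xi>0] odd_map_energy_bounded[OF p \<Omega> that]])
    finally show ?thesis .
  qed
  have "cogenus_eigenvalue p \<Omega> k \<le> ?E h"
    unfolding cogenus_eigenvalue_def by (rule cINF_lower[OF bdd_belowI2[OF nonneg] h(1)])
  also have "\<dots> \<le> \<mu>" by (rule cSUP_least) (use \<xi>0 h(2) in auto)
  finally show ?thesis .
qed

text \<open>An odd map with supremum below \<mu> would make \<open>k\<close> admissible at \<mu>.
  Admissibility at some level \<nu> guarantees that odd maps exist, so that the infimum is taken
  over a nonempty set.\<close>

lemma cogenus_eigenvalue_ge:
  fixes \<Omega> :: "(real^'n) set"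
  assumes p: "1 < p" and \<Omega>: "open \<Omega>" and k: "1 \<le> k" and a: "\<not> adm p \<Omega> k \<mu>" and b: "adm p \<Omega> k \<nu>"
  shows "\<mu> \<le> cogenus_eigenvalue p \<Omega> k"
  unfolding cogenus_eigenvalue_def
proof (rule cINF_greatest)
  show "odd_maps p \<Omega> k \<noteq> {}" using adm_imp_odd_map[OF p \<Omega> k b] by blast
  let ?S = "topspace (nsphere (k - 1))"
  fix h assume h: "h \<in> odd_maps p \<Omega> k"
  show "\<mu> \<le> (SUP u\<in>h ` ?S. dirichlet_energy p \<Omega> u)"
  proof (rule ccontr)
    assume "\<not> ?thesis"
    then have lt: "(SUP u\<in>h ` ?S. dirichlet_energy p \<Omega> u) < \<mu>" by simp
    have "adm p \<Omega> k \<mu>"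
    proof (rule odd_map_imp_adm[OF p \<Omega> k h])
      fix \<xi> assume "\<xi> \<in> ?S"
      then have "dirichlet_energy p \<Omega> (h \<xi>) \<le> (SUP u\<in>h ` ?S. dirichlet_energy p \<Omega> u)"
        by (intro cSUP_upper[OF imageI odd_map_energy_bounded[OF p \<Omega> h]])
      then show "dirichlet_energy p \<Omega> (h \<xi>) \<le> \<mu>" using lt by simp
    qed
    then show False using a by simp
  qed
qed

text \<open>At level \<open>b * k powr (p / N)\<close> the count is asymptotic to
  \<open>W * b powr (N / p) * k\<close>. It is eventually above or below \<open>k\<close> according
  as \<open>b\<close> is above or below \<Lambda>, the root of
  \<open>W * \<Lambda> powr (N / p) = 1\<close>.\<close>

lemma cogenus_eigenvalue_limit:
  fixes \<Omega> :: "(real^'n) set"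
  assumes p: "1 < p" and \<Omega>: "open \<Omega>" "bounded \<Omega>"
    and W: "0 < W" "((\<lambda>t. real (cnt p \<Omega> (t powr p)) / t ^ CARD('n)) \<longlongrightarrow> W) at_top"
  shows "(\<lambda>k. cogenus_eigenvalue p \<Omega> k / real k powr (p / real CARD('n))) \<longlonglongrightarrow> W powr (- p / real CARD('n))"
proof -
  let ?N = "real CARD('n)"
  define \<Lambda> where "\<Lambda> = W powr (- p / ?N)"
  have \<Lambda>: "0 < \<Lambda>" using W(1) by (simp add: \<Lambda>_def)
  have W\<Lambda>: "W * \<Lambda> powr (?N / p) = 1"
  proof -
    have "- p / ?N * (?N / p) = - 1" using p by simp
    then have "\<Lambda> powr (?N / p) = W powr (- 1)" by (simp only: \<Lambda>_def powr_powr)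
    then show ?thesis using W(1) by (simp add: powr_minus)
  qed
  have ev_adm: "\<forall>\<^sub>F k in sequentially. adm p \<Omega> k (b * real k powr (p / ?N))" if b: "\<Lambda> < b" for b
  proof -
    have "\<Lambda> powr (?N / p) < b powr (?N / p)" by (rule powr_less_mono2) (use b \<Lambda> p in auto)
    then have "1 < W * b powr (?N / p)" using W\<Lambda> W(1) by (metis mult_less_cancel_left_pos)
    from order_tendstoD(1)[OF cnt_sequence[OF p _ W(2), of b] this] b \<Lambda>
    have "\<forall>\<^sub>F k in sequentially. 1 < real (cnt p \<Omega> (b * real k powr (p / ?N))) / real k" by simp
    then show ?thesis using eventually_gt_at_top[of 0]
    proof eventually_elim
      case (elim k)
      then have "real k < real (cnt p \<Omega> (b * real k powr (p / ?N)))" by (simp add: less_divide_eq)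
      then show ?case unfolding adm_iff_le_cnt[OF p \<Omega>(2)] by simp
    qed
  qed
  have "(\<lambda>k. cogenus_eigenvalue p \<Omega> k / real k powr (p / ?N)) \<longlonglongrightarrow> \<Lambda>"
  proof (rule order_tendstoI)
    fix b assume b: "\<Lambda> < b"
    then obtain b' where b': "\<Lambda> < b'" "b' < b" using dense by blast
    from ev_adm[OF b'(1)] eventually_gt_at_top[of 0]
    show "\<forall>\<^sub>F k in sequentially. cogenus_eigenvalue p \<Omega> k / real k powr (p / ?N) < b"
    proof eventually_elim
      case (elim k)
      have "cogenus_eigenvalue p \<Omega> k \<le> b' * real k powr (p / ?N)"
        by (rule cogenus_eigenvalue_le[OF p \<Omega>(1) _ elim(1)]) (use elim(2) in simp)
      then have "cogenus_eigenvalue p \<Omega> k / real k powr (p / ?N) \<le> b'" using elim(2) by (simp add: divide_le_eq)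
      then show ?case using b'(2) by linarith
    qed
  next
    fix a assume a: "a < \<Lambda>"
    \<comment> \<open>A positive number between \<open>a\<close> and \<Lambda>;
      \<open>cnt_sequence\<close> requires positivity.\<close>
    define a' where "a' = (max a 0 + \<Lambda>) / 2"
    have a': "a < a'" "0 < a'" "a' < \<Lambda>" using a \<Lambda> by (auto simp: a'_def max_def)
    have "a' powr (?N / p) < \<Lambda> powr (?N / p)" by (rule powr_less_mono2) (use a' p in auto)
    then have "W * a' powr (?N / p) < 1" using W\<Lambda> W(1) by (metis mult_less_cancel_left_pos)
    from order_tendstoD(2)[OF cnt_sequence[OF p a'(2) W(2)] this]
    have ev: "\<forall>\<^sub>F k in sequentially. real (cnt p \<Omega> (a' * real k powr (p / ?N))) / real k < 1" .
    \<comment> \<open>Any factor above \<Lambda> serves to supply odd maps for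
      \<open>cogenus_eigenvalue_ge\<close>.\<close>
    have "\<Lambda> < \<Lambda> + 1" by simp
    from ev ev_adm[OF this] eventually_gt_at_top[of 0]
    show "\<forall>\<^sub>F k in sequentially. a < cogenus_eigenvalue p \<Omega> k / real k powr (p / ?N)"
    proof eventually_elim
      case (elim k)
      have "real (cnt p \<Omega> (a' * real k powr (p / ?N))) < real k" using elim(1,3) by (simp add: divide_less_eq)
      then have na: "\<not> adm p \<Omega> k (a' * real k powr (p / ?N))" unfolding adm_iff_le_cnt[OF p \<Omega>(2)] by simp
      have "a' * real k powr (p / ?N) \<le> cogenus_eigenvalue p \<Omega> k"
        by (rule cogenus_eigenvalue_ge[OF p \<Omega>(1) _ na elim(2)]) (use elim(3) in simp)
      then have "a' \<le> cogenus_eigenvalue p \<Omega> k / real k powr (p / ?N)" using elim(3) by (simp add: le_divide_eq)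
      then show ?case using a'(1) by linarith
    qed
  qed
  then show ?thesis by (simp add: \<Lambda>_def)
qed

theorem theorem1p7:
  fixes p :: real
  assumes "CARD('n::finite) \<ge> 2" and "1 < p"
  shows "\<exists>C>0. \<forall>\<Omega> :: (real^'n) set. bounded_lipschitz_domain \<Omega> \<longrightarrow>
           (\<lambda>k. cogenus_eigenvalue p \<Omega> k / real k powr (p / real CARD('n)))
             \<longlonglongrightarrow> C / measure lebesgue \<Omega> powr (p / real CARD('n))"
proof -
  obtain L where L: "0 < L" "((\<lambda>s. real (cnt p (ucube :: (real^'n) set) (s powr p)) / s ^ CARD('n)) \<longlongrightarrow> L) at_top"
    using cnt_ucube_asymptotic[OF assms(2)] by blast
  have "(\<lambda>k. cogenus_eigenvalue p \<Omega> k / real k powr (p / real CARD('n)))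
        \<longlonglongrightarrow> L powr (- p / real CARD('n)) / measure lebesgue \<Omega> powr (p / real CARD('n))"
    if "bounded_lipschitz_domain \<Omega>" for \<Omega> :: "(real^'n) set"
  proof -
    have \<Omega>: "bounded \<Omega>" "open \<Omega>" "\<Omega> \<noteq> {}" "lipschitz_boundary \<Omega>"
      using that by (auto simp: bounded_lipschitz_domain_def Defs.domain_def)
    have "\<not> negligible \<Omega>" by (rule open_not_negligible[OF \<Omega>(2,3)])
    then have m: "0 < measure lebesgue \<Omega>"
      using lmeasurable_open[OF \<Omega>(1,2)] by (simp add: negligible_iff_measure zero_less_measure_iff)
    \<comment> \<open>The Lipschitz condition enters as the statement that the boundary is a null
      set, on which the upper bound rests.\<close>
    have neg: "negligible (frontier \<Omega>)" by (rule lipschitz_boundary_negligible[OF \<Omega>(2,4)])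
    have "((\<lambda>t. real (cnt p \<Omega> (t powr p)) / t ^ CARD('n)) \<longlongrightarrow> L * measure lebesgue \<Omega>) at_top"
      by (rule order_tendstoI) (rule cnt_lower[OF assms(2) \<Omega>(2,1) L], assumption, rule cnt_upper[OF assms(2) \<Omega>(2,1) neg L])
    from cogenus_eigenvalue_limit[OF assms(2) \<Omega>(2,1) _ this] L(1) m
    have "(\<lambda>k. cogenus_eigenvalue p \<Omega> k / real k powr (p / real CARD('n)))
        \<longlonglongrightarrow> (L * measure lebesgue \<Omega>) powr (- p / real CARD('n))" by simp
    also have "(L * measure lebesgue \<Omega>) powr (- p / real CARD('n))
        = L powr (- p / real CARD('n)) / measure lebesgue \<Omega> powr (p / real CARD('n))"
      unfolding powr_mult by (simp add: powr_minus divide_inverse)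
    finally show ?thesis .
  qed
  then show ?thesis using L(1) by (intro exI[of _ "L powr (- p / real CARD('n))"]) simp
qed

end
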